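(* Let $\kappa\in\{0,1,-1\}$, let $F$ be a curvature function satisfying conditions (i)--(iv) listed in the context, and let $M_t$ $(0\le t<T)$ be a family of smooth, closed, strictly convex surfaces in the space form $\mathbb{R}^3(\kappa)$ moving according to $$\frac{\partial}{\partial t}X(x,t)=F^{-\alpha}(x,t)\,\nu(x,t).$$ Assume that $\alpha\in(0,1]$ for $\kappa=0,-1$, and that $\alpha=1$ for $\kappa=1$. Then the pinching ratio of $M_t$ is no greater than the pinching ratio of $M_0$; i.e., there exists a constant $\beta>1$ which depends only on $M_0$ such that $$\lambda_2\le\beta\lambda_1$$ on $M_t$ for all $t\in[0,T)$, where $\lambda_1\le\lambda_2$ are the principal curvatures of $M_t$.
   Context: The pinching ratio of a strictly convex surface is the supremum over the surface of the ratio of the largest to the smallest principal curvature at each point. $\mathbb{R}^3(0)=\mathbb{R}^3$, $\mathbb{R}^3(1)=\mathbb{S}^3$, $\mathbb{R}^3(-1)=\mathbb{H}^3$. Let $\Gamma_+=\{(\lambda_1,\lambda_2)\in\mathbb{R}^2:\lambda_1>0,\lambda_2>0\}$. The function $F$ satisfies: (i) $F$ is smooth, symmetric and positive on $\Gamma_+$; (ii) $\partial F/\partial\lambda_i>0$ on $\Gamma_+$ for $i=1,2$; (iii) $F(k\lambda)=kF(\lambda)$ for all $k>0$, $\lambda\in\Gamma_+$; (iv) $F(1,1)=2$. In the flow, $M_t=X(M,t)$, $F(x,t)=F(\lambda_1(x,t),\lambda_2(x,t))$ is evaluated at the principal curvatures of $M_t$, and $\nu$ is the outer unit normal; the sign convention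 is $h_{ij}=-\bar g(\bar\nabla_{\partial_i X}\partial_j X,\nu)$. Strictly convex means that all principal curvatures are positive. *)

theory Defs
  imports "HOL-Analysis.Analysis"
begin

subsection \<open>Smooth maps\<close>

text \<open>Intended for open \<open>S\<close> only.\<close>

primrec Ck_on :: "nat \<Rightarrow> ('a::euclidean_space \<Rightarrow> 'b::euclidean_space) \<Rightarrow> 'a set \<Rightarrow> bool" where
  "Ck_on 0 f S \<longleftrightarrow> continuous_on S f"
| "Ck_on (Suc k) f S \<longleftrightarrow>
     f differentiable_on S \<and> (\<forall>v. Ck_on k (\<lambda>x. frechet_derivative f (at x) v) S)"

text \<open>On a set that need not be open, such as \<open>[0,T) \<times> V\<close>, smoothness means that there are local
  smooth extensions.\<close>

definition smooth_on :: "'a::euclidean_space set \<Rightarrow> ('a \<Rightarrow> 'b::euclidean_space) \<Rightarrow> bool" where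
  "smooth_on S f \<longleftrightarrow> (\<forall>x\<in>S. \<exists>U g. open U \<and> x \<in> U \<and> (\<forall>k. Ck_on k g U) \<and> (\<forall>y\<in>S \<inter> U. g y = f y))"

subsection \<open>Closed smooth surfaces\<close>

text \<open>A chart is a pair \<open>(U, \<phi>)\<close>; its local parametrization is \<open>inv_into U \<phi>\<close> on \<open>\<phi> ` U\<close>.
  Second countability is automatic for a compact locally Euclidean space.\<close>

type_synonym 'm chart = "'m set \<times> ('m \<Rightarrow> real^2)"

definition closed_surface :: "'m::t2_space set \<Rightarrow> 'm chart set \<Rightarrow> bool" where
  "closed_surface M A \<longleftrightarrow>
     M \<noteq> {} \<and> compact M \<and> connected M \<and>
     (\<Union>(U, \<phi>)\<in>A. U) = M \<and>
     (\<forall>(U, \<phi>)\<in>A. openin (top_of_set M) U \<and> open (\<phi> ` U) \<and>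
                 homeomorphism U (\<phi> ` U) \<phi> (inv_into U \<phi>)) \<and>
     (\<forall>(U, \<phi>)\<in>A. \<forall>(V, \<psi>)\<in>A. smooth_on (\<phi> ` (U \<inter> V)) (\<psi> \<circ> inv_into U \<phi>))"

subsection \<open>The space forms\<close>

text \<open>All three space forms are realised in \<open>\<real> \<times> \<real>\<^sup>3\<close>: for \<open>\<kappa> = 0\<close> as the affine
  hyperplane \<open>{1} \<times> \<real>\<^sup>3\<close>, for \<open>\<kappa> = 1\<close> as the unit sphere, and for \<open>\<kappa> = -1\<close> as the upper sheet of
  the hyperboloid in Minkowski space.  In each case the Riemannian metric is the restriction to
  tangent vectors of the bilinear form \<open>sf_inner \<kappa>\<close>.\<close>

type_synonym ambient = "real \<times> (real^3)"

definition sf_inner :: "real \<Rightarrow> ambient \<Rightarrow> ambient \<Rightarrow> real" where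
  "sf_inner \<kappa> v w = snd v \<bullet> snd w + \<kappa> * (fst v * fst w)"

definition space_form :: "real \<Rightarrow> ambient set" where
  "space_form \<kappa> = {p. (fst p)\<^sup>2 + \<kappa> * (snd p \<bullet> snd p) = 1 \<and> (\<kappa> \<le> 0 \<longrightarrow> fst p > 0)}"

definition sf_tangent :: "real \<Rightarrow> ambient \<Rightarrow> ambient set" where
  "sf_tangent \<kappa> p = {v. fst p * fst v + \<kappa> * (snd p \<bullet> snd v) = 0}"

text \<open>The Levi-Civita derivative of a tangent field along a map is the tangential part of its
  ambient derivative \<open>w\<close>.  For \<open>\<kappa> = \<plusminus>1\<close> the position vector \<open>p\<close> is normal to the space form and
  \<open>sf_inner \<kappa> p p = \<kappa>\<close>; for \<open>\<kappa> = 0\<close> nothing is subtracted.\<close>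

definition sf_tangential_part :: "real \<Rightarrow> ambient \<Rightarrow> ambient \<Rightarrow> ambient" where
  "sf_tangential_part \<kappa> p w = w - (\<kappa> * sf_inner \<kappa> w p) *\<^sub>R p"

text \<open>The geodesic with initial point \<open>p\<close> and initial unit velocity \<open>v\<close>.\<close>

definition sf_geodesic :: "real \<Rightarrow> ambient \<Rightarrow> ambient \<Rightarrow> real \<Rightarrow> ambient" where
  "sf_geodesic \<kappa> p v s =
     (if \<kappa> = 0 then p + s *\<^sub>R v
      else if \<kappa> > 0 then cos s *\<^sub>R p + sin s *\<^sub>R v
      else cosh s *\<^sub>R p + sinh s *\<^sub>R v)"

subsection \<open>Geometry of an immersed surface\<close>

definition partial :: "2 \<Rightarrow> (real^2 \<Rightarrow> ambient) \<Rightarrow> real^2 \<Rightarrow> ambient" where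
  "partial i Y u = frechet_derivative Y (at u) (axis i 1)"

definition local_param :: "('m \<Rightarrow> ambient) \<Rightarrow> 'm chart \<Rightarrow> real^2 \<Rightarrow> ambient" where
  "local_param X c = X \<circ> inv_into (fst c) (snd c)"

definition smooth_immersion ::
  "real \<Rightarrow> 'm::t2_space set \<Rightarrow> 'm chart set \<Rightarrow> ('m \<Rightarrow> ambient) \<Rightarrow> bool" where
  "smooth_immersion \<kappa> M A X \<longleftrightarrow>
     X ` M \<subseteq> space_form \<kappa> \<and>
     (\<forall>c\<in>A. smooth_on (snd c ` fst c) (local_param X c) \<and>
            (\<forall>u\<in>snd c ` fst c. inj (frechet_derivative (local_param X c) (at u))))"

definition unit_normal ::
  "real \<Rightarrow> 'm::t2_space set \<Rightarrow> 'm chart set \<Rightarrow> ('m \<Rightarrow> ambient) \<Rightarrow> ('m \<Rightarrow> ambient) \<Rightarrow> bool" where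
  "unit_normal \<kappa> M A X \<nu> \<longleftrightarrow>
     (\<forall>x\<in>M. \<nu> x \<in> sf_tangent \<kappa> (X x) \<and> sf_inner \<kappa> (\<nu> x) (\<nu> x) = 1 \<and>
        (\<forall>c\<in>A. x \<in> fst c \<longrightarrow>
           (\<forall>i. sf_inner \<kappa> (partial i (local_param X c) (snd c x)) (\<nu> x) = 0)))"

text \<open>The normal points out of the region \<open>\<Omega>\<close> enclosed by the surface.  For \<open>\<kappa> \<le> 0\<close> boundedness
  singles out the inside.  On the sphere both sides of the surface are bounded; there the
  requirement of strict convexity (positive principal curvatures) with respect to the normal
  determines which side is the enclosed one.\<close>

definition outer_unit_normal ::
  "real \<Rightarrow> 'm::t2_space set \<Rightarrow> 'm chart set \<Rightarrow> ('m \<Rightarrow> ambient) \<Rightarrow> ('m \<Rightarrow> ambient) \<Rightarrow> bool" where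
  "outer_unit_normal \<kappa> M A X \<nu> \<longleftrightarrow>
     unit_normal \<kappa> M A X \<nu> \<and>
     (\<exists>\<Omega>. openin (top_of_set (space_form \<kappa>)) \<Omega> \<and> bounded \<Omega> \<and>
          top_of_set (space_form \<kappa>) frontier_of \<Omega> = X ` M \<and>
          (\<forall>x\<in>M. \<exists>\<epsilon>>0. \<forall>s\<in>{0<..<\<epsilon>}.
              sf_geodesic \<kappa> (X x) (\<nu> x) s \<notin> \<Omega> \<and> sf_geodesic \<kappa> (X x) (\<nu> x) (- s) \<in> \<Omega>))"

definition first_fundamental_form ::
  "real \<Rightarrow> ('m \<Rightarrow> ambient) \<Rightarrow> 'm chart \<Rightarrow> 'm \<Rightarrow> real^2^2" where
  "first_fundamental_form \<kappa> X c x =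
     (let Y = local_param X c; u = snd c x
      in \<chi> i j. sf_inner \<kappa> (partial i Y u) (partial j Y u))"

definition second_fundamental_form ::
  "real \<Rightarrow> ('m \<Rightarrow> ambient) \<Rightarrow> ('m \<Rightarrow> ambient) \<Rightarrow> 'm chart \<Rightarrow> 'm \<Rightarrow> real^2^2" where
  "second_fundamental_form \<kappa> X \<nu> c x =
     (let Y = local_param X c; u = snd c x
      in \<chi> i j. - sf_inner \<kappa> (sf_tangential_part \<kappa> (Y u) (partial i (partial j Y) u)) (\<nu> x))"

definition weingarten ::
  "real \<Rightarrow> ('m \<Rightarrow> ambient) \<Rightarrow> ('m \<Rightarrow> ambient) \<Rightarrow> 'm chart \<Rightarrow> 'm \<Rightarrow> real^2^2" where
  "weingarten \<kappa> X \<nu> c x =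
     matrix_inv (first_fundamental_form \<kappa> X c x) ** second_fundamental_form \<kappa> X \<nu> c x"

text \<open>The eigenvalues of the Weingarten matrix do not depend on the chart, so the set below is the
  spectrum of the Weingarten map, with one or two elements.\<close>

definition principal_curvatures ::
  "real \<Rightarrow> 'm chart set \<Rightarrow> ('m \<Rightarrow> ambient) \<Rightarrow> ('m \<Rightarrow> ambient) \<Rightarrow> 'm \<Rightarrow> real set" where
  "principal_curvatures \<kappa> A X \<nu> x =
     {l. \<exists>c\<in>A. x \<in> fst c \<and> (\<exists>v. v \<noteq> 0 \<and> weingarten \<kappa> X \<nu> c x *v v = l *\<^sub>R v)}"

definition lambda1 ::
  "real \<Rightarrow> 'm chart set \<Rightarrow> ('m \<Rightarrow> ambient) \<Rightarrow> ('m \<Rightarrow> ambient) \<Rightarrow> 'm \<Rightarrow> real" where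
  "lambda1 \<kappa> A X \<nu> x = Min (principal_curvatures \<kappa> A X \<nu> x)"

definition lambda2 ::
  "real \<Rightarrow> 'm chart set \<Rightarrow> ('m \<Rightarrow> ambient) \<Rightarrow> ('m \<Rightarrow> ambient) \<Rightarrow> 'm \<Rightarrow> real" where
  "lambda2 \<kappa> A X \<nu> x = Max (principal_curvatures \<kappa> A X \<nu> x)"

definition strictly_convex ::
  "real \<Rightarrow> 'm::t2_space set \<Rightarrow> 'm chart set \<Rightarrow> ('m \<Rightarrow> ambient) \<Rightarrow> ('m \<Rightarrow> ambient) \<Rightarrow> bool" where
  "strictly_convex \<kappa> M A X \<nu> \<longleftrightarrow> (\<forall>x\<in>M. \<forall>l\<in>principal_curvatures \<kappa> A X \<nu> x. l > 0)"

definition pinching_ratio ::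
  "real \<Rightarrow> 'm::t2_space set \<Rightarrow> 'm chart set \<Rightarrow> ('m \<Rightarrow> ambient) \<Rightarrow> ('m \<Rightarrow> ambient) \<Rightarrow> ereal" where
  "pinching_ratio \<kappa> M A X \<nu> = (SUP x\<in>M. ereal (lambda2 \<kappa> A X \<nu> x / lambda1 \<kappa> A X \<nu> x))"

subsection \<open>Curvature functions and the flow\<close>

definition Gamma_plus :: "(real^2) set" where
  "Gamma_plus = {l. l $ 1 > 0 \<and> l $ 2 > 0}"

definition curvature_function :: "(real^2 \<Rightarrow> real) \<Rightarrow> bool" where
  "curvature_function F \<longleftrightarrow>
     smooth_on Gamma_plus F \<and>
     (\<forall>l\<in>Gamma_plus. F (vector [l $ 2, l $ 1]) = F l) \<and>
     (\<forall>l\<in>Gamma_plus. F l > 0) \<and>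
     (\<forall>l\<in>Gamma_plus. \<forall>i. frechet_derivative F (at l) (axis i 1) > 0) \<and>
     (\<forall>k>0. \<forall>l\<in>Gamma_plus. F (k *\<^sub>R l) = k * F l) \<and>
     F (vector [1, 1]) = 2"

definition admissible_exponent :: "real \<Rightarrow> real \<Rightarrow> bool" where
  "admissible_exponent \<kappa> \<alpha> \<longleftrightarrow>
     (\<kappa> \<in> {0, -1} \<longrightarrow> \<alpha> \<in> {0<..1}) \<and> (\<kappa> = 1 \<longrightarrow> \<alpha> = 1)"

definition time_interval :: "ereal \<Rightarrow> real set" where
  "time_interval T = {t. 0 \<le> t \<and> ereal t < T}"

text \<open>At time 0 the velocity is the one-sided derivative.\<close>

definition expanding_flow ::
  "real \<Rightarrow> (real^2 \<Rightarrow> real) \<Rightarrow> real \<Rightarrow> 'm::t2_space set \<Rightarrow> 'm chart set \<Rightarrow> ereal \<Rightarrow>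
   (real \<Rightarrow> 'm \<Rightarrow> ambient) \<Rightarrow> (real \<Rightarrow> 'm \<Rightarrow> ambient) \<Rightarrow> bool" where
  "expanding_flow \<kappa> F \<alpha> M A T X \<nu> \<longleftrightarrow>
     T > 0 \<and>
     (\<forall>c\<in>A. smooth_on (time_interval T \<times> snd c ` fst c) (\<lambda>(t, u). local_param (X t) c u)) \<and>
     (\<forall>t\<in>time_interval T.
        smooth_immersion \<kappa> M A (X t) \<and>
        outer_unit_normal \<kappa> M A (X t) (\<nu> t) \<and>
        strictly_convex \<kappa> M A (X t) (\<nu> t) \<and>
        (\<forall>x\<in>M. ((\<lambda>s. X s x) has_vector_derivative
           F (vector [lambda1 \<kappa> A (X t) (\<nu> t) x, lambda2 \<kappa> A (X t) (\<nu> t) x]) powr (- \<alpha>) *\<^sub>R \<nu> t x)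
           (at t within time_interval T)))"

end

theory Submission
  imports Defs
begin

text \<open>
  Let \<open>r = \<lambda>\<^sub>2 / \<lambda>\<^sub>1\<close>. On \<open>[0, t] \<times> M\<close> this continuous function attains its maximum, and if the
  maximum exceeds all initial values it sits at a point with positive time and \<open>\<lambda>\<^sub>1 < \<lambda>\<^sub>2\<close>. Near such a
  point the curvatures and the unit principal directions \<open>e\<^sub>1, e\<^sub>2\<close> are smooth, and the flow is
  described by the structure equations of this moving frame. They give the evolution equations of
  \<open>\<lambda>\<^sub>1\<close> and \<open>\<lambda>\<^sub>2\<close>, which contain second derivatives of the speed \<open>\<phi> = F\<^sup>-\<^sup>\<alpha>\<close>. By the Codazzi
  equations the connection coefficients are first derivatives of the curvatures, so that the Gauss
  equation exchanges the second derivatives \<open>e\<^sub>2 e\<^sub>2 \<lambda>\<^sub>1\<close> and \<open>e\<^sub>1 e\<^sub>1 \<lambda>\<^sub>2\<close>. At the maximum,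
  where \<open>r\<close> is critical in space, all remaining gradient terms have a good sign because
  \<open>\<alpha> \<le> 1 < (\<lambda>\<^sub>1 + \<lambda>\<^sub>2) / (\<lambda>\<^sub>2 - \<lambda>\<^sub>1)\<close>, and the zero order term is a negative multiple of
  \<open>(1 + \<alpha>) \<lambda>\<^sub>1 \<lambda>\<^sub>2 - (1 - \<alpha>) \<kappa> > 0\<close>. So the time derivative of \<open>r\<close> is negative there, a contradiction.
\<close>

subsection \<open>Smooth functions on open sets\<close>

text \<open>Homogeneity gives F(l, r l) = l F(1, r), so log \<phi> has the differential -\<alpha> (d
  log \<open>l1\<close> + G dr), where G is the derivative of log F(1, r) in r. Where the spatial
  part of dr vanishes, a second spatial differentiation multiplies the derivative of G by zero:
  second derivatives of F drop out and only 0 \<le> r G \<le> 1 is left of F, by monotonicity and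
  Euler's identity. The obstacle is the combination e2 e2 \<open>l1\<close> - r e1 e1
  \<open>l1\<close>, about which a maximum of r alone says nothing; the Gauss equation supplies
  exactly this combination. The time direction and the two principal directions are treated as
  vector fields on an open set of space-time. The Codazzi, Gauss and evolution equations are then
  commutators of two such fields, applied to position, normal or frame vectors, and the changing
  metric needs no separate account. Smooth principal frames are built away from umbilic points only,
  but r takes its least value 1 at those points.\<close>

definition smooth_in :: "'a::euclidean_space set \<Rightarrow> ('a \<Rightarrow> 'b::euclidean_space) \<Rightarrow> bool" where
  "smooth_in S f \<longleftrightarrow> (\<forall>k. Ck_on k f S)"

text \<open>The direction is a field instead of a fixed vector, so that \<open>dd E f\<close> is
  again a function of the point and can be differentiated along another field, as commutators
  require.\<close>

definition dd :: "('a::euclidean_space \<Rightarrow> 'a) \<Rightarrow> ('a \<Rightarrow> 'b::euclidean_space) \<Rightarrow> 'a \<Rightarrow> 'b" where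
  "dd E f x = frechet_derivative f (at x) (E x)"

section \<open>Locality and closure properties of the differentiability classes\<close>

lemma frechet_derivative_cong_open:
  assumes "open S" "x \<in> S" "\<And>y. y \<in> S \<Longrightarrow> f y = g y"
  shows "frechet_derivative f (at x) = frechet_derivative g (at x)"
proof -
  have "(f has_derivative d) (at x) \<longleftrightarrow> (g has_derivative d) (at x)" for d
    using assms by (metis has_derivative_transform_within_open)
  then show ?thesis unfolding frechet_derivative_def by simp
qed

lemma differentiable_on_cong_open:
  assumes "open S" "\<And>y. y \<in> S \<Longrightarrow> f y = g y" "f differentiable_on S"
  shows "g differentiable_on S"
  using assms unfolding differentiable_on_def
  by (metis differentiable_transform_within zero_less_one)

lemma Ck_on_cong_imp:
  assumes "open S" "\<And>x. x \<in> S \<Longrightarrow> f x = g x" "Ck_on k f S"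
  shows "Ck_on k g S"
  using assms(2,3)
proof (induction k arbitrary: f g)
  case 0
  then show ?case using continuous_on_cong by fastforce
next
  case (Suc k)
  have "g differentiable_on S"
    using differentiable_on_cong_open[OF assms(1) Suc.prems(1)] Suc.prems(2) by simp
  moreover have "Ck_on k (\<lambda>x. frechet_derivative g (at x) v) S" for v
  proof (rule Suc.IH)
    show "Ck_on k (\<lambda>x. frechet_derivative f (at x) v) S" using Suc.prems(2) by simp
    show "frechet_derivative f (at x) v = frechet_derivative g (at x) v" if "x \<in> S" for x
      using frechet_derivative_cong_open[OF assms(1) that Suc.prems(1)] by simp
  qed
  ultimately show ?case by simp
qed

lemma Ck_on_subset: "Ck_on k f S \<Longrightarrow> T \<subseteq> S \<Longrightarrow> Ck_on k f T"
  by (induction k arbitrary: f) (auto intro: continuous_on_subset differentiable_on_subset)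

lemma Ck_on_SucD: "Ck_on (Suc k) f S \<Longrightarrow> Ck_on k f S"
  by (induction k arbitrary: f) (auto intro: differentiable_imp_continuous_on)

lemma Ck_on_has_derivative:
  assumes "open S" "Ck_on (Suc k) f S" "x \<in> S"
  shows "(f has_derivative frechet_derivative f (at x)) (at x)"
  using assms by (metis Ck_on.simps(2) differentiable_on_eq_differentiable_at frechet_derivative_works)

lemma Ck_on_SucI:
  assumes "open S" "\<And>x. x \<in> S \<Longrightarrow> (f has_derivative f' x) (at x)"
    and "\<And>v. Ck_on k (\<lambda>x. f' x v) S"
  shows "Ck_on (Suc k) f S"
proof -
  have "f differentiable_on S"
    using assms(1,2) by (meson differentiable_def differentiable_on_eq_differentiable_at)
  moreover have "Ck_on k (\<lambda>x. frechet_derivative f (at x) v) S" for v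
    by (rule Ck_on_cong_imp[OF assms(1) _ assms(3)[of v]])
      (simp add: frechet_derivative_at[OF assms(2), symmetric])
  ultimately show ?thesis by simp
qed

lemma Ck_on_const: "open S \<Longrightarrow> Ck_on k (\<lambda>x. c) S"
proof (induction k arbitrary: c)
  case (Suc k)
  show ?case
    by (rule Ck_on_SucI[OF Suc.prems has_derivative_const]) (rule Suc.IH[OF Suc.prems])
qed simp

lemma Ck_on_add:
  "open S \<Longrightarrow> Ck_on k f S \<Longrightarrow> Ck_on k g S \<Longrightarrow> Ck_on k (\<lambda>x. f x + g x) S"
proof (induction k arbitrary: f g)
  case (Suc k)
  note d = Ck_on_has_derivative[OF Suc.prems(1)]
  show ?case
    using Suc.prems
    by (intro Ck_on_SucI[OF Suc.prems(1) has_derivative_add[OF d[OF Suc.prems(2)] d[OF Suc.prems(3)]]]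
        Suc.IH) auto
qed (auto intro: continuous_intros)

lemma Ck_on_bilinear:
  assumes h: "bounded_bilinear h"
  shows "open S \<Longrightarrow> Ck_on k f S \<Longrightarrow> Ck_on k g S \<Longrightarrow> Ck_on k (\<lambda>x. h (f x) (g x)) S"
proof (induction k arbitrary: f g)
  case 0
  then show ?case using bounded_bilinear.continuous_on[OF h] by simp
next
  case (Suc k)
  note IH = Suc.IH[OF \<open>open S\<close>]
  show ?case
  proof (rule Ck_on_SucI[OF \<open>open S\<close>])
    show "((\<lambda>x. h (f x) (g x)) has_derivative
        (\<lambda>v. h (f x) (frechet_derivative g (at x) v) + h (frechet_derivative f (at x) v) (g x))) (at x)"
      if "x \<in> S" for x
      by (rule bounded_bilinear.FDERIV[OF h]; rule Ck_on_has_derivative) (use Suc.prems that in auto)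
    show "Ck_on k (\<lambda>x. h (f x) (frechet_derivative g (at x) v) + h (frechet_derivative f (at x) v) (g x)) S" for v
      using Suc.prems Ck_on_SucD[OF Suc.prems(2)] Ck_on_SucD[OF Suc.prems(3)]
      by (intro Ck_on_add IH) auto
  qed
qed

lemma Ck_on_inverse:
  fixes f :: "'a::euclidean_space \<Rightarrow> real"
  shows "open S \<Longrightarrow> (\<And>x. x \<in> S \<Longrightarrow> f x \<noteq> 0) \<Longrightarrow> Ck_on k f S \<Longrightarrow> Ck_on k (\<lambda>x. inverse (f x)) S"
proof (induction k)
  case 0
  then show ?case by (auto intro: continuous_intros)
next
  case (Suc k)
  have inv: "Ck_on k (\<lambda>x. inverse (f x)) S" using Suc Ck_on_SucD by blast
  have "Ck_on k (\<lambda>x. (-1) * ((inverse (f x) * frechet_derivative f (at x) v) * inverse (f x))) S" for v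
    using Suc.prems inv by (intro Ck_on_bilinear[OF bounded_bilinear_mult] Ck_on_const) auto
  then have "Ck_on k (\<lambda>x. - (inverse (f x) * frechet_derivative f (at x) v * inverse (f x))) S" for v
    by simp
  from Ck_on_SucI[OF Suc.prems(1) Deriv.has_derivative_inverse[OF Suc.prems(2)
        Ck_on_has_derivative[OF Suc.prems(1,3)]] this]
  show ?case .
qed

lemma Ck_on_sqrt:
  fixes f :: "'a::euclidean_space \<Rightarrow> real"
  shows "open S \<Longrightarrow> (\<And>x. x \<in> S \<Longrightarrow> f x > 0) \<Longrightarrow> Ck_on k f S \<Longrightarrow> Ck_on k (\<lambda>x. sqrt (f x)) S"
proof (induction k)
  case 0
  then show ?case by (auto intro: continuous_intros)
next
  case (Suc k)
  have sq: "Ck_on k (\<lambda>x. inverse (sqrt (f x))) S"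
    using Suc Ck_on_SucD by (intro Ck_on_inverse) (auto simp: less_imp_neq[symmetric])
  show ?case
  proof (rule Ck_on_SucI[OF \<open>open S\<close>])
    show "((\<lambda>x. sqrt (f x)) has_derivative
        (\<lambda>v. frechet_derivative f (at x) v * (inverse (sqrt (f x)) * (1/2)))) (at x)" if "x \<in> S" for x
    proof -
      have "(f has_derivative frechet_derivative f (at x)) (at x)"
        using Ck_on_has_derivative[OF Suc.prems(1,3) that] .
      moreover have "((\<lambda>s. sqrt s) has_derivative (\<lambda>h. h * (inverse (sqrt (f x)) * (1/2)))) (at (f x))"
        using DERIV_real_sqrt[OF Suc.prems(2)[OF that]]
        unfolding has_field_derivative_def by (rule has_derivative_eq_rhs) (auto simp: fun_eq_iff)
      ultimately show ?thesis by (rule has_derivative_compose)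
    qed
    show "Ck_on k (\<lambda>x. frechet_derivative f (at x) v * (inverse (sqrt (f x)) * (1/2))) S" for v
      using Suc.prems sq by (intro Ck_on_bilinear[OF bounded_bilinear_mult] Ck_on_const) auto
  qed
qed

named_theorems smooth_intros

lemma smooth_in_cong_imp:
  "open S \<Longrightarrow> (\<And>x. x \<in> S \<Longrightarrow> f x = g x) \<Longrightarrow> smooth_in S f \<Longrightarrow> smooth_in S g"
  unfolding smooth_in_def using Ck_on_cong_imp by blast

lemma smooth_in_subset: "smooth_in S f \<Longrightarrow> T \<subseteq> S \<Longrightarrow> smooth_in T f"
  unfolding smooth_in_def using Ck_on_subset by blast

lemma smooth_in_continuous_on: "smooth_in S f \<Longrightarrow> continuous_on S f"
  unfolding smooth_in_def using Ck_on.simps(1) by blast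

lemma smooth_in_has_derivative:
  "open S \<Longrightarrow> smooth_in S f \<Longrightarrow> x \<in> S \<Longrightarrow> (f has_derivative frechet_derivative f (at x)) (at x)"
  unfolding smooth_in_def using Ck_on_has_derivative by blast

lemma smooth_in_const [smooth_intros]: "open S \<Longrightarrow> smooth_in S (\<lambda>x. c)"
  by (simp add: smooth_in_def Ck_on_const)

lemma smooth_in_add [smooth_intros]:
  "open S \<Longrightarrow> smooth_in S f \<Longrightarrow> smooth_in S g \<Longrightarrow> smooth_in S (\<lambda>x. f x + g x)"
  by (simp add: smooth_in_def Ck_on_add)

lemma smooth_in_bilinear:
  "bounded_bilinear h \<Longrightarrow> open S \<Longrightarrow> smooth_in S f \<Longrightarrow> smooth_in S g \<Longrightarrow> smooth_in S (\<lambda>x. h (f x) (g x))"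
  by (simp add: smooth_in_def Ck_on_bilinear)

lemmas smooth_in_mult [smooth_intros] = smooth_in_bilinear[OF bounded_bilinear_mult]
lemmas smooth_in_scaleR [smooth_intros] = smooth_in_bilinear[OF bounded_bilinear_scaleR]
lemmas smooth_in_inner [smooth_intros] = smooth_in_bilinear[OF bounded_bilinear_inner]

lemma smooth_in_minus [smooth_intros]:
  assumes "open S" "smooth_in S f" shows "smooth_in S (\<lambda>x. - f x)"
  using smooth_in_scaleR[OF assms(1) smooth_in_const[OF assms(1), of "-1"] assms(2)] by simp

lemma smooth_in_diff [smooth_intros]:
  "open S \<Longrightarrow> smooth_in S f \<Longrightarrow> smooth_in S g \<Longrightarrow> smooth_in S (\<lambda>x. f x - g x)"
  using smooth_in_add[of S f "\<lambda>x. - g x"] smooth_in_minus[of S g] by simp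

lemma smooth_in_divide [smooth_intros]:
  fixes f g :: "'a::euclidean_space \<Rightarrow> real"
  shows "open S \<Longrightarrow> smooth_in S f \<Longrightarrow> smooth_in S g \<Longrightarrow> (\<And>x. x \<in> S \<Longrightarrow> g x \<noteq> 0)
    \<Longrightarrow> smooth_in S (\<lambda>x. f x / g x)"
  unfolding divide_inverse
  by (intro smooth_in_mult) (auto simp: smooth_in_def intro: Ck_on_inverse)

lemma smooth_in_sqrt [smooth_intros]:
  fixes f :: "'a::euclidean_space \<Rightarrow> real"
  shows "open S \<Longrightarrow> smooth_in S f \<Longrightarrow> (\<And>x. x \<in> S \<Longrightarrow> f x > 0) \<Longrightarrow> smooth_in S (\<lambda>x. sqrt (f x))"
  by (auto simp: smooth_in_def intro: Ck_on_sqrt)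

lemma smooth_in_sum:
  "finite I \<Longrightarrow> open S \<Longrightarrow> (\<And>i. i \<in> I \<Longrightarrow> smooth_in S (f i)) \<Longrightarrow> smooth_in S (\<lambda>x. \<Sum>i\<in>I. f i x)"
  by (induction I rule: finite_induct) (auto intro: smooth_intros)

lemma smooth_in_frechet: "smooth_in S f \<Longrightarrow> smooth_in S (\<lambda>x. frechet_derivative f (at x) v)"
  unfolding smooth_in_def by (metis Ck_on.simps(2))

text \<open>Expanding \<open>E x\<close> in the standard basis reduces the claim to derivatives in
  constant directions, which are smooth by the definition of \<open>Ck_on\<close>.\<close>

lemma smooth_in_dd [smooth_intros]:
  assumes "open S" "smooth_in S E" "smooth_in S f"
  shows "smooth_in S (dd E f)"
proof (rule smooth_in_cong_imp[OF assms(1)])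
  show "smooth_in S (\<lambda>x. \<Sum>b\<in>Basis. (E x \<bullet> b) *\<^sub>R frechet_derivative f (at x) b)"
    using assms by (intro smooth_in_sum smooth_intros smooth_in_frechet) auto
  fix x assume "x \<in> S"
  then have "linear (frechet_derivative f (at x))"
    using smooth_in_has_derivative[OF assms(1,3)] has_derivative_linear by blast
  then show "(\<Sum>b\<in>Basis. (E x \<bullet> b) *\<^sub>R frechet_derivative f (at x) b) = dd E f x"
    unfolding dd_def
    by (subst (2) euclidean_representation[symmetric]) (simp add: linear_sum linear_scale)
qed

section \<open>Rules for derivatives along vector fields\<close>

lemma dd_cong_open:
  "open S \<Longrightarrow> x \<in> S \<Longrightarrow> (\<And>y. y \<in> S \<Longrightarrow> f y = g y) \<Longrightarrow> dd E f x = dd E g x"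
  unfolding dd_def using frechet_derivative_cong_open by metis

lemma dd_eqI: "(f has_derivative D) (at x) \<Longrightarrow> dd E f x = D (E x)"
  unfolding dd_def by (metis frechet_derivative_at)

lemma dd_const: "dd E (\<lambda>x. c) x = 0"
  by (simp add: dd_def)

lemma dd_add:
  "open S \<Longrightarrow> smooth_in S f \<Longrightarrow> smooth_in S g \<Longrightarrow> x \<in> S \<Longrightarrow> dd E (\<lambda>x. f x + g x) x = dd E f x + dd E g x"
  by (rule trans[OF dd_eqI[OF has_derivative_add[OF smooth_in_has_derivative smooth_in_has_derivative]]])
    (auto simp: dd_def)

lemma dd_minus:
  "open S \<Longrightarrow> smooth_in S f \<Longrightarrow> x \<in> S \<Longrightarrow> dd E (\<lambda>x. - f x) x = - dd E f x"
  by (rule trans[OF dd_eqI[OF has_derivative_minus[OF smooth_in_has_derivative]]]) (auto simp: dd_def)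

lemma dd_diff:
  "open S \<Longrightarrow> smooth_in S f \<Longrightarrow> smooth_in S g \<Longrightarrow> x \<in> S \<Longrightarrow> dd E (\<lambda>x. f x - g x) x = dd E f x - dd E g x"
  by (rule trans[OF dd_eqI[OF has_derivative_diff[OF smooth_in_has_derivative smooth_in_has_derivative]]])
    (auto simp: dd_def)

lemma dd_bilinear:
  assumes "bounded_bilinear h"
  shows "open S \<Longrightarrow> smooth_in S f \<Longrightarrow> smooth_in S g \<Longrightarrow> x \<in> S \<Longrightarrow>
    dd E (\<lambda>x. h (f x) (g x)) x = h (f x) (dd E g x) + h (dd E f x) (g x)"
  by (rule trans[OF dd_eqI[OF bounded_bilinear.FDERIV[OF assms smooth_in_has_derivative smooth_in_has_derivative]]])
    (auto simp: dd_def)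

lemmas dd_mult = dd_bilinear[OF bounded_bilinear_mult]
lemmas dd_scaleR = dd_bilinear[OF bounded_bilinear_scaleR]

section \<open>Symmetry of second derivatives and Lie brackets\<close>

lemma has_real_derivative_along_line:
  assumes "open S" "f differentiable_on S" "x + s *\<^sub>R v \<in> S"
  shows "((\<lambda>s. f (x + s *\<^sub>R v)) has_real_derivative frechet_derivative f (at (x + s *\<^sub>R v)) v) (at s within T)"
proof -
  let ?d = "frechet_derivative f (at (x + s *\<^sub>R v))"
  have d: "(f has_derivative ?d) (at (x + s *\<^sub>R v))"
    using assms by (metis differentiable_on_eq_differentiable_at frechet_derivative_works)
  have "((\<lambda>s. f (x + s *\<^sub>R v)) has_derivative (\<lambda>h. ?d (h *\<^sub>R v))) (at s within T)"
    by (rule has_derivative_compose[where g=f and f="\<lambda>s. x + s *\<^sub>R v", OF _ d])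
      (auto intro!: derivative_eq_intros)
  moreover have "(\<lambda>h. ?d (h *\<^sub>R v)) = (*) (?d v)"
    using has_derivative_linear[OF d] by (auto simp: linear_scale)
  ultimately show ?thesis by (simp add: has_field_derivative_def)
qed

text \<open>Two uses of the mean value theorem: along v for the difference of f and its translate by
  h w, then along w for the derivative of f in direction v.\<close>

lemma second_difference:
  fixes f :: "'a::euclidean_space \<Rightarrow> real"
  assumes S: "open S" and f: "Ck_on 2 f S" and "h > 0"
    and sub: "\<And>a b. 0 \<le> a \<Longrightarrow> a \<le> h \<Longrightarrow> 0 \<le> b \<Longrightarrow> b \<le> h \<Longrightarrow> x + a *\<^sub>R v + b *\<^sub>R w \<in> S"
  shows "\<exists>a b. 0 < a \<and> a < h \<and> 0 < b \<and> b < h \<and>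
    f (x + h *\<^sub>R v + h *\<^sub>R w) - f (x + h *\<^sub>R v) - f (x + h *\<^sub>R w) + f x =
    h * h * frechet_derivative (\<lambda>y. frechet_derivative f (at y) v) (at (x + a *\<^sub>R v + b *\<^sub>R w)) w"
proof -
  let ?D = "\<lambda>y. frechet_derivative f (at y) v"
  have f1: "f differentiable_on S" and f2: "?D differentiable_on S"
    using f by (auto simp: numeral_2_eq_2)
  define q where "q = (\<lambda>s. f (x + h *\<^sub>R w + s *\<^sub>R v) - f (x + s *\<^sub>R v))"
  have q': "(q has_real_derivative ?D (x + h *\<^sub>R w + s *\<^sub>R v) - ?D (x + s *\<^sub>R v)) (at s)"
    if "0 \<le> s" "s \<le> h" for s
    unfolding q_def
    using that sub[of s h] sub[of s 0] \<open>h > 0\<close>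
    by (intro DERIV_diff has_real_derivative_along_line[OF S f1]) (auto simp: algebra_simps)
  obtain a where a: "0 < a" "a < h" "q h - q 0 = (h - 0) * (?D (x + h *\<^sub>R w + a *\<^sub>R v) - ?D (x + a *\<^sub>R v))"
    using MVT2[of 0 h q, OF \<open>h > 0\<close> q'] by blast
  define r where "r = (\<lambda>s. ?D (x + a *\<^sub>R v + s *\<^sub>R w))"
  have r': "(r has_real_derivative frechet_derivative ?D (at (x + a *\<^sub>R v + s *\<^sub>R w)) w) (at s)"
    if "0 \<le> s" "s \<le> h" for s
    unfolding r_def
    using that sub[of a s] a by (intro has_real_derivative_along_line[OF S f2]) auto
  obtain b where b: "0 < b" "b < h"
    "r h - r 0 = (h - 0) * frechet_derivative ?D (at (x + a *\<^sub>R v + b *\<^sub>R w)) w"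
    using MVT2[of 0 h r, OF \<open>h > 0\<close> r'] by blast
  have "q h - q 0 = h * (r h - r 0)"
    unfolding a(3) by (simp add: r_def algebra_simps)
  then have "q h - q 0 = h * h * frechet_derivative ?D (at (x + a *\<^sub>R v + b *\<^sub>R w)) w"
    unfolding b(3) by simp
  then show ?thesis using a(1,2) b(1,2) by (auto simp: q_def algebra_simps)
qed

text \<open>The second difference is symmetric in v and w, so the two mixed derivatives take a
  common value at points arbitrarily close to x; their continuity at x does the rest.\<close>

lemma symmetric_second_derivative_real:
  fixes f :: "'a::euclidean_space \<Rightarrow> real"
  assumes S: "open S" and f: "Ck_on 2 f S" and x: "x \<in> S"
  shows "frechet_derivative (\<lambda>y. frechet_derivative f (at y) v) (at x) w =
         frechet_derivative (\<lambda>y. frechet_derivative f (at y) w) (at x) v"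
proof -
  let ?D = "\<lambda>v w y. frechet_derivative (\<lambda>y. frechet_derivative f (at y) v) (at y) w"
  have cont: "isCont (?D v w) x" for v w
    using f S x by (auto simp: numeral_2_eq_2 continuous_on_eq_continuous_at)
  obtain e where e: "e > 0" "ball x e \<subseteq> S" using S x openE by blast
  have approx: "\<exists>y z. dist y x < r \<and> dist z x < r \<and> ?D v w y = ?D w v z" if "r > 0" for r
  proof -
    \<comment> \<open>The summand 1 keeps \<open>n\<close> positive even if v = w = 0. With this
      \<open>h\<close> the whole parallelogram spanned by h v and h w stays within half of
      \<open>min r e\<close> from x.\<close>
    define n where "n = norm v + norm w + 1"
    define h where "h = min r e / n / 2"
    have pos: "n > 0" by (simp add: n_def add_nonneg_pos)
    have h: "h > 0" using e that pos by (simp add: h_def)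
    have near: "dist (x + a *\<^sub>R v + b *\<^sub>R w) x < min r e"
      if "0 \<le> a" "a \<le> h" "0 \<le> b" "b \<le> h" for a b
    proof -
      have "dist (x + a *\<^sub>R v + b *\<^sub>R w) x = norm (a *\<^sub>R v + b *\<^sub>R w)" by (simp add: dist_norm)
      also have "\<dots> \<le> a * norm v + b * norm w" using norm_triangle_ineq[of "a *\<^sub>R v" "b *\<^sub>R w"] that by simp
      also have "\<dots> \<le> h * norm v + h * norm w" using that by (intro add_mono mult_right_mono) auto
      also have "\<dots> \<le> h * n" using h by (simp add: n_def algebra_simps)
      also have "\<dots> = min r e / 2" using pos by (simp add: h_def)
      also have "\<dots> < min r e" using e \<open>r > 0\<close> by auto
      finally show ?thesis .
    qed
    have sub: "x + a *\<^sub>R v + b *\<^sub>R w \<in> S" "x + b *\<^sub>R w + a *\<^sub>R v \<in> S"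
      if "0 \<le> a" "a \<le> h" "0 \<le> b" "b \<le> h" for a b
      using near[OF that] e(2) by (auto simp: subset_iff dist_commute algebra_simps)
    obtain a b where ab: "0 < a" "a < h" "0 < b" "b < h"
      "f (x + h *\<^sub>R v + h *\<^sub>R w) - f (x + h *\<^sub>R v) - f (x + h *\<^sub>R w) + f x =
        h * h * ?D v w (x + a *\<^sub>R v + b *\<^sub>R w)"
      using second_difference[OF S f h sub(1)] by blast
    obtain c d where cd: "0 < c" "c < h" "0 < d" "d < h"
      "f (x + h *\<^sub>R w + h *\<^sub>R v) - f (x + h *\<^sub>R w) - f (x + h *\<^sub>R v) + f x =
        h * h * ?D w v (x + c *\<^sub>R w + d *\<^sub>R v)"
      using second_difference[OF S f h, of x w v] sub(2) by blast
    have "h * h * ?D v w (x + a *\<^sub>R v + b *\<^sub>R w) = h * h * ?D w v (x + c *\<^sub>R w + d *\<^sub>R v)"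
      unfolding ab(5)[symmetric] cd(5)[symmetric] by (simp add: algebra_simps)
    then have "?D v w (x + a *\<^sub>R v + b *\<^sub>R w) = ?D w v (x + c *\<^sub>R w + d *\<^sub>R v)" using h by simp
    moreover have "dist (x + a *\<^sub>R v + b *\<^sub>R w) x < r" using near[of a b] ab by simp
    moreover have "dist (x + c *\<^sub>R w + d *\<^sub>R v) x < r" using near[of d c] cd by (simp add: algebra_simps)
    ultimately show ?thesis by blast
  qed
  show ?thesis
  proof (rule ccontr)
    assume neq: "?D v w x \<noteq> ?D w v x"
    define m where "m = \<bar>?D v w x - ?D w v x\<bar> / 2"
    have m: "m > 0" using neq by (simp add: m_def)
    obtain r1 where r1: "r1 > 0" "\<And>y. dist y x < r1 \<Longrightarrow> dist (?D v w y) (?D v w x) < m"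
      using cont[of v w] m unfolding continuous_at_eps_delta by metis
    obtain r2 where r2: "r2 > 0" "\<And>y. dist y x < r2 \<Longrightarrow> dist (?D w v y) (?D w v x) < m"
      using cont[of w v] m unfolding continuous_at_eps_delta by metis
    obtain y z where yz: "dist y x < min r1 r2" "dist z x < min r1 r2" "?D v w y = ?D w v z"
      using approx[of "min r1 r2"] r1 r2 by auto
    have "dist (?D v w y) (?D v w x) < m" "dist (?D w v z) (?D w v x) < m"
      using r1(2)[of y] r2(2)[of z] yz(1,2) by (simp_all only: min_less_iff_conj)
    then have "\<bar>?D v w x - ?D w v x\<bar> < 2 * m" using yz(3) by (auto simp: dist_real_def)
    then show False by (simp add: m_def)
  qed
qed

lemma symmetric_second_derivative:
  fixes f :: "'a::euclidean_space \<Rightarrow> 'b::euclidean_space"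
  assumes S: "open S" and f: "smooth_in S f" and x: "x \<in> S"
  shows "frechet_derivative (\<lambda>y. frechet_derivative f (at y) v) (at x) w =
         frechet_derivative (\<lambda>y. frechet_derivative f (at y) w) (at x) v"
proof (rule euclidean_eqI)
  fix b :: 'b
  have comp: "frechet_derivative (\<lambda>y. g y \<bullet> b) (at y) v = frechet_derivative g (at y) v \<bullet> b"
    if "smooth_in S g" "y \<in> S" for g y v
    using frechet_derivative_at[OF has_derivative_inner_left[OF smooth_in_has_derivative[OF S that]], of b, symmetric]
    by simp
  have comp2: "frechet_derivative (\<lambda>y. frechet_derivative (\<lambda>y. f y \<bullet> b) (at y) v) (at x) w =
     frechet_derivative (\<lambda>y. frechet_derivative f (at y) v) (at x) w \<bullet> b" for v w
    using frechet_derivative_cong_open[OF S x comp[OF f, where v=v]] comp[OF smooth_in_frechet[OF f] x]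
    by simp
  have "smooth_in S (\<lambda>y. f y \<bullet> b)" using f S by (intro smooth_intros) auto
  then have "Ck_on 2 (\<lambda>y. f y \<bullet> b) S" by (simp add: smooth_in_def)
  from symmetric_second_derivative_real[OF S this x]
  show "frechet_derivative (\<lambda>y. frechet_derivative f (at y) v) (at x) w \<bullet> b =
         frechet_derivative (\<lambda>y. frechet_derivative f (at y) w) (at x) v \<bullet> b"
    by (simp only: comp2)
qed

text \<open>Product rule for the map sending y to Df(y)(E y): the Hessian with E frozen at x, plus
  the gradient term from the variation of E. In a commutator the Hessian part cancels; at a critical
  point only the Hessian part survives.\<close>

lemma dd_dd_expand:
  assumes S: "open S" and f: "smooth_in S f" and E: "smooth_in S E" and x: "x \<in> S"
  shows "dd G (dd E f) x = frechet_derivative (\<lambda>y. frechet_derivative f (at y) (E x)) (at x) (G x)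
      + frechet_derivative f (at x) (dd G E x)"
proof -
  let ?D = "\<lambda>y. frechet_derivative f (at y)"
  have lin: "linear (?D y)" if "y \<in> S" for y
    using smooth_in_has_derivative[OF S f that] has_derivative_linear by blast
  have rep: "dd E f y = (\<Sum>b\<in>Basis. (E y \<bullet> b) *\<^sub>R ?D y b)" if "y \<in> S" for y
    unfolding dd_def using lin[OF that]
    by (subst euclidean_representation[of "E y", symmetric]) (simp add: linear_sum linear_scale)
  have rep2: "?D y e = (\<Sum>b\<in>Basis. (e \<bullet> b) *\<^sub>R ?D y b)" if "y \<in> S" for y e
    using lin[OF that]
    by (subst euclidean_representation[of e, symmetric]) (simp add: linear_sum linear_scale)
  have dE: "(E has_derivative frechet_derivative E (at x)) (at x)"
    by (rule smooth_in_has_derivative[OF S E x])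
  have dD: "((\<lambda>y. ?D y b) has_derivative frechet_derivative (\<lambda>y. ?D y b) (at x)) (at x)" for b
    by (rule smooth_in_has_derivative[OF S smooth_in_frechet[OF f] x])
  have "((\<lambda>y. \<Sum>b\<in>Basis. (E y \<bullet> b) *\<^sub>R ?D y b) has_derivative
     (\<lambda>h. \<Sum>b\<in>Basis. (E x \<bullet> b) *\<^sub>R frechet_derivative (\<lambda>y. ?D y b) (at x) h
        + (frechet_derivative E (at x) h \<bullet> b) *\<^sub>R ?D x b)) (at x)"
    by (intro has_derivative_sum has_derivative_scaleR has_derivative_inner_left dE dD)
  then have 1: "dd G (dd E f) x = (\<Sum>b\<in>Basis. (E x \<bullet> b) *\<^sub>R frechet_derivative (\<lambda>y. ?D y b) (at x) (G x)
        + (frechet_derivative E (at x) (G x) \<bullet> b) *\<^sub>R ?D x b)"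
    by (subst dd_cong_open[OF S x, of "dd E f", OF rep]) (auto intro: dd_eqI)
  have "((\<lambda>y. \<Sum>b\<in>Basis. (E x \<bullet> b) *\<^sub>R ?D y b) has_derivative
     (\<lambda>h. \<Sum>b\<in>Basis. (E x \<bullet> b) *\<^sub>R frechet_derivative (\<lambda>y. ?D y b) (at x) h)) (at x)"
    by (intro has_derivative_sum has_derivative_scaleR_right dD)
  then have 2: "frechet_derivative (\<lambda>y. ?D y (E x)) (at x) (G x)
      = (\<Sum>b\<in>Basis. (E x \<bullet> b) *\<^sub>R frechet_derivative (\<lambda>y. ?D y b) (at x) (G x))"
    by (simp add: frechet_derivative_cong_open[OF S x rep2[where e="E x"]] frechet_derivative_at[symmetric])
  have 3: "?D x (dd G E x) = (\<Sum>b\<in>Basis. (frechet_derivative E (at x) (G x) \<bullet> b) *\<^sub>R ?D x b)"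
    unfolding dd_def by (rule rep2[OF x])
  show ?thesis unfolding 1 2 3 by (simp add: sum.distrib)
qed

text \<open>\<open>dd G E x - dd E G x\<close> is the Lie bracket of G and E in coordinates; the
  Hessian terms cancel by symmetry.\<close>

lemma dd_commutator:
  assumes S: "open S" and f: "smooth_in S f" and E: "smooth_in S E" and G: "smooth_in S G" and x: "x \<in> S"
  shows "dd G (dd E f) x - dd E (dd G f) x = frechet_derivative f (at x) (dd G E x - dd E G x)"
proof -
  have "linear (frechet_derivative f (at x))"
    using smooth_in_has_derivative[OF S f x] has_derivative_linear by blast
  then show ?thesis
    unfolding dd_dd_expand[OF S f E x] dd_dd_expand[OF S f G x]
    by (simp add: symmetric_second_derivative[OF S f x, of "E x" "G x"] linear_diff)
qed

subsection \<open>Linear algebra of the space forms\<close>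

text \<open>For \<kappa> = 1 and \<kappa> = -1 this is \<kappa> times \<open>sf_inner\<close>. For
  \<kappa> = 0, where \<open>sf_inner\<close> ignores the first coordinate, it is the product of the
  first coordinates. In all three cases it vanishes against p exactly on the tangent space and
  equals 1 on (p, p).\<close>

definition sf_radial :: "real \<Rightarrow> ambient \<Rightarrow> ambient \<Rightarrow> real" where
  "sf_radial \<kappa> p v = fst p * fst v + \<kappa> * (snd p \<bullet> snd v)"

lemma sf_tangent_iff: "v \<in> sf_tangent \<kappa> p \<longleftrightarrow> sf_radial \<kappa> p v = 0"
  by (simp add: sf_tangent_def sf_radial_def)

lemma bounded_bilinear_sf_inner: "bounded_bilinear (sf_inner \<kappa>)"
proof -
  have "bounded_linear (\<lambda>w::ambient. (\<kappa> * fst w, snd w))"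
    by (intro bounded_linear_Pair bounded_linear_mult_const bounded_linear_const_mult
        bounded_linear_fst bounded_linear_snd)
  from bounded_bilinear.comp[OF bounded_bilinear_inner bounded_linear_ident this]
  show ?thesis by (simp add: sf_inner_def[abs_def] inner_prod_def mult_ac add.commute)
qed

lemma bounded_bilinear_sf_radial: "bounded_bilinear (sf_radial \<kappa>)"
proof -
  have "bounded_linear (\<lambda>w::ambient. (fst w, \<kappa> *\<^sub>R snd w))"
    by (intro bounded_linear_Pair bounded_linear_const_scaleR
        bounded_linear_fst bounded_linear_snd)
  from bounded_bilinear.comp[OF bounded_bilinear_inner bounded_linear_ident this]
  show ?thesis by (simp add: sf_radial_def[abs_def] inner_prod_def)
qed

lemmas sf_inner_simps =
  bounded_bilinear.add_left[OF bounded_bilinear_sf_inner]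
  bounded_bilinear.add_right[OF bounded_bilinear_sf_inner]
  bounded_bilinear.diff_left[OF bounded_bilinear_sf_inner]
  bounded_bilinear.diff_right[OF bounded_bilinear_sf_inner]
  bounded_bilinear.minus_left[OF bounded_bilinear_sf_inner]
  bounded_bilinear.minus_right[OF bounded_bilinear_sf_inner]
  bounded_bilinear.scaleR_left[OF bounded_bilinear_sf_inner, simplified]
  bounded_bilinear.scaleR_right[OF bounded_bilinear_sf_inner, simplified]
  bounded_bilinear.zero_left[OF bounded_bilinear_sf_inner]
  bounded_bilinear.zero_right[OF bounded_bilinear_sf_inner]

lemmas sf_radial_simps =
  bounded_bilinear.add_left[OF bounded_bilinear_sf_radial]
  bounded_bilinear.add_right[OF bounded_bilinear_sf_radial]
  bounded_bilinear.diff_left[OF bounded_bilinear_sf_radial]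
  bounded_bilinear.diff_right[OF bounded_bilinear_sf_radial]
  bounded_bilinear.minus_left[OF bounded_bilinear_sf_radial]
  bounded_bilinear.minus_right[OF bounded_bilinear_sf_radial]
  bounded_bilinear.scaleR_left[OF bounded_bilinear_sf_radial, simplified]
  bounded_bilinear.scaleR_right[OF bounded_bilinear_sf_radial, simplified]
  bounded_bilinear.zero_left[OF bounded_bilinear_sf_radial]
  bounded_bilinear.zero_right[OF bounded_bilinear_sf_radial]

lemmas smooth_in_sf_inner [smooth_intros] = smooth_in_bilinear[OF bounded_bilinear_sf_inner]
lemmas dd_sf_inner = dd_bilinear[OF bounded_bilinear_sf_inner]
lemmas dd_sf_radial = dd_bilinear[OF bounded_bilinear_sf_radial]

lemma sf_inner_commute: "sf_inner \<kappa> v w = sf_inner \<kappa> w v"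
  by (simp add: sf_inner_def inner_commute mult.commute)

lemma sf_radial_commute: "sf_radial \<kappa> v w = sf_radial \<kappa> w v"
  by (simp add: sf_radial_def inner_commute mult.commute)

lemma space_form_radial: "p \<in> space_form \<kappa> \<Longrightarrow> sf_radial \<kappa> p p = 1"
  by (simp add: space_form_def sf_radial_def power2_eq_square)

lemma space_form_tangent_zero:
  "p \<in> space_form 0 \<Longrightarrow> sf_radial 0 p v = 0 \<Longrightarrow> fst v = 0"
  by (auto simp: space_form_def sf_radial_def)

lemma sf_radial_tangent:
  assumes "\<kappa> \<in> {0, 1, -1}" "p \<in> space_form \<kappa>" "sf_radial \<kappa> p v = 0"
  shows "sf_radial \<kappa> v w = \<kappa> * sf_inner \<kappa> v w"
  using assms space_form_tangent_zero[of p v]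
  by (auto simp: sf_radial_def sf_inner_def algebra_simps)

text \<open>The factor \<kappa> has to stay: in the flat case the position vector is in general not
  orthogonal to tangent vectors, but there it never enters a formula.\<close>

lemma sf_inner_position_tangent:
  assumes "\<kappa> \<in> {0, 1, -1}" "sf_radial \<kappa> p v = 0"
  shows "\<kappa> * sf_inner \<kappa> p v = 0"
  using assms by (auto simp: sf_radial_def sf_inner_def algebra_simps)

text \<open>On the hyperboloid the ambient form is indefinite. Tangency turns
  \<open>fst p * fst v\<close> into an inner product of spatial parts, and Cauchy-Schwarz with
  \<open>fst p * fst p = 1 + ?P\<close> shows that v is spacelike.\<close>

lemma sf_inner_pos:
  assumes "\<kappa> \<in> {0, 1, -1}" "p \<in> space_form \<kappa>" "sf_radial \<kappa> p v = 0" "v \<noteq> 0"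
  shows "sf_inner \<kappa> v v > 0"
proof -
  consider "\<kappa> = 0" | "\<kappa> = 1" | "\<kappa> = -1" using assms(1) by auto
  then show ?thesis
  proof cases
    case 1
    then have "fst v = 0" using assms space_form_tangent_zero by blast
    then have "snd v \<noteq> 0" using assms(4) by (metis prod_eqI fst_zero snd_zero)
    then show ?thesis using 1 by (simp add: sf_inner_def)
  next
    case 2
    then have "sf_inner \<kappa> v v = v \<bullet> v" by (simp add: sf_inner_def inner_prod_def)
    then show ?thesis using assms(4) by simp
  next
    case 3
    let ?P = "snd p \<bullet> snd p" and ?V = "snd v \<bullet> snd v"
    have p: "fst p * fst p = 1 + ?P" using assms(2) 3 by (simp add: space_form_def power2_eq_square)
    have pv: "fst p * fst v = snd p \<bullet> snd v" using assms(3) 3 by (simp add: sf_radial_def)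
    have V: "?V > 0"
    proof (rule ccontr)
      assume "\<not> ?V > 0"
      then have "snd v = 0" by simp
      moreover have "fst p \<noteq> 0" using assms(2) 3 by (auto simp: space_form_def)
      ultimately have "fst v = 0" using pv by simp
      then show False using \<open>snd v = 0\<close> assms(4) by (metis prod_eqI fst_zero snd_zero)
    qed
    have P: "1 + ?P > 0" by (simp add: add_pos_nonneg)
    have "(1 + ?P) * (fst v * fst v) = (fst p * fst v) * (fst p * fst v)"
      unfolding p[symmetric] by (simp add: mult_ac)
    also have "\<dots> = (snd p \<bullet> snd v)\<^sup>2" by (simp add: pv power2_eq_square)
    also have "\<dots> \<le> ?P * ?V" by (rule Cauchy_Schwarz_ineq)
    also have "\<dots> < (1 + ?P) * ?V" using V by simp
    finally have "fst v * fst v < ?V" using P by (simp add: mult_less_cancel_left_pos)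
    then show ?thesis using 3 by (simp add: sf_inner_def)
  qed
qed

lemma dim_sf_tangent:
  assumes "p \<in> space_form \<kappa>"
  shows "dim (sf_tangent \<kappa> p) = 3"
proof -
  have "sf_tangent \<kappa> p = {v. (fst p, \<kappa> *\<^sub>R snd p) \<bullet> v = 0}"
    by (auto simp: sf_tangent_def inner_Pair_0 inner_prod_def)
  moreover have "(fst p, \<kappa> *\<^sub>R snd p) \<noteq> 0"
    using assms by (auto simp: space_form_def zero_prod_def)
  ultimately show ?thesis using dim_hyperplane[of "(fst p, \<kappa> *\<^sub>R snd p)"] by simp
qed

text \<open>By positivity a nonzero r would be a fourth independent vector in a tangent space of
  dimension 3. The vectors y1 and y2 are only required to be independent, so that coordinate bases
  are covered as well as orthonormal frames.\<close>

lemma sf_orthogonal_complement_trivial: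
  assumes \<kappa>: "\<kappa> \<in> {0, 1, -1}" and p: "p \<in> space_form \<kappa>"
    and tangent: "sf_radial \<kappa> p y1 = 0" "sf_radial \<kappa> p y2 = 0" "sf_radial \<kappa> p n = 0" "sf_radial \<kappa> p r = 0"
    and indep: "\<And>a b. a *\<^sub>R y1 + b *\<^sub>R y2 = 0 \<Longrightarrow> a = 0 \<and> b = 0"
    and n: "sf_inner \<kappa> n n = 1" "sf_inner \<kappa> y1 n = 0" "sf_inner \<kappa> y2 n = 0"
    and r: "sf_inner \<kappa> r y1 = 0" "sf_inner \<kappa> r y2 = 0" "sf_inner \<kappa> r n = 0"
  shows "r = 0"
proof (rule ccontr)
  assume "r \<noteq> 0"
  then have rr: "sf_inner \<kappa> r r > 0" using sf_inner_pos[OF \<kappa> p tangent(4)] by simp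
  have zero: "a = 0 \<and> b = 0 \<and> c = 0 \<and> d = 0"
    if eq: "a *\<^sub>R y1 + b *\<^sub>R y2 + c *\<^sub>R n + d *\<^sub>R r = 0" for a b c d
  proof -
    have "sf_inner \<kappa> (a *\<^sub>R y1 + b *\<^sub>R y2 + c *\<^sub>R n + d *\<^sub>R r) n = 0"
      "sf_inner \<kappa> (a *\<^sub>R y1 + b *\<^sub>R y2 + c *\<^sub>R n + d *\<^sub>R r) r = 0"
      unfolding eq by (simp_all add: sf_inner_simps)
    then have "c = 0" "d = 0"
      using n r rr by (simp_all add: sf_inner_simps sf_inner_commute[of \<kappa> y1 r]
          sf_inner_commute[of \<kappa> y2 r] sf_inner_commute[of \<kappa> n r])
    then show ?thesis using eq indep[of a b] by simp
  qed
  define B where "B = {y1, y2, n, r}"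
  have distinct: "y1 \<noteq> y2" "y1 \<noteq> n" "y1 \<noteq> r" "y2 \<noteq> n" "y2 \<noteq> r" "n \<noteq> r"
    using zero[of 1 "-1" 0 0] zero[of 1 0 "-1" 0] zero[of 1 0 0 "-1"]
      zero[of 0 1 "-1" 0] zero[of 0 1 0 "-1"] zero[of 0 0 1 "-1"] by auto
  have "independent B"
  proof (rule independent_if_scalars_zero)
    show "finite B" by (simp add: B_def)
    fix f x assume "(\<Sum>x\<in>B. f x *\<^sub>R x) = 0" and x: "x \<in> B"
    then have "f y1 *\<^sub>R y1 + f y2 *\<^sub>R y2 + f n *\<^sub>R n + f r *\<^sub>R r = 0"
      using distinct by (simp add: B_def add.assoc)
    from zero[OF this] show "f x = 0" using x by (auto simp: B_def)
  qed
  moreover have "B \<subseteq> sf_tangent \<kappa> p" using tangent by (simp add: B_def sf_tangent_iff)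
  ultimately have "card B \<le> dim (sf_tangent \<kappa> p)" using independent_card_le_dim by blast
  moreover have "card B = 4" using distinct by (simp add: B_def)
  ultimately show False using dim_sf_tangent[OF p] by simp
qed

lemma sf_orthonormal_expansion:
  assumes \<kappa>: "\<kappa> \<in> {0, 1, -1}" and p: "p \<in> space_form \<kappa>"
    and tangent: "sf_radial \<kappa> p e1 = 0" "sf_radial \<kappa> p e2 = 0" "sf_radial \<kappa> p n = 0" "sf_radial \<kappa> p w = 0"
    and on: "sf_inner \<kappa> e1 e1 = 1" "sf_inner \<kappa> e2 e2 = 1" "sf_inner \<kappa> e1 e2 = 0"
    and n: "sf_inner \<kappa> n n = 1" "sf_inner \<kappa> e1 n = 0" "sf_inner \<kappa> e2 n = 0"
  shows "w = sf_inner \<kappa> w e1 *\<^sub>R e1 + sf_inner \<kappa> w e2 *\<^sub>R e2 + sf_inner \<kappa> w n *\<^sub>R n"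
proof -
  let ?r = "w - (sf_inner \<kappa> w e1 *\<^sub>R e1 + sf_inner \<kappa> w e2 *\<^sub>R e2 + sf_inner \<kappa> w n *\<^sub>R n)"
  have sym: "sf_inner \<kappa> e2 e1 = 0" "sf_inner \<kappa> n e1 = 0" "sf_inner \<kappa> n e2 = 0"
    using on n sf_inner_commute by metis+
  have "?r = 0"
  proof (rule sf_orthogonal_complement_trivial[OF \<kappa> p tangent(1-3) _ _ n])
    fix a b assume eq: "a *\<^sub>R e1 + b *\<^sub>R e2 = 0"
    have "sf_inner \<kappa> (a *\<^sub>R e1 + b *\<^sub>R e2) e1 = 0" "sf_inner \<kappa> (a *\<^sub>R e1 + b *\<^sub>R e2) e2 = 0"
      unfolding eq by (simp_all add: sf_inner_simps)
    then show "a = 0 \<and> b = 0" using on sym by (simp add: sf_inner_simps)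
  qed (use tangent on n sym in \<open>simp_all add: sf_inner_simps sf_radial_simps\<close>)
  then show ?thesis by simp
qed

subsection \<open>Moving principal frames\<close>

text \<open>In the application the domain lies in space-time, \<open>T\<close> is the time direction
  and \<open>E1\<close>, \<open>E2\<close> are spatial fields. The bracket assumptions express that
  all brackets are tangent to the time slices; their coefficients are left open because applying the
  brackets to \<open>Y\<close> yields the ones that matter.\<close>

locale moving_frame =
  fixes \<kappa> :: real and W :: "'a::euclidean_space set" and Y \<nu> :: "'a \<Rightarrow> ambient"
    and T E1 E2 :: "'a \<Rightarrow> 'a" and \<phi> l1 l2 :: "'a \<Rightarrow> real"
  assumes \<kappa>: "\<kappa> \<in> {0, 1, -1}" and W: "open W"
    and smooth: "smooth_in W Y" "smooth_in W \<nu>" "smooth_in W T" "smooth_in W E1" "smooth_in W E2"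
      "smooth_in W \<phi>" "smooth_in W l1" "smooth_in W l2"
    and Y: "x \<in> W \<Longrightarrow> Y x \<in> space_form \<kappa>"
    and \<nu>: "x \<in> W \<Longrightarrow> sf_radial \<kappa> (Y x) (\<nu> x) = 0" "x \<in> W \<Longrightarrow> sf_inner \<kappa> (\<nu> x) (\<nu> x) = 1"
    and flow: "x \<in> W \<Longrightarrow> dd T Y x = \<phi> x *\<^sub>R \<nu> x"
    and frame: "x \<in> W \<Longrightarrow> sf_inner \<kappa> (dd E1 Y x) (dd E1 Y x) = 1"
      "x \<in> W \<Longrightarrow> sf_inner \<kappa> (dd E2 Y x) (dd E2 Y x) = 1"
      "x \<in> W \<Longrightarrow> sf_inner \<kappa> (dd E1 Y x) (dd E2 Y x) = 0"
      "x \<in> W \<Longrightarrow> sf_inner \<kappa> (dd E1 Y x) (\<nu> x) = 0"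
      "x \<in> W \<Longrightarrow> sf_inner \<kappa> (dd E2 Y x) (\<nu> x) = 0"
    and principal: "x \<in> W \<Longrightarrow> dd E1 \<nu> x = l1 x *\<^sub>R dd E1 Y x"
      "x \<in> W \<Longrightarrow> dd E2 \<nu> x = l2 x *\<^sub>R dd E2 Y x"
    and brackets: "x \<in> W \<Longrightarrow> dd E1 E2 x - dd E2 E1 x \<in> span {E1 x, E2 x}"
      "x \<in> W \<Longrightarrow> dd T E1 x - dd E1 T x \<in> span {E1 x, E2 x}"
      "x \<in> W \<Longrightarrow> dd T E2 x - dd E2 T x \<in> span {E1 x, E2 x}"
begin

text \<open>The functions \<open>a\<close> and \<open>b\<close> below are the two connection coefficients of the principal frame
  \<open>e1, e2\<close>; they satisfy \<open>[E1, E2] = - a E1 - b E2\<close>.\<close>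

definition "e1 = dd E1 Y"
definition "e2 = dd E2 Y"
definition "a x = sf_inner \<kappa> (dd E1 e1 x) (e2 x)"
definition "b x = sf_inner \<kappa> (dd E2 e1 x) (e2 x)"

lemmas [smooth_intros] = W smooth

lemma smooth_frame [smooth_intros]: "smooth_in W e1" "smooth_in W e2"
  unfolding e1_def e2_def by (intro smooth_intros)+

lemma smooth_ab [smooth_intros]: "smooth_in W a" "smooth_in W b"
  unfolding a_def[abs_def] b_def[abs_def] by (intro smooth_intros)+

lemma dd_eq_on:
  assumes "\<And>y. y \<in> W \<Longrightarrow> f y = g y" "x \<in> W"
  shows "dd E f x = dd E g x"
  using dd_cong_open[OF W assms(2) assms(1)] .

lemmas d_rules = dd_add[OF W] dd_diff[OF W] dd_minus[OF W] dd_mult[OF W] dd_scaleR[OF W]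
  dd_sf_inner[OF W] dd_sf_radial[OF W]

lemma inner_frame:
  assumes "x \<in> W"
  shows "sf_inner \<kappa> (e1 x) (e1 x) = 1" "sf_inner \<kappa> (e2 x) (e2 x) = 1"
    "sf_inner \<kappa> (e1 x) (e2 x) = 0" "sf_inner \<kappa> (e2 x) (e1 x) = 0"
    "sf_inner \<kappa> (e1 x) (\<nu> x) = 0" "sf_inner \<kappa> (e2 x) (\<nu> x) = 0"
    "sf_inner \<kappa> (\<nu> x) (e1 x) = 0" "sf_inner \<kappa> (\<nu> x) (e2 x) = 0" "sf_inner \<kappa> (\<nu> x) (\<nu> x) = 1"
  using frame[OF assms] \<nu>[OF assms] by (auto simp: e1_def e2_def sf_inner_commute)

lemma dd_sf_inner_const:
  assumes "smooth_in W f" "smooth_in W g" "\<And>y. y \<in> W \<Longrightarrow> sf_inner \<kappa> (f y) (g y) = c" "x \<in> W"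
  shows "sf_inner \<kappa> (f x) (dd E g x) = - sf_inner \<kappa> (dd E f x) (g x)"
  using dd_eq_on[of "\<lambda>y. sf_inner \<kappa> (f y) (g y)" "\<lambda>_. c", OF assms(3,4), of E] d_rules(6)[OF assms(1,2,4), of E \<kappa>] by (simp add: dd_const)

lemma dd_sf_radial_const:
  assumes "smooth_in W f" "\<And>y. y \<in> W \<Longrightarrow> sf_radial \<kappa> (Y y) (f y) = c" "x \<in> W"
  shows "sf_radial \<kappa> (Y x) (dd E f x) = - sf_radial \<kappa> (dd E Y x) (f x)"
  using dd_eq_on[of "\<lambda>y. sf_radial \<kappa> (Y y) (f y)" "\<lambda>_. c", OF assms(2,3), of E] d_rules(7)[OF smooth(1) assms(1,3), of E \<kappa>] by (simp add: dd_const)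

lemma radial_dd_Y:
  assumes "x \<in> W"
  shows "sf_radial \<kappa> (Y x) (dd E Y x) = 0"
  using dd_sf_radial_const[OF smooth(1) space_form_radial[OF Y] assms, of E]
  by (simp add: sf_radial_commute)

lemma radial_frame:
  assumes "x \<in> W"
  shows "sf_radial \<kappa> (Y x) (e1 x) = 0" "sf_radial \<kappa> (Y x) (e2 x) = 0"
  using radial_dd_Y[OF assms] by (simp_all add: e1_def e2_def)

text \<open>The ambient derivative of a tangent field leaves the tangent space by a multiple of the
  position vector. Adding that multiple back produces the Levi-Civita derivative; for \<kappa> = 0
  nothing is added.\<close>

lemma radial_dd_tangent:
  assumes "smooth_in W f" "\<And>y. y \<in> W \<Longrightarrow> sf_radial \<kappa> (Y y) (f y) = 0" "x \<in> W"
  shows "sf_radial \<kappa> (Y x) (dd E f x + (\<kappa> * sf_inner \<kappa> (dd E Y x) (f x)) *\<^sub>R Y x) = 0"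
  using dd_sf_radial_const[OF assms, of E] sf_radial_tangent[OF \<kappa> Y[OF assms(3)] radial_dd_Y[OF assms(3)]]
    space_form_radial[OF Y[OF assms(3)]]
  by (simp add: sf_radial_simps)

lemma position_inner:
  assumes "x \<in> W" "sf_radial \<kappa> (Y x) v = 0"
  shows "\<kappa> * sf_inner \<kappa> (Y x) v = 0" "\<kappa> * sf_inner \<kappa> v (Y x) = 0"
  using sf_inner_position_tangent[OF \<kappa> assms(2)] by (simp_all add: sf_inner_commute)

lemma expansion:
  assumes "smooth_in W f" "\<And>y. y \<in> W \<Longrightarrow> sf_radial \<kappa> (Y y) (f y) = 0" "x \<in> W"
  shows "dd E f x = sf_inner \<kappa> (dd E f x) (e1 x) *\<^sub>R e1 x + sf_inner \<kappa> (dd E f x) (e2 x) *\<^sub>R e2 x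
    + sf_inner \<kappa> (dd E f x) (\<nu> x) *\<^sub>R \<nu> x - (\<kappa> * sf_inner \<kappa> (dd E Y x) (f x)) *\<^sub>R Y x"
proof -
  let ?c = "sf_inner \<kappa> (dd E Y x) (f x)"
  let ?w = "dd E f x + (\<kappa> * ?c) *\<^sub>R Y x"
  have "?w = sf_inner \<kappa> ?w (e1 x) *\<^sub>R e1 x + sf_inner \<kappa> ?w (e2 x) *\<^sub>R e2 x + sf_inner \<kappa> ?w (\<nu> x) *\<^sub>R \<nu> x"
    by (rule sf_orthonormal_expansion[OF \<kappa> Y[OF assms(3)]])
      (simp_all add: radial_frame \<nu> inner_frame assms(3) radial_dd_tangent[OF assms])
  moreover have "sf_inner \<kappa> ?w v = sf_inner \<kappa> (dd E f x) v" if "sf_radial \<kappa> (Y x) v = 0" for v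
  proof -
    have "(\<kappa> * ?c) * sf_inner \<kappa> (Y x) v = 0" using position_inner(1)[OF assms(3) that] by auto
    then show ?thesis by (simp only: sf_inner_simps)
  qed
  ultimately have "?w = sf_inner \<kappa> (dd E f x) (e1 x) *\<^sub>R e1 x + sf_inner \<kappa> (dd E f x) (e2 x) *\<^sub>R e2 x
      + sf_inner \<kappa> (dd E f x) (\<nu> x) *\<^sub>R \<nu> x"
    using radial_frame[OF assms(3)] \<nu>(1)[OF assms(3)] by simp
  then show ?thesis by (metis add_diff_cancel_right')
qed

lemma dd_frame_inner:
  assumes "x \<in> W"
  shows "sf_inner \<kappa> (dd E e1 x) (e1 x) = 0" "sf_inner \<kappa> (dd E e2 x) (e2 x) = 0"
    "sf_inner \<kappa> (dd E e2 x) (e1 x) = - sf_inner \<kappa> (dd E e1 x) (e2 x)"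
    "sf_inner \<kappa> (dd E e1 x) (\<nu> x) = - sf_inner \<kappa> (dd E \<nu> x) (e1 x)"
    "sf_inner \<kappa> (dd E e2 x) (\<nu> x) = - sf_inner \<kappa> (dd E \<nu> x) (e2 x)"
    "sf_inner \<kappa> (dd E \<nu> x) (\<nu> x) = 0"
  using dd_sf_inner_const[OF smooth_frame(1) smooth_frame(1) inner_frame(1) assms, of E]
    dd_sf_inner_const[OF smooth_frame(2) smooth_frame(2) inner_frame(2) assms, of E]
    dd_sf_inner_const[OF smooth_frame(1) smooth_frame(2) inner_frame(3) assms, of E]
    dd_sf_inner_const[OF smooth_frame(1) smooth(2) inner_frame(5) assms, of E]
    dd_sf_inner_const[OF smooth_frame(2) smooth(2) inner_frame(6) assms, of E]
    dd_sf_inner_const[OF smooth(2) smooth(2) inner_frame(9) assms, of E]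
  by (simp_all add: sf_inner_commute)

lemma dd_\<nu>:
  assumes "x \<in> W"
  shows "dd E1 \<nu> x = l1 x *\<^sub>R e1 x" "dd E2 \<nu> x = l2 x *\<^sub>R e2 x"
  using principal[OF assms] by (simp_all add: e1_def e2_def)

lemma dd_Y: "dd E1 Y = e1" "dd E2 Y = e2"
  by (simp_all add: e1_def e2_def)

text \<open>The Gauss formula in the principal frame. The mixed derivatives have no normal component
  because the second fundamental form is diagonal, and the \<open>Y\<close> terms come from the
  embedding of the space form.\<close>

lemma structure_equations:
  assumes "x \<in> W"
  shows "dd E1 e1 x = a x *\<^sub>R e2 x - l1 x *\<^sub>R \<nu> x - \<kappa> *\<^sub>R Y x"
    "dd E2 e1 x = b x *\<^sub>R e2 x"
    "dd E1 e2 x = - a x *\<^sub>R e1 x"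
    "dd E2 e2 x = - b x *\<^sub>R e1 x - l2 x *\<^sub>R \<nu> x - \<kappa> *\<^sub>R Y x"
  using expansion[OF smooth_frame(1) radial_frame(1) assms, of E1]
    expansion[OF smooth_frame(1) radial_frame(1) assms, of E2]
    expansion[OF smooth_frame(2) radial_frame(2) assms, of E1]
    expansion[OF smooth_frame(2) radial_frame(2) assms, of E2]
  by (simp_all add: dd_Y dd_frame_inner[OF assms] dd_\<nu>[OF assms] inner_frame[OF assms] sf_inner_simps
      a_def b_def)

section \<open>Brackets of the frame; Codazzi, Gauss and evolution equations\<close>

lemma linear_frechet: "smooth_in W f \<Longrightarrow> x \<in> W \<Longrightarrow> linear (frechet_derivative f (at x))"
  using smooth_in_has_derivative[OF W] has_derivative_linear by blast

text \<open>The coefficients are chosen before f. They can therefore be identified by testing with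
  \<open>Y\<close> and then used for any other map.\<close>

lemma frechet_span:
  assumes "v \<in> span {E1 x, E2 x}"
  obtains c1 c2 where "\<And>f::'a \<Rightarrow> 'b::euclidean_space. smooth_in W f \<Longrightarrow> x \<in> W \<Longrightarrow>
    frechet_derivative f (at x) v = c1 *\<^sub>R dd E1 f x + c2 *\<^sub>R dd E2 f x"
proof -
  obtain c1 where "v - c1 *\<^sub>R E1 x \<in> span {E2 x}"
    using assms span_breakdown_eq by blast
  then obtain c2 where "v - c1 *\<^sub>R E1 x = c2 *\<^sub>R E2 x"
    using span_breakdown_eq by (metis eq_iff_diff_eq_0 singletonD span_empty)
  then have v: "v = c1 *\<^sub>R E1 x + c2 *\<^sub>R E2 x" by (simp add: algebra_simps)
  show thesis
    by (rule that[of c1 c2]) (simp add: v dd_def linear_frechet linear_add linear_scale)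
qed

text \<open>Applied to \<open>Y\<close>, the bracket is the difference of two structure equations,
  which yields the coefficients -a and -b; the same coefficients then act on every f.\<close>

lemma bracket_frame:
  assumes f: "smooth_in W f" and x: "x \<in> W"
  shows "dd E1 (dd E2 f) x - dd E2 (dd E1 f) x = - a x *\<^sub>R dd E1 f x - b x *\<^sub>R dd E2 (f :: 'a \<Rightarrow> ambient) x"
proof -
  obtain c1 c2 where c: "\<And>f::'a \<Rightarrow> ambient. smooth_in W f \<Longrightarrow> x \<in> W \<Longrightarrow>
    frechet_derivative f (at x) (dd E1 E2 x - dd E2 E1 x) = c1 *\<^sub>R dd E1 f x + c2 *\<^sub>R dd E2 f x"
    using frechet_span[OF brackets(1)[OF x]] by metis
  have comm: "dd E1 (dd E2 f) x - dd E2 (dd E1 f) x = c1 *\<^sub>R dd E1 f x + c2 *\<^sub>R dd E2 f x"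
    if "smooth_in W f" for f :: "'a \<Rightarrow> ambient"
    using dd_commutator[OF W that smooth(5) smooth(4) x] c[OF that x] by simp
  have eq: "- a x *\<^sub>R e1 x - b x *\<^sub>R e2 x = c1 *\<^sub>R e1 x + c2 *\<^sub>R e2 x"
    using comm[OF smooth(1)] structure_equations(2,3)[OF x] by (simp add: dd_Y)
  have "c1 = - a x" "c2 = - b x"
    using arg_cong[OF eq, of "\<lambda>v. sf_inner \<kappa> v (e1 x)"] arg_cong[OF eq, of "\<lambda>v. sf_inner \<kappa> v (e2 x)"]
    by (simp_all add: sf_inner_simps inner_frame[OF x])
  then show ?thesis using comm[OF f] by simp
qed

text \<open>The bracket of the frame applied to the normal: differentiating \<open>dd_\<nu>\<close>
  in the two orders and comparing the e1 and e2 components.\<close>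

lemma codazzi:
  assumes x: "x \<in> W"
  shows "dd E2 l1 x = a x * (l1 x - l2 x)" "dd E1 l2 x = b x * (l1 x - l2 x)"
proof -
  have 1: "dd E1 (dd E2 \<nu>) x = - (a x * l2 x) *\<^sub>R e1 x + dd E1 l2 x *\<^sub>R e2 x"
    using dd_eq_on[of "dd E2 \<nu>" "\<lambda>y. l2 y *\<^sub>R e2 y", OF dd_\<nu>(2) x, of E1]
      d_rules(5)[OF smooth(8) smooth_frame(2) x, of E1] structure_equations[OF x] by simp
  have 2: "dd E2 (dd E1 \<nu>) x = (b x * l1 x) *\<^sub>R e2 x + dd E2 l1 x *\<^sub>R e1 x"
    using dd_eq_on[of "dd E1 \<nu>" "\<lambda>y. l1 y *\<^sub>R e1 y", OF dd_\<nu>(1) x, of E2]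
      d_rules(5)[OF smooth(7) smooth_frame(1) x, of E2] structure_equations[OF x] by simp
  have eq: "- (a x * l2 x) *\<^sub>R e1 x + dd E1 l2 x *\<^sub>R e2 x - ((b x * l1 x) *\<^sub>R e2 x + dd E2 l1 x *\<^sub>R e1 x)
     = - a x *\<^sub>R (l1 x *\<^sub>R e1 x) - b x *\<^sub>R (l2 x *\<^sub>R e2 x)"
    using bracket_frame[OF smooth(2) x] unfolding 1 2 dd_\<nu>[OF x] .
  show "dd E2 l1 x = a x * (l1 x - l2 x)" "dd E1 l2 x = b x * (l1 x - l2 x)"
    using arg_cong[OF eq, of "\<lambda>v. sf_inner \<kappa> v (e1 x)"] arg_cong[OF eq, of "\<lambda>v. sf_inner \<kappa> v (e2 x)"]
    by (simp_all add: sf_inner_simps inner_frame[OF x] algebra_simps)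
qed

text \<open>The e2 component of the bracket of the frame applied to e1. The curvature \<kappa> of
  the ambient space enters through the position term of \<open>structure_equations\<close>.\<close>

lemma gauss:
  assumes x: "x \<in> W"
  shows "dd E1 b x - dd E2 a x + (a x)\<^sup>2 + (b x)\<^sup>2 + l1 x * l2 x + \<kappa> = 0"
proof -
  have 1: "dd E1 (dd E2 e1) x = - (a x * b x) *\<^sub>R e1 x + dd E1 b x *\<^sub>R e2 x"
    using dd_eq_on[of "dd E2 e1" "\<lambda>y. b y *\<^sub>R e2 y", OF structure_equations(2) x, of E1]
      d_rules(5)[OF smooth_ab(2) smooth_frame(2) x, of E1] structure_equations[OF x] by simp
  have "dd E2 (dd E1 e1) x = dd E2 (\<lambda>y. a y *\<^sub>R e2 y - l1 y *\<^sub>R \<nu> y - \<kappa> *\<^sub>R Y y) x"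
    by (rule dd_eq_on[OF structure_equations(1) x])
  also have "\<dots> = (a x *\<^sub>R dd E2 e2 x + dd E2 a x *\<^sub>R e2 x) - (l1 x *\<^sub>R dd E2 \<nu> x + dd E2 l1 x *\<^sub>R \<nu> x)
      - \<kappa> *\<^sub>R dd E2 Y x"
    by (simp add: d_rules dd_const x smooth smooth_ab smooth_frame smooth_intros)
  finally have 2: "dd E2 (dd E1 e1) x = \<dots>" .
  have eq: "- (a x * b x) *\<^sub>R e1 x + dd E1 b x *\<^sub>R e2 x
      - ((a x *\<^sub>R dd E2 e2 x + dd E2 a x *\<^sub>R e2 x) - (l1 x *\<^sub>R dd E2 \<nu> x + dd E2 l1 x *\<^sub>R \<nu> x) - \<kappa> *\<^sub>R dd E2 Y x)
      = - a x *\<^sub>R dd E1 e1 x - b x *\<^sub>R dd E2 e1 x"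
    using bracket_frame[OF smooth_frame(1) x] unfolding 1 2 .
  have Y2: "\<kappa> * sf_inner \<kappa> (Y x) (e2 x) = 0"
    using position_inner(1)[OF x radial_frame(2)[OF x]] .
  have "a x * (\<kappa> * sf_inner \<kappa> (Y x) (e2 x)) = 0" by (simp only: Y2 mult_zero_right)
  then show ?thesis
    using arg_cong[OF eq, of "\<lambda>v. sf_inner \<kappa> v (e2 x)"]
    by (simp add: sf_inner_simps inner_frame[OF x] structure_equations[OF x] dd_\<nu>[OF x] dd_Y
        algebra_simps power2_eq_square)
qed

text \<open>Differentiate the orthogonality of frame and normal in time. Time and frame derivatives
  commute up to tangential terms, so the normal component of \<open>dd T e\<close> is that of the
  derivative of \<phi> \<nu>, which is the derivative of \<phi>. The last term keeps \<nu> tangent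
  to the space form while the position moves.\<close>

lemma dd_T_\<nu>:
  assumes x: "x \<in> W"
  shows "dd T \<nu> x = - dd E1 \<phi> x *\<^sub>R e1 x - dd E2 \<phi> x *\<^sub>R e2 x - (\<kappa> * \<phi> x) *\<^sub>R Y x"
proof -
  have normal: "sf_inner \<kappa> (\<nu> x) (dd T e x) = dd E \<phi> x"
    if E: "smooth_in W E" "dd T E x - dd E T x \<in> span {E1 x, E2 x}" and e: "e = dd E Y"
      and e\<nu>: "sf_inner \<kappa> (e x) (\<nu> x) = 0" for E e
  proof -
    obtain c1 c2 where c: "\<And>f::'a \<Rightarrow> ambient. smooth_in W f \<Longrightarrow> x \<in> W \<Longrightarrow>
      frechet_derivative f (at x) (dd T E x - dd E T x) = c1 *\<^sub>R dd E1 f x + c2 *\<^sub>R dd E2 f x"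
      using frechet_span[OF E(2)] by metis
    have "dd T e x = dd E (dd T Y) x + (c1 *\<^sub>R e1 x + c2 *\<^sub>R e2 x)"
      using dd_commutator[OF W smooth(1) E(1) smooth(3) x] c[OF smooth(1) x] by (simp add: e dd_Y algebra_simps)
    moreover have "dd E (dd T Y) x = \<phi> x *\<^sub>R dd E \<nu> x + dd E \<phi> x *\<^sub>R \<nu> x"
      using dd_eq_on[OF flow x] d_rules(5)[OF smooth(6) smooth(2) x] by simp
    ultimately show ?thesis
      using dd_frame_inner(6)[OF x, of E]
      by (simp add: sf_inner_simps inner_frame[OF x] sf_inner_commute[of \<kappa> "\<nu> x" "dd E \<nu> x"])
  qed
  have "sf_inner \<kappa> (dd T \<nu> x) (e1 x) = - dd E1 \<phi> x"
    using normal[OF smooth(4) brackets(2)[OF x] e1_def inner_frame(5)[OF x]] dd_frame_inner(4)[OF x, of T]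
    by (simp add: sf_inner_commute)
  moreover have "sf_inner \<kappa> (dd T \<nu> x) (e2 x) = - dd E2 \<phi> x"
    using normal[OF smooth(5) brackets(3)[OF x] e2_def inner_frame(6)[OF x]] dd_frame_inner(5)[OF x, of T]
    by (simp add: sf_inner_commute)
  ultimately show ?thesis
    using expansion[OF smooth(2) \<nu>(1) x, of T] dd_frame_inner(6)[OF x, of T] flow[OF x]
    by (simp add: sf_inner_simps inner_frame[OF x])
qed

text \<open>Take the time derivative of \<open>dd E \<nu> = l e\<close> and commute. The second
  derivatives of \<phi> come from the gradient in \<open>dd_T_\<nu>\<close>, the terms with a and b
  from the rotation of the frame, \<kappa> \<phi> from the position term, and the quadratic term
  from the bracket of T with E.\<close>

lemma evolution_equations:
  assumes x: "x \<in> W"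
  shows "dd T l1 x = - dd E1 (dd E1 \<phi>) x + a x * dd E2 \<phi> x - \<kappa> * \<phi> x - \<phi> x * (l1 x)\<^sup>2"
    "dd T l2 x = - dd E2 (dd E2 \<phi>) x - b x * dd E1 \<phi> x - \<kappa> * \<phi> x - \<phi> x * (l2 x)\<^sup>2"
proof -
  have evol: "dd T l x = sf_inner \<kappa> (dd E (dd T \<nu>) x) (e x) - \<phi> x * (l x)\<^sup>2"
    if E: "smooth_in W E" "dd T E x - dd E T x \<in> span {E1 x, E2 x}" and e: "e = dd E Y"
      and l: "smooth_in W l" "\<And>y. y \<in> W \<Longrightarrow> dd E \<nu> y = l y *\<^sub>R e y"
      and unit: "\<And>y. y \<in> W \<Longrightarrow> sf_inner \<kappa> (e y) (e y) = 1"
      and which: "(e = e1 \<and> l = l1) \<or> (e = e2 \<and> l = l2)" for E e l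
  proof -
    obtain c1 c2 where c: "\<And>f::'a \<Rightarrow> ambient. smooth_in W f \<Longrightarrow> x \<in> W \<Longrightarrow>
      frechet_derivative f (at x) (dd T E x - dd E T x) = c1 *\<^sub>R dd E1 f x + c2 *\<^sub>R dd E2 f x"
      using frechet_span[OF E(2)] by metis
    have smooth_e: "smooth_in W e" unfolding e by (intro smooth_intros E)
    have te: "sf_inner \<kappa> (e x) (dd T e x) = 0"
      using dd_sf_inner_const[OF smooth_e smooth_e unit x, of T] by (simp add: sf_inner_commute)
    have "dd T e x = dd E (dd T Y) x + (c1 *\<^sub>R e1 x + c2 *\<^sub>R e2 x)"
      using dd_commutator[OF W smooth(1) E(1) smooth(3) x] c[OF smooth(1) x] by (simp add: e dd_Y algebra_simps)
    moreover have "dd E (dd T Y) x = \<phi> x *\<^sub>R dd E \<nu> x + dd E \<phi> x *\<^sub>R \<nu> x"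
      using dd_eq_on[OF flow x] d_rules(5)[OF smooth(6) smooth(2) x] by simp
    \<comment> \<open>The vector e has constant length, so the bracket coefficient along e must
      compensate the stretching of the surface at rate \<phi> l.\<close>
    ultimately have "sf_inner \<kappa> (c1 *\<^sub>R e1 x + c2 *\<^sub>R e2 x) (e x) = - \<phi> x * l x"
      using te which inner_frame[OF x] l(2)[OF x] unit[OF x]
      by (auto simp: sf_inner_simps sf_inner_commute)
    moreover have "dd T (dd E \<nu>) x = dd E (dd T \<nu>) x + (c1 *\<^sub>R (l1 x *\<^sub>R e1 x) + c2 *\<^sub>R (l2 x *\<^sub>R e2 x))"
      using dd_commutator[OF W smooth(2) E(1) smooth(3) x] c[OF smooth(2) x] dd_\<nu>[OF x] by (simp add: algebra_simps)
    moreover have "dd T (dd E \<nu>) x = l x *\<^sub>R dd T e x + dd T l x *\<^sub>R e x"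
      using dd_eq_on[of "dd E \<nu>" "\<lambda>y. l y *\<^sub>R e y", OF l(2) x, of T] d_rules(5)[OF l(1) smooth_e x, of T] by simp
    ultimately have "sf_inner \<kappa> (l x *\<^sub>R dd T e x + dd T l x *\<^sub>R e x) (e x) =
        sf_inner \<kappa> (dd E (dd T \<nu>) x) (e x) + l x * (- \<phi> x * l x)"
      using which inner_frame[OF x] by (auto simp: sf_inner_simps)
    then show ?thesis
      using te unit[OF x] by (simp add: sf_inner_simps sf_inner_commute power2_eq_square algebra_simps)
  qed
  have dT: "dd E (dd T \<nu>) x = - (dd E1 \<phi> x *\<^sub>R dd E e1 x + dd E (dd E1 \<phi>) x *\<^sub>R e1 x)
      - (dd E2 \<phi> x *\<^sub>R dd E e2 x + dd E (dd E2 \<phi>) x *\<^sub>R e2 x)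
      - (\<kappa> *\<^sub>R (\<phi> x *\<^sub>R dd E Y x + dd E \<phi> x *\<^sub>R Y x))" for E
  proof -
    have "dd E (dd T \<nu>) x = dd E (\<lambda>y. - (dd E1 \<phi> y *\<^sub>R e1 y) - dd E2 \<phi> y *\<^sub>R e2 y - \<kappa> *\<^sub>R (\<phi> y *\<^sub>R Y y)) x"
      by (rule dd_eq_on[OF _ x]) (simp add: dd_T_\<nu>)
    then show ?thesis
      by (simp add: d_rules dd_const x smooth smooth_ab smooth_frame smooth_intros scaleR_right_distrib)
  qed
  have Y1: "\<kappa> * (dd E1 \<phi> x * sf_inner \<kappa> (Y x) (e1 x)) = 0" and Y2: "\<kappa> * (dd E2 \<phi> x * sf_inner \<kappa> (Y x) (e2 x)) = 0"
    using position_inner(1)[OF x radial_frame(1)[OF x]] position_inner(1)[OF x radial_frame(2)[OF x]] by auto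
  show "dd T l1 x = - dd E1 (dd E1 \<phi>) x + a x * dd E2 \<phi> x - \<kappa> * \<phi> x - \<phi> x * (l1 x)\<^sup>2"
    using evol[OF smooth(4) brackets(2)[OF x] e1_def smooth(7) dd_\<nu>(1) inner_frame(1)] Y1
    unfolding dT
    by (simp add: sf_inner_simps structure_equations[OF x] dd_Y inner_frame[OF x] algebra_simps
       position_inner[OF x radial_frame(1)[OF x]])
  show "dd T l2 x = - dd E2 (dd E2 \<phi>) x - b x * dd E1 \<phi> x - \<kappa> * \<phi> x - \<phi> x * (l2 x)\<^sup>2"
    using evol[OF smooth(5) brackets(3)[OF x] e2_def smooth(8) dd_\<nu>(2) inner_frame(2)] Y2
    unfolding dT
    by (simp add: sf_inner_simps structure_equations[OF x] dd_Y inner_frame[OF x] algebra_simps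
       position_inner[OF x radial_frame(2)[OF x]])
qed

end

subsection \<open>The curvature ratio at a critical point\<close>

text \<open>The left-hand side is \<open>l1\<close> times the time derivative of \<open>r = l2 / l1\<close> at a spatial maximum, with \<open>u, v\<close> the
  components of the gradient of \<open>log l1\<close>, with \<open>A, B\<close> the derivatives \<open>E1 E1 l1\<close> and \<open>E2 E2 l1\<close>
  divided by \<open>l1\<close>, and \<open>s = 1 / (r - 1)\<close>. The assumption \<open>gauss\<close> eliminates \<open>B - r * A\<close>.\<close>

lemma pinching_reaction_negative:
  fixes \<kappa> \<alpha> \<phi> l1 r u v A B R11 R22 G s a b a2 b1 \<phi>1 \<phi>2 \<phi>11 \<phi>22 :: real
  assumes \<alpha>: "0 < \<alpha>" "\<alpha> \<le> 1" and \<kappa>\<alpha>: "(1 - \<alpha>) * \<kappa> \<le> 0" and pos: "\<phi> > 0" "l1 > 0" "r > 1"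
    and R: "R11 \<le> 0" "R22 \<le> 0" and G: "0 \<le> G" "r * G \<le> 1"
    and s: "s * (r - 1) = 1" and a: "a = - v * s" and b: "b = - r * u * s"
    and b1: "b1 * (1 - r) + b * (u - r * u) = r * A + R11"
    and a2: "a2 * (1 - r) + a * (v - r * v) = B"
    and gauss: "b1 - a2 + a\<^sup>2 + b\<^sup>2 + l1 * (r * l1) + \<kappa> = 0"
    and \<phi>: "\<phi>1 = - \<alpha> * \<phi> * u" "\<phi>2 = - \<alpha> * \<phi> * v"
    and \<phi>2: "\<phi>11 = - \<alpha> * \<phi> * A - \<alpha> * \<phi> * G * R11 - (1 + \<alpha>) * u * \<phi>1"
      "\<phi>22 = - \<alpha> * \<phi> * B - \<alpha> * \<phi> * G * R22 - (1 + \<alpha>) * v * \<phi>2"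
  shows "(- \<phi>22 - b * \<phi>1 - \<kappa> * \<phi> - \<phi> * (r * l1)\<^sup>2) - r * (- \<phi>11 + a * \<phi>2 - \<kappa> * \<phi> - \<phi> * l1\<^sup>2) < 0"
proof -
  let ?K = "l1 * (r * l1) + \<kappa>"
  have sr: "s * r = 1 + s" using s by (simp add: algebra_simps)
  have s0: "s > 0" using s pos(3) by (metis diff_gt_0_iff_gt zero_less_mult_pos2 zero_less_one)
  have bu: "b * (u - r * u) = r * (u * u)"
  proof -
    have "b * (u - r * u) = r * (u * u) * (s * (r - 1))" unfolding b by (simp add: algebra_simps)
    then show ?thesis by (simp add: s)
  qed
  have av: "a * (v - r * v) = v * v"
  proof -
    have "a * (v - r * v) = v * v * (s * (r - 1))" unfolding a by (simp add: algebra_simps)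
    then show ?thesis by (simp add: s)
  qed
  have aa: "a\<^sup>2 * (1 - r) = - s * (v * v)"
  proof -
    have "a\<^sup>2 * (1 - r) = - s * (v * v) * (s * (r - 1))" unfolding a power2_eq_square by (simp add: algebra_simps)
    then show ?thesis by (simp add: s)
  qed
  have bb: "b\<^sup>2 * (1 - r) = - s * (r * r * (u * u))"
  proof -
    have "b\<^sup>2 * (1 - r) = - s * (r * r * (u * u)) * (s * (r - 1))" unfolding b power2_eq_square by (simp add: algebra_simps)
    then show ?thesis by (simp add: s)
  qed
  \<comment> \<open>The factor 1 - r turns b1 and a2 into the expressions in the differentiated
    Codazzi equations \<open>b1\<close> and \<open>a2\<close>, whose right-hand sides contain A and
    B.\<close>
  have "(b1 - a2 + a\<^sup>2 + b\<^sup>2 + ?K) * (1 - r) = 0" using gauss by simp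
  then have "b1 * (1 - r) - a2 * (1 - r) + a\<^sup>2 * (1 - r) + b\<^sup>2 * (1 - r) + ?K * (1 - r) = 0"
    by (simp add: algebra_simps)
  then have BA: "B - r * A = R11 - r * (u * u) + v * v - s * (v * v) - s * (r * r * (u * u)) + ?K * (1 - r)"
    using a2 b1 unfolding bu av aa bb by linarith
  have "(- \<phi>22 - b * \<phi>1 - \<kappa> * \<phi> - \<phi> * (r * l1)\<^sup>2) - r * (- \<phi>11 + a * \<phi>2 - \<kappa> * \<phi> - \<phi> * l1\<^sup>2)
    = \<alpha> * \<phi> * (B - r * A) + \<alpha> * \<phi> * (G * (R22 - r * R11)) + (1 + \<alpha>) * (\<alpha> * \<phi>) * (r * (u * u) - v * v)
      - \<alpha> * \<phi> * (s * r) * (u * u + v * v) - \<phi> * (r - 1) * (l1 * (r * l1) - \<kappa>)"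
    unfolding \<phi>2 \<phi> a b power2_eq_square by (simp add: algebra_simps)
  also have "\<dots> = \<alpha> * \<phi> * ((1 - r * G) * R11 + G * R22)
      + \<alpha> * \<phi> * (u * u) * (- r - (s * r) * r + (1 + \<alpha>) * r - s * r)
      + \<alpha> * \<phi> * (v * v) * (1 - s - (1 + \<alpha>) - s * r)
      - \<phi> * (r - 1) * ((1 + \<alpha>) * (l1 * (r * l1)) - (1 - \<alpha>) * \<kappa>)"
    unfolding BA by (simp add: algebra_simps)
  also have "\<dots> < 0"
  proof -
    \<comment> \<open>The exchange by Gauss gives R11 the weight 1, and the speed takes r * G away
      from it. In the application 1 - r * G is the quotient of the first partial derivative of F by
      F at (1, r), so both weights reflect ellipticity.\<close>
    have "(1 - r * G) * R11 \<le> 0" "G * R22 \<le> 0" using R G by (simp_all add: mult_nonneg_nonpos)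
    then have t1: "\<alpha> * \<phi> * ((1 - r * G) * R11 + G * R22) \<le> 0"
      using \<alpha> pos by (intro mult_nonneg_nonpos) auto
    \<comment> \<open>Since s r = 1 + s, the coefficient of u * u equals r (\<alpha> - (r + 1) / (r
      - 1)); this is the place where \<alpha> \<le> 1 gives the sign.\<close>
    have "(1 + \<alpha>) * r \<le> 2 * r" using \<alpha> pos by (intro mult_right_mono) auto
    moreover have "(s * r) * r = r + 1 + s" unfolding sr using sr by (simp add: algebra_simps)
    ultimately have "- r - (s * r) * r + (1 + \<alpha>) * r - s * r \<le> 0" using s0 sr by linarith
    then have t2: "\<alpha> * \<phi> * (u * u) * (- r - (s * r) * r + (1 + \<alpha>) * r - s * r) \<le> 0"
      using \<alpha> pos by (intro mult_nonneg_nonpos) auto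
    have "1 - s - (1 + \<alpha>) - s * r \<le> 0" using s0 sr \<alpha> by linarith
    then have t3: "\<alpha> * \<phi> * (v * v) * (1 - s - (1 + \<alpha>) - s * r) \<le> 0"
      using \<alpha> pos by (intro mult_nonneg_nonpos) auto
    \<comment> \<open>The zero order term collects \<alpha> times l1 l2 + \<kappa> from the Gauss
      equation and l1 l2 - \<kappa> from the evolution equations, where l2 = r l1.\<close>
    have "(1 + \<alpha>) * (l1 * (r * l1)) > 0" using \<alpha> pos by simp
    then have t4: "\<phi> * (r - 1) * ((1 + \<alpha>) * (l1 * (r * l1)) - (1 - \<alpha>) * \<kappa>) > 0"
      using pos \<kappa>\<alpha> by (intro mult_pos_pos) auto
    show ?thesis using t1 t2 t3 t4 by linarith
  qed
  finally show ?thesis .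
qed

context moving_frame
begin

text \<open>Reduction to \<open>pinching_reaction_negative\<close>: all equations are divided by
  \<open>l1 x\<close>, which makes them scale free in the derivatives of the curvatures. The
  function \<open>G\<close> represents the logarithmic slope of F in the ratio.\<close>

lemma ratio_decreasing_at_critical_point:
  fixes G r :: "'a \<Rightarrow> real"
  assumes x: "x \<in> W" and \<alpha>: "0 < \<alpha>" "\<alpha> \<le> 1" and \<kappa>\<alpha>: "(1 - \<alpha>) * \<kappa> \<le> 0"
    and pos: "\<phi> x > 0" "l1 x > 0" "r x > 1"
    and r: "smooth_in W r" "\<And>y. y \<in> W \<Longrightarrow> l2 y = r y * l1 y"
    and crit: "dd E1 r x = 0" "dd E2 r x = 0" "dd E1 (dd E1 r) x \<le> 0" "dd E2 (dd E2 r) x \<le> 0"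
    and G: "G differentiable (at x)" "0 \<le> G x" "r x * G x \<le> 1"
    and \<phi>: "\<And>y E. y \<in> W \<Longrightarrow> l1 y * dd E \<phi> y = - \<alpha> * (\<phi> y * dd E l1 y) - \<alpha> * (\<phi> y * l1 y * (G y * dd E r y))"
  shows "dd T r x < 0"
proof -
  have dl2: "dd E l2 y = r y * dd E l1 y + dd E r y * l1 y" if "y \<in> W" for E y
    using dd_eq_on[OF r(2) that] d_rules(4)[OF r(1) smooth(7) that] by simp
  have ddl2: "dd E (dd E l2) x = r x * dd E (dd E l1) x + dd E (dd E r) x * l1 x"
    if E: "smooth_in W E" and z: "dd E r x = 0" for E
  proof -
    have "dd E (dd E l2) x = dd E (\<lambda>y. r y * dd E l1 y + dd E r y * l1 y) x"
      by (rule dd_eq_on[OF dl2 x])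
    then show ?thesis using z by (simp add: d_rules x r smooth E smooth_intros)
  qed
  \<comment> \<open>Differentiating the assumption on \<open>dd E \<phi>\<close> once more: each
    term with the factor \<open>dd E r x\<close> vanishes, among them the only one with the
    derivative of \<open>G\<close>. The coefficient 1 + \<alpha> combines the product rule on the
    left with the derivative of \<phi> on the right.\<close>
  have dd\<phi>: "l1 x * dd E (dd E \<phi>) x = - \<alpha> * (\<phi> x * dd E (dd E l1) x)
      - \<alpha> * (\<phi> x * l1 x * (G x * dd E (dd E r) x)) - (1 + \<alpha>) * dd E l1 x * dd E \<phi> x"
    if E: "smooth_in W E" and z: "dd E r x = 0" for E
  proof -
    have hd: "(f has_derivative frechet_derivative f (at x)) (at x)" if "smooth_in W f" for f :: "'a \<Rightarrow> real"
      using smooth_in_has_derivative[OF W that x] .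
    have G': "(G has_derivative frechet_derivative G (at x)) (at x)"
      using G(1) frechet_derivative_works by blast
    have sE: "smooth_in W (dd E f)" if "smooth_in W f" for f :: "'a \<Rightarrow> real" by (intro smooth_intros E that)
    have "dd E (\<lambda>y. l1 y * dd E \<phi> y) x = l1 x * dd E (dd E \<phi>) x + dd E l1 x * dd E \<phi> x"
      using d_rules(4)[OF smooth(7) sE[OF smooth(6)] x] .
    moreover have "((\<lambda>y. - \<alpha> * (\<phi> y * dd E l1 y) - \<alpha> * (\<phi> y * l1 y * (G y * dd E r y))) has_derivative
       (\<lambda>h. - \<alpha> * (\<phi> x * frechet_derivative (dd E l1) (at x) h + frechet_derivative \<phi> (at x) h * dd E l1 x)
         - \<alpha> * (\<phi> x * l1 x * (G x * frechet_derivative (dd E r) (at x) h + frechet_derivative G (at x) h * dd E r x)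
            + (\<phi> x * frechet_derivative l1 (at x) h + frechet_derivative \<phi> (at x) h * l1 x) * (G x * dd E r x)))) (at x)"
      by (intro has_derivative_diff has_derivative_mult_right has_derivative_mult hd G' sE smooth r(1))
    then have "dd E (\<lambda>y. - \<alpha> * (\<phi> y * dd E l1 y) - \<alpha> * (\<phi> y * l1 y * (G y * dd E r y))) x =
      - \<alpha> * (\<phi> x * dd E (dd E l1) x + dd E \<phi> x * dd E l1 x) - \<alpha> * (\<phi> x * l1 x * (G x * dd E (dd E r) x))"
      by (subst dd_eqI) (assumption, simp add: z dd_def[symmetric])
    moreover have "dd E (\<lambda>y. l1 y * dd E \<phi> y) x
        = dd E (\<lambda>y. - \<alpha> * (\<phi> y * dd E l1 y) - \<alpha> * (\<phi> y * l1 y * (G y * dd E r y))) x"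
      by (rule dd_eq_on[OF \<phi> x])
    ultimately show ?thesis by (simp add: algebra_simps)
  qed
  have T: "dd T l2 x = r x * dd T l1 x + dd T r x * l1 x" by (rule dl2[OF x])
  have evo: "dd T l1 x = - dd E1 (dd E1 \<phi>) x + a x * dd E2 \<phi> x - \<kappa> * \<phi> x - \<phi> x * (l1 x)\<^sup>2"
    "dd T l2 x = - dd E2 (dd E2 \<phi>) x - b x * dd E1 \<phi> x - \<kappa> * \<phi> x - \<phi> x * (r x * l1 x)\<^sup>2"
    using evolution_equations[OF x] r(2)[OF x] by simp_all
  \<comment> \<open>The Codazzi equations hold on all of \<open>W\<close> and may be differentiated;
    this links the derivatives of a and b in the Gauss equation to second derivatives of the
    curvatures.\<close>
  have cod: "dd E1 (dd E1 l2) x = dd E1 b x * (l1 x - l2 x) + b x * (dd E1 l1 x - dd E1 l2 x)"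
    "dd E2 (dd E2 l1) x = dd E2 a x * (l1 x - l2 x) + a x * (dd E2 l1 x - dd E2 l2 x)"
    by (subst dd_eq_on[of "dd E1 l2" "\<lambda>y. b y * (l1 y - l2 y)", OF codazzi(2) x];
        simp add: d_rules x smooth smooth_intros)
      (subst dd_eq_on[of "dd E2 l1" "\<lambda>y. a y * (l1 y - l2 y)", OF codazzi(1) x];
        simp add: d_rules x smooth smooth_intros)
  define l where "l = l1 x"
  define rx where "rx = r x"
  have l: "l > 0" "l \<noteq> 0" and rx: "rx > 1" using pos by (auto simp: l_def rx_def)
  define u where "u = dd E1 l1 x / l"
  define v where "v = dd E2 l1 x / l"
  define s where "s = 1 / (rx - 1)"
  have u: "dd E1 l1 x = l * u" and v: "dd E2 l1 x = l * v" using l by (simp_all add: u_def v_def)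
  have s: "s * (rx - 1) = 1" using rx by (simp add: s_def)
  have l2: "l2 x = rx * l" using r(2)[OF x] by (simp add: l_def rx_def)
  have "l * v = l * (a x * (1 - rx))"
    using codazzi(1)[OF x] unfolding v l2 l_def[symmetric] by (simp add: algebra_simps)
  then have v': "v = a x * (1 - rx)" using l by simp
  have a: "a x = - v * s"
  proof -
    have "a x * (s * (rx - 1)) = - v * s" unfolding v' by (simp add: algebra_simps)
    then show ?thesis by (simp add: s)
  qed
  have "l * (rx * u) = l * (b x * (1 - rx))"
    using codazzi(2)[OF x] unfolding dl2[OF x] u l2 crit l_def[symmetric] rx_def[symmetric] by (simp add: algebra_simps)
  then have u': "rx * u = b x * (1 - rx)" using l by simp
  have b: "b x = - rx * u * s"
  proof -
    have "b x * (s * (rx - 1)) = - (rx * u) * s" unfolding u' by (simp add: algebra_simps)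
    then show ?thesis by (simp add: s)
  qed
  define A where "A = dd E1 (dd E1 l1) x / l"
  define B where "B = dd E2 (dd E2 l1) x / l"
  have A: "dd E1 (dd E1 l1) x = l * A" and B: "dd E2 (dd E2 l1) x = l * B" using l by (simp_all add: A_def B_def)
  have "l * (dd E1 b x * (1 - rx) + b x * (u - rx * u)) = l * (rx * A + dd E1 (dd E1 r) x)"
    using cod(1) unfolding ddl2[OF smooth(4) crit(1)] dl2[OF x] crit A u l2 l_def[symmetric] rx_def[symmetric]
    by (simp add: algebra_simps)
  then have b1: "dd E1 b x * (1 - rx) + b x * (u - rx * u) = rx * A + dd E1 (dd E1 r) x" using l by simp
  have "l * (dd E2 a x * (1 - rx) + a x * (v - rx * v)) = l * B"
    using cod(2) unfolding dl2[OF x] crit B v l2 l_def[symmetric] rx_def[symmetric]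
    by (simp add: algebra_simps)
  then have a2: "dd E2 a x * (1 - rx) + a x * (v - rx * v) = B" using l by simp
  have "l * dd E1 \<phi> x = l * (- \<alpha> * \<phi> x * u)" "l * dd E2 \<phi> x = l * (- \<alpha> * \<phi> x * v)"
    using \<phi>[OF x, of E1] \<phi>[OF x, of E2] unfolding crit u v l_def[symmetric] by (simp_all add: algebra_simps)
  then have \<phi>1: "dd E1 \<phi> x = - \<alpha> * \<phi> x * u" "dd E2 \<phi> x = - \<alpha> * \<phi> x * v"
    by (simp_all only: mult_left_cancel[OF l(2)])
  have "l * dd E1 (dd E1 \<phi>) x = l * (- \<alpha> * \<phi> x * A - \<alpha> * \<phi> x * G x * dd E1 (dd E1 r) x - (1 + \<alpha>) * u * dd E1 \<phi> x)"
    "l * dd E2 (dd E2 \<phi>) x = l * (- \<alpha> * \<phi> x * B - \<alpha> * \<phi> x * G x * dd E2 (dd E2 r) x - (1 + \<alpha>) * v * dd E2 \<phi> x)"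
    using dd\<phi>[OF smooth(4) crit(1)] dd\<phi>[OF smooth(5) crit(2)] unfolding A B u v l_def[symmetric]
    by (simp_all add: algebra_simps)
  then have \<phi>2: "dd E1 (dd E1 \<phi>) x = - \<alpha> * \<phi> x * A - \<alpha> * \<phi> x * G x * dd E1 (dd E1 r) x - (1 + \<alpha>) * u * dd E1 \<phi> x"
    "dd E2 (dd E2 \<phi>) x = - \<alpha> * \<phi> x * B - \<alpha> * \<phi> x * G x * dd E2 (dd E2 r) x - (1 + \<alpha>) * v * dd E2 \<phi> x"
    by (simp_all only: mult_left_cancel[OF l(2)])
  have gauss': "dd E1 b x - dd E2 a x + (a x)\<^sup>2 + (b x)\<^sup>2 + l * (rx * l) + \<kappa> = 0"
    using gauss[OF x] unfolding l2 l_def[symmetric] .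
  have "(- dd E2 (dd E2 \<phi>) x - b x * dd E1 \<phi> x - \<kappa> * \<phi> x - \<phi> x * (rx * l)\<^sup>2)
     - rx * (- dd E1 (dd E1 \<phi>) x + a x * dd E2 \<phi> x - \<kappa> * \<phi> x - \<phi> x * l\<^sup>2) < 0"
    by (rule pinching_reaction_negative[OF \<alpha> \<kappa>\<alpha> pos(1) l(1) rx crit(3,4) G(2) _ s a b b1 a2 gauss' \<phi>1 \<phi>2])
      (use G(3) in \<open>simp add: rx_def\<close>)
  then have "dd T l2 x - rx * dd T l1 x < 0" unfolding evo l_def rx_def .
  then have "dd T r x * l < 0" unfolding T l_def rx_def by simp
  then show ?thesis using l by (simp add: mult_less_0_iff)
qed

end

subsection \<open>Principal curvatures in charts\<close>

text \<open>Here \<open>E, F, G\<close> and \<open>L, M, N\<close> are the coefficients of the first and second fundamental form; the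
  principal curvatures are the two roots \<open>l\<close> of \<open>det (h - l g) = 0\<close>.\<close>

definition pencil_disc :: "real \<Rightarrow> real \<Rightarrow> real \<Rightarrow> real \<Rightarrow> real \<Rightarrow> real \<Rightarrow> real" where
  "pencil_disc E F G L M N = (E * N + G * L - 2 * F * M)\<^sup>2 - 4 * (E * G - F\<^sup>2) * (L * N - M\<^sup>2)"

definition pencil_root :: "real \<Rightarrow> real \<Rightarrow> real \<Rightarrow> real \<Rightarrow> real \<Rightarrow> real \<Rightarrow> real \<Rightarrow> real" where
  "pencil_root \<sigma> E F G L M N =
     (E * N + G * L - 2 * F * M + \<sigma> * sqrt (pencil_disc E F G L M N)) / (2 * (E * G - F\<^sup>2))"

text \<open>Multiplied by the square of E the discriminant is a sum of nonnegative terms. This is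
  the reality of the eigenvalues of one symmetric form relative to a positive definite one.\<close>

lemma pencil_disc_nonneg:
  assumes "E > 0" "E * G - F\<^sup>2 > 0"
  shows "pencil_disc E F G L M N \<ge> 0"
proof -
  let ?D = "E * G - F\<^sup>2"
  have "E\<^sup>2 * pencil_disc E F G L M N =
      (?D * L - (E\<^sup>2 * N - 2 * E * F * M + F\<^sup>2 * L))\<^sup>2 + 4 * ?D * (E * M - F * L)\<^sup>2"
    by (simp add: pencil_disc_def power2_eq_square algebra_simps)
  also have "\<dots> \<ge> 0" using assms by simp
  finally show ?thesis using assms(1) by (simp add: zero_le_mult_iff)
qed

text \<open>Vieta's formulas for det (h - l g) = 0, multiplied by det g. They spare later arguments
  the explicit square root.\<close>

lemma pencil_roots_sum_prod:
  assumes "E > 0" "E * G - F\<^sup>2 > 0"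
  shows "(E * G - F\<^sup>2) * (pencil_root (-1) E F G L M N + pencil_root 1 E F G L M N) = E * N + G * L - 2 * F * M"
    "(E * G - F\<^sup>2) * (pencil_root (-1) E F G L M N * pencil_root 1 E F G L M N) = L * N - M\<^sup>2"
proof -
  define D where "D = E * G - F\<^sup>2"
  define s where "s = sqrt (pencil_disc E F G L M N)"
  define t where "t = E * N + G * L - 2 * F * M"
  have D: "D \<noteq> 0" using assms by (simp add: D_def)
  have r: "pencil_root \<sigma> E F G L M N = (t + \<sigma> * s) / (2 * D)" for \<sigma>
    by (simp add: pencil_root_def D_def s_def t_def)
  show "(E * G - F\<^sup>2) * (pencil_root (-1) E F G L M N + pencil_root 1 E F G L M N) = E * N + G * L - 2 * F * M"
    unfolding r D_def[symmetric] t_def[symmetric] using D by (simp add: field_simps)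
  have "s * s = t * t - 4 * D * (L * N - M\<^sup>2)"
    using pencil_disc_nonneg[OF assms, of L M N]
    by (simp add: s_def) (simp add: pencil_disc_def t_def D_def power2_eq_square)
  then have "(t + - 1 * s) * (t + 1 * s) = 4 * D * (L * N - M\<^sup>2)" by (simp add: algebra_simps)
  then have "D * ((t + - 1 * s) / (2 * D) * ((t + 1 * s) / (2 * D))) = D * (4 * D * (L * N - M\<^sup>2)) / (2 * D * (2 * D))"
    by simp
  also have "\<dots> = L * N - M\<^sup>2" using D by (simp add: field_simps)
  finally show "(E * G - F\<^sup>2) * (pencil_root (-1) E F G L M N * pencil_root 1 E F G L M N) = L * N - M\<^sup>2"
    unfolding r D_def[symmetric] .
qed

lemma pencil_root_less:
  assumes "E > 0" "E * G - F\<^sup>2 > 0"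
  shows "pencil_root (-1) E F G L M N \<le> pencil_root 1 E F G L M N"
    "pencil_root (-1) E F G L M N < pencil_root 1 E F G L M N \<longleftrightarrow> pencil_disc E F G L M N > 0"
  using assms pencil_disc_nonneg[OF assms, of L M N]
  by (simp_all add: pencil_root_def divide_le_cancel divide_less_cancel)

lemma pencil_eigenvalue_iff:
  assumes "E > 0" "E * G - F\<^sup>2 > 0"
  shows "(\<exists>x y. (x, y) \<noteq> (0, 0) \<and> L * x + M * y = l * (E * x + F * y) \<and> M * x + N * y = l * (F * x + G * y))
    \<longleftrightarrow> l = pencil_root (-1) E F G L M N \<or> l = pencil_root 1 E F G L M N" (is "?lhs \<longleftrightarrow> ?rhs")
proof -
  let ?p = "L - l * E" and ?q = "M - l * F" and ?r = "N - l * G"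
  let ?r1 = "pencil_root (-1) E F G L M N" and ?r2 = "pencil_root 1 E F G L M N"
  have "?lhs \<longleftrightarrow> (\<exists>x y. (x, y) \<noteq> (0, 0) \<and> ?p * x + ?q * y = 0 \<and> ?q * x + ?r * y = 0)"
    by (simp add: algebra_simps)
  also have "\<dots> \<longleftrightarrow> ?p * ?r - ?q * ?q = 0"
  proof
    assume "\<exists>x y. (x, y) \<noteq> (0, 0) \<and> ?p * x + ?q * y = 0 \<and> ?q * x + ?r * y = 0"
    then obtain x y where xy: "(x, y) \<noteq> (0, 0)" "?p * x + ?q * y = 0" "?q * x + ?r * y = 0" by blast
    have "(?p * ?r - ?q * ?q) * x = ?r * (?p * x + ?q * y) - ?q * (?q * x + ?r * y)"
      "(?p * ?r - ?q * ?q) * y = ?p * (?q * x + ?r * y) - ?q * (?p * x + ?q * y)" by algebra+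
    then have "(?p * ?r - ?q * ?q) * x = 0" "(?p * ?r - ?q * ?q) * y = 0" unfolding xy(2,3) by auto
    then show "?p * ?r - ?q * ?q = 0" using xy(1) by (metis mult_eq_0_iff)
  next
    assume det: "?p * ?r - ?q * ?q = 0"
    show "\<exists>x y. (x, y) \<noteq> (0, 0) \<and> ?p * x + ?q * y = 0 \<and> ?q * x + ?r * y = 0"
    \<comment> \<open>The kernel vector is the first row turned by a right angle; if that row is
      zero, the first basis vector serves.\<close>
    proof (cases "?p = 0 \<and> ?q = 0")
      case True
      then show ?thesis using det by (intro exI[of _ 1] exI[of _ 0]) auto
    next
      case False
      have "?p * (- ?q) + ?q * ?p = 0" "?q * (- ?q) + ?r * ?p = 0" using det by (simp_all add: algebra_simps)
      then show ?thesis using False by (intro exI[of _ "- ?q"] exI[of _ ?p]) auto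
    qed
  qed
  also have "\<dots> \<longleftrightarrow> (E * G - F\<^sup>2) * ((l - ?r1) * (l - ?r2)) = 0"
  proof -
    have "(E * G - F\<^sup>2) * ((l - ?r1) * (l - ?r2)) = (E * G - F\<^sup>2) * (l * l)
        - (E * G - F\<^sup>2) * (?r1 + ?r2) * l + (E * G - F\<^sup>2) * (?r1 * ?r2)"
      by (simp add: algebra_simps)
    also have "\<dots> = ?p * ?r - ?q * ?q"
      unfolding pencil_roots_sum_prod[OF assms] by (simp add: algebra_simps power2_eq_square)
    finally show ?thesis by simp
  qed
  also have "\<dots> \<longleftrightarrow> ?rhs" using assms(2) by auto
  finally show ?thesis .
qed

text \<open>Around a point of an open set the local extension from \<open>smooth_on\<close>
  coincides with f itself.\<close>

lemma smooth_on_openD: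
  assumes "smooth_on S f" "open S" "x \<in> S"
  obtains V where "open V" "x \<in> V" "V \<subseteq> S" "smooth_in V f"
proof -
  obtain U g where U: "open U" "x \<in> U" "\<forall>k. Ck_on k g U" "\<forall>y\<in>S \<inter> U. g y = f y"
    using assms unfolding smooth_on_def by meson
  have "smooth_in (U \<inter> S) g" using U(3) smooth_in_subset[of U g "U \<inter> S"] by (auto simp: smooth_in_def)
  then have "smooth_in (U \<inter> S) f"
    by (rule smooth_in_cong_imp[rotated -1]) (use U assms in auto)
  then show thesis using that[of "U \<inter> S"] U assms by auto
qed

lemma smooth_in_differentiable: "open S \<Longrightarrow> smooth_in S f \<Longrightarrow> x \<in> S \<Longrightarrow> f differentiable (at x)"
  using smooth_in_has_derivative differentiable_def by blast

section \<open>Charts of a closed surface\<close>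

lemma closed_surface_chart:
  assumes "closed_surface M A" "c \<in> A"
  shows "fst c \<subseteq> M" "openin (top_of_set M) (fst c)" "open (snd c ` fst c)"
    "homeomorphism (fst c) (snd c ` fst c) (snd c) (inv_into (fst c) (snd c))"
proof -
  have "(\<Union>c\<in>A. fst c) = M"
    and "\<forall>c\<in>A. openin (top_of_set M) (fst c) \<and> open (snd c ` fst c) \<and>
      homeomorphism (fst c) (snd c ` fst c) (snd c) (inv_into (fst c) (snd c))"
    using assms(1) by (simp_all add: closed_surface_def split_beta)
  then show "fst c \<subseteq> M" "openin (top_of_set M) (fst c)" "open (snd c ` fst c)"
    "homeomorphism (fst c) (snd c ` fst c) (snd c) (inv_into (fst c) (snd c))"
    using assms(2) by blast+
qed

lemma closed_surface_covered:
  assumes "closed_surface M A" "x \<in> M"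
  obtains c where "c \<in> A" "x \<in> fst c"
proof -
  have "(\<Union>c\<in>A. fst c) = M" using assms(1) by (simp add: closed_surface_def split_beta)
  then show thesis using assms(2) that by blast
qed

lemma closed_surface_transition:
  assumes "closed_surface M A" "c \<in> A" "d \<in> A"
  shows "smooth_on (snd c ` (fst c \<inter> fst d)) (snd d \<circ> inv_into (fst c) (snd c))"
proof -
  have "\<forall>c\<in>A. \<forall>d\<in>A. smooth_on (snd c ` (fst c \<inter> fst d)) (snd d \<circ> inv_into (fst c) (snd c))"
    using assms(1) by (simp add: closed_surface_def split_beta)
  then show ?thesis using assms(2,3) by blast
qed

lemma chart_inv_into:
  assumes "closed_surface M A" "c \<in> A"
  shows "x \<in> fst c \<Longrightarrow> inv_into (fst c) (snd c) (snd c x) = x"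
  using closed_surface_chart(4)[OF assms] by (auto simp: homeomorphism_def)

lemma local_param_at:
  assumes "closed_surface M A" "c \<in> A" "x \<in> fst c"
  shows "local_param X c (snd c x) = X x"
  using chart_inv_into[OF assms(1,2,3)] by (simp add: local_param_def)

lemma open_chart_image:
  assumes "closed_surface M A" "c \<in> A" "d \<in> A"
  shows "open (snd c ` (fst c \<inter> fst d))"
proof -
  have "openin (top_of_set (fst c)) (fst c \<inter> fst d)"
    using closed_surface_chart(1,2)[OF assms(1,2)] closed_surface_chart(2)[OF assms(1,3)]
    by (metis openin_Int openin_subset_trans inf_le1)
  from homeomorphism_imp_open_map[OF closed_surface_chart(4)[OF assms(1,2)] this]
  show ?thesis using closed_surface_chart(3)[OF assms(1,2)] openin_open_trans by blast
qed

lemma frechet_2: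
  fixes f :: "real^2 \<Rightarrow> 'b::euclidean_space"
  assumes "f differentiable (at u)"
  shows "frechet_derivative f (at u) v =
    v $ 1 *\<^sub>R frechet_derivative f (at u) (axis 1 1) + v $ 2 *\<^sub>R frechet_derivative f (at u) (axis 2 1)"
proof -
  note lin = linear_frechet_derivative[OF assms]
  have "v = v $ 1 *\<^sub>R axis 1 1 + v $ 2 *\<^sub>R axis 2 1"
    by (simp add: vec_eq_iff forall_2 axis_def)
  from arg_cong[OF this, of "frechet_derivative f (at u)"] show ?thesis
    unfolding linear_add[OF lin] linear_scale[OF lin] .
qed

lemma frechet_bilinear:
  assumes "bounded_bilinear h" "f differentiable (at u)" "g differentiable (at u)"
  shows "frechet_derivative (\<lambda>x. h (f x) (g x)) (at u) v =
    h (f u) (frechet_derivative g (at u) v) + h (frechet_derivative f (at u) v) (g u)"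
  using frechet_derivative_at[OF bounded_bilinear.FDERIV[OF assms(1)
      assms(2)[THEN frechet_derivative_works[THEN iffD1]] assms(3)[THEN frechet_derivative_works[THEN iffD1]]], symmetric]
  by simp

text \<open>No regularity of \<nu> is built in, so the second fundamental form is handled through
  second derivatives of the parametrization. Wherever the normal is differentiated, its
  differentiability is the explicit premise \<open>diff\<close>.\<close>

locale surface_point =
  fixes \<kappa> :: real and M :: "'m::t2_space set" and A :: "'m chart set" and X \<nu> :: "'m \<Rightarrow> ambient"
    and c :: "'m chart" and x :: 'm
  assumes \<kappa>: "\<kappa> \<in> {0, 1, -1}" and M: "closed_surface M A" and c: "c \<in> A" "x \<in> fst c"
    and immersion: "smooth_immersion \<kappa> M A X" and normal: "unit_normal \<kappa> M A X \<nu>"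
begin

abbreviation "S \<equiv> snd c ` fst c"
abbreviation "u \<equiv> snd c x"
abbreviation "Y \<equiv> local_param X c"
abbreviation "n \<equiv> local_param \<nu> c"
abbreviation "y i \<equiv> partial i Y u"
abbreviation "yy i j \<equiv> partial i (partial j Y) u"

section \<open>Tangent vectors, normal and fundamental forms at a point\<close>

lemma u: "u \<in> S" using c by simp
lemma open_S: "open S" using closed_surface_chart(3)[OF M c(1)] .

lemma param_at: "Y u = X x" "n u = \<nu> x"
  using local_param_at[OF M c] by auto

lemma smooth_near:
  assumes "v \<in> S"
  obtains V where "open V" "v \<in> V" "V \<subseteq> S" "smooth_in V Y"
  using immersion c smooth_on_openD[OF _ open_S assms] unfolding smooth_immersion_def by metis

lemma Y_differentiable: "v \<in> S \<Longrightarrow> Y differentiable (at v)"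
  using smooth_near smooth_in_differentiable by metis

lemma partial_differentiable: "partial j Y differentiable (at u)"
proof -
  obtain V where V: "open V" "u \<in> V" "V \<subseteq> S" "smooth_in V Y" using smooth_near[OF u] .
  from smooth_in_differentiable[OF V(1) smooth_in_frechet[OF V(4)] V(2), of "axis j 1"]
  show ?thesis by (simp add: partial_def[abs_def])
qed

lemma param_space_form: "v \<in> S \<Longrightarrow> Y v \<in> space_form \<kappa>"
  using immersion closed_surface_chart(1)[OF M c(1)] inv_into_into[of v "snd c" "fst c"]
  by (auto simp: local_param_def smooth_immersion_def)

lemma point_space_form: "X x \<in> space_form \<kappa>"
  using param_space_form[OF u] by (simp add: param_at)

lemma radial_DY: "sf_radial \<kappa> (X x) (frechet_derivative Y (at u) v) = 0"
proof -
  have "frechet_derivative (\<lambda>v. sf_radial \<kappa> (Y v) (Y v)) (at u) = frechet_derivative (\<lambda>v. 1) (at u)"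
    by (rule frechet_derivative_cong_open[OF open_S u]) (rule space_form_radial[OF param_space_form])
  then have "frechet_derivative (\<lambda>v. sf_radial \<kappa> (Y v) (Y v)) (at u) v = 0" by simp
  then show ?thesis
    unfolding frechet_bilinear[OF bounded_bilinear_sf_radial Y_differentiable[OF u] Y_differentiable[OF u]]
    by (simp add: param_at sf_radial_commute)
qed

lemma normal_at:
  assumes "v \<in> S"
  shows "sf_radial \<kappa> (Y v) (n v) = 0" "sf_inner \<kappa> (n v) (n v) = 1" "sf_inner \<kappa> (partial i Y v) (n v) = 0"
proof -
  obtain x' where x': "x' \<in> fst c" "v = snd c x'" using assms by blast
  have "x' \<in> M" using x' closed_surface_chart(1)[OF M c(1)] by blast
  then show "sf_radial \<kappa> (Y v) (n v) = 0" "sf_inner \<kappa> (n v) (n v) = 1" "sf_inner \<kappa> (partial i Y v) (n v) = 0"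
    using normal x' c local_param_at[OF M c(1) x'(1)] unfolding unit_normal_def by (simp_all add: sf_tangent_iff)
qed

lemma normal_at_point:
  "sf_radial \<kappa> (X x) (\<nu> x) = 0" "sf_inner \<kappa> (\<nu> x) (\<nu> x) = 1" "sf_inner \<kappa> (y i) (\<nu> x) = 0"
  using normal_at[OF u] by (simp_all add: param_at)

lemma DY_expand: "frechet_derivative Y (at u) v = v $ 1 *\<^sub>R y 1 + v $ 2 *\<^sub>R y 2"
  unfolding partial_def by (rule frechet_2[OF Y_differentiable[OF u]])

lemma inner_DY_\<nu>: "sf_inner \<kappa> (frechet_derivative Y (at u) v) (\<nu> x) = 0"
  unfolding DY_expand by (simp add: sf_inner_simps normal_at_point)

lemma first_form: "first_fundamental_form \<kappa> X c x $ i $ j = sf_inner \<kappa> (y i) (y j)"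
  by (simp add: first_fundamental_form_def Let_def)

abbreviation "cE \<equiv> sf_inner \<kappa> (y 1) (y 1)"
abbreviation "cF \<equiv> sf_inner \<kappa> (y 1) (y 2)"
abbreviation "cG \<equiv> sf_inner \<kappa> (y 2) (y 2)"
lemma inj_DY: "inj (frechet_derivative Y (at u))"
  using immersion c u unfolding smooth_immersion_def by blast

lemma independent: "a *\<^sub>R y 1 + b *\<^sub>R y 2 = 0 \<Longrightarrow> a = 0 \<and> b = 0"
proof -
  assume "a *\<^sub>R y 1 + b *\<^sub>R y 2 = 0"
  then have "frechet_derivative Y (at u) (vector [a, b]) = frechet_derivative Y (at u) 0"
    unfolding DY_expand by (simp add: vector_2)
  then have "vector [a, b] = (0 :: real^2)" using inj_DY by (simp add: inj_eq)
  then show ?thesis by (metis vector_2 zero_index)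
qed

lemma radial_y: "sf_radial \<kappa> (X x) (y i) = 0"
  using radial_DY by (simp add: partial_def)

lemma cE_pos: "cE > 0"
proof -
  have "y 1 \<noteq> 0" using independent[of 1 0] by auto
  then show ?thesis using sf_inner_pos[OF \<kappa> point_space_form radial_y] by blast
qed

lemma gram_pos: "cE * cG - cF\<^sup>2 > 0"
proof -
  \<comment> \<open>Gram-Schmidt: \<open>?v\<close> is the part of \<open>y 2\<close> orthogonal to
    \<open>y 1\<close>, scaled by \<open>cE\<close>. Its squared length is \<open>cE\<close> times
    the Gram determinant.\<close>
  let ?v = "(- cF) *\<^sub>R y 1 + cE *\<^sub>R y 2"
  have "?v \<noteq> 0" using independent[of "- cF" cE] cE_pos by auto
  then have "sf_inner \<kappa> ?v ?v > 0"
    by (intro sf_inner_pos[OF \<kappa> point_space_form]) (simp_all add: sf_radial_simps radial_y)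
  also have "sf_inner \<kappa> ?v ?v = cE * (cE * cG - cF\<^sup>2)"
    by (simp add: sf_inner_simps sf_inner_commute[of \<kappa> "y 2" "y 1"] power2_eq_square algebra_simps)
  finally show ?thesis using cE_pos by (simp add: zero_less_mult_iff)
qed

text \<open>The tangential projection subtracts \<kappa> times a multiple of the position vector,
  which the normal does not see.\<close>

lemma second_form: "second_fundamental_form \<kappa> X \<nu> c x $ i $ j = - sf_inner \<kappa> (yy i j) (\<nu> x)"
proof -
  have 2: "(\<kappa> * w) * sf_inner \<kappa> (X x) (\<nu> x) = 0" for w
    using sf_inner_position_tangent[OF \<kappa> normal_at_point(1)] by auto
  show ?thesis
    unfolding second_fundamental_form_def sf_tangential_part_def
    by (simp add: Let_def sf_inner_simps param_at 2 del: mult_eq_0_iff)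
qed

lemma yy_commute: "yy 2 1 = yy 1 2"
proof -
  obtain V where V: "open V" "u \<in> V" "V \<subseteq> S" "smooth_in V Y" using smooth_near[OF u] .
  show ?thesis
    using symmetric_second_derivative[OF V(1,4,2), of "axis 1 1" "axis 2 1"] by (simp add: partial_def[abs_def])
qed

abbreviation "cL \<equiv> - sf_inner \<kappa> (yy 1 1) (\<nu> x)"
abbreviation "cM \<equiv> - sf_inner \<kappa> (yy 1 2) (\<nu> x)"
abbreviation "cN \<equiv> - sf_inner \<kappa> (yy 2 2) (\<nu> x)"

text \<open>The equation h v = l g v, that is, the Weingarten eigenvalue equation multiplied by g,
  so that no inverse matrix has to be carried along.\<close>

definition eigenpair :: "real \<Rightarrow> real^2 \<Rightarrow> bool" where
  "eigenpair l v \<longleftrightarrow> cL * v $ 1 + cM * v $ 2 = l * (cE * v $ 1 + cF * v $ 2) \<and>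
     cM * v $ 1 + cN * v $ 2 = l * (cF * v $ 1 + cG * v $ 2)"

definition second_derivative :: "real^2 \<Rightarrow> real^2 \<Rightarrow> ambient" where
  "second_derivative v w = frechet_derivative (\<lambda>u'. frechet_derivative Y (at u') v) (at u) w"

lemma second_derivative_expand:
  "second_derivative v w = v $ 1 *\<^sub>R frechet_derivative (partial 1 Y) (at u) w
    + v $ 2 *\<^sub>R frechet_derivative (partial 2 Y) (at u) w"
proof -
  have 1: "frechet_derivative (\<lambda>u'. frechet_derivative Y (at u') v) (at u) =
      frechet_derivative (\<lambda>u'. v $ 1 *\<^sub>R partial 1 Y u' + v $ 2 *\<^sub>R partial 2 Y u') (at u)"
    by (rule frechet_derivative_cong_open[OF open_S u])
      (simp only: partial_def frechet_2[OF Y_differentiable, where v=v])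
  have "((\<lambda>u'. v $ 1 *\<^sub>R partial 1 Y u' + v $ 2 *\<^sub>R partial 2 Y u') has_derivative
     (\<lambda>w. v $ 1 *\<^sub>R frechet_derivative (partial 1 Y) (at u) w + v $ 2 *\<^sub>R frechet_derivative (partial 2 Y) (at u) w)) (at u)"
    by (intro has_derivative_add has_derivative_scaleR_right partial_differentiable[THEN frechet_derivative_works[THEN iffD1]])
  from frechet_derivative_at[OF this, symmetric] show ?thesis
    unfolding second_derivative_def 1 by simp
qed

text \<open>This form of the eigenvalue equation is what survives a change of chart: the extra term in the
  chain rule for the second derivative is tangential, hence orthogonal to the normal.\<close>

lemma eigenpair_iff:
  "eigenpair l v \<longleftrightarrow> (\<forall>w. - sf_inner \<kappa> (second_derivative v w) (\<nu> x) =
     l * sf_inner \<kappa> (frechet_derivative Y (at u) v) (frechet_derivative Y (at u) w))"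
proof -
  have p: "frechet_derivative (partial i Y) (at u) w = w $ 1 *\<^sub>R yy 1 i + w $ 2 *\<^sub>R yy 2 i" for i w
    unfolding partial_def[of _ "partial i Y"] by (rule frechet_2[OF partial_differentiable])
  have lhs: "- sf_inner \<kappa> (second_derivative v w) (\<nu> x) =
      w $ 1 * (cL * v $ 1 + cM * v $ 2) + w $ 2 * (cM * v $ 1 + cN * v $ 2)" for w
    unfolding second_derivative_expand p by (simp add: sf_inner_simps yy_commute algebra_simps)
  have rhs: "sf_inner \<kappa> (frechet_derivative Y (at u) v) (frechet_derivative Y (at u) w) =
      w $ 1 * (cE * v $ 1 + cF * v $ 2) + w $ 2 * (cF * v $ 1 + cG * v $ 2)" for w
    unfolding DY_expand[of v] DY_expand[of w]
    by (simp add: sf_inner_simps sf_inner_commute[of \<kappa> "y 2" "y 1"] algebra_simps)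
  show ?thesis
  proof
    assume "eigenpair l v"
    then show "\<forall>w. - sf_inner \<kappa> (second_derivative v w) (\<nu> x) =
        l * sf_inner \<kappa> (frechet_derivative Y (at u) v) (frechet_derivative Y (at u) w)"
      unfolding lhs rhs eigenpair_def by (simp only:) (simp add: algebra_simps)
  next
    assume a: "\<forall>w. - sf_inner \<kappa> (second_derivative v w) (\<nu> x) =
        l * sf_inner \<kappa> (frechet_derivative Y (at u) v) (frechet_derivative Y (at u) w)"
    show "eigenpair l v"
      using spec[OF a, of "axis 1 1"] spec[OF a, of "axis 2 1"]
      unfolding lhs rhs eigenpair_def by (simp add: axis_def)
  qed
qed

lemma weingarten_eigen_iff:
  "weingarten \<kappa> X \<nu> c x *v v = l *\<^sub>R v \<longleftrightarrow> eigenpair l v"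
proof -
  let ?g = "first_fundamental_form \<kappa> X c x" and ?h = "second_fundamental_form \<kappa> X \<nu> c x"
  have "det ?g \<noteq> 0"
    using gram_pos by (simp add: det_2 first_form sf_inner_commute[of \<kappa> "y 2" "y 1"] power2_eq_square)
  then have "invertible ?g" by (simp add: invertible_det_nz)
  then have inv: "?g ** matrix_inv ?g = mat 1" "matrix_inv ?g ** ?g = mat 1"
    unfolding matrix_inv_def using someI_ex[of "\<lambda>B. ?g ** B = mat 1 \<and> B ** ?g = mat 1"]
    by (simp_all add: invertible_def)
  have "weingarten \<kappa> X \<nu> c x *v v = l *\<^sub>R v \<longleftrightarrow> ?h *v v = l *\<^sub>R (?g *v v)"
  proof
    assume "weingarten \<kappa> X \<nu> c x *v v = l *\<^sub>R v"
    then have "?g *v (weingarten \<kappa> X \<nu> c x *v v) = ?g *v (l *\<^sub>R v)" by simp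
    then show "?h *v v = l *\<^sub>R (?g *v v)"
      by (simp add: weingarten_def matrix_vector_mul_assoc matrix_mul_assoc inv matrix_vector_mult_scaleR)
  next
    assume "?h *v v = l *\<^sub>R (?g *v v)"
    then have "matrix_inv ?g *v (?h *v v) = matrix_inv ?g *v (l *\<^sub>R (?g *v v))" by simp
    then show "weingarten \<kappa> X \<nu> c x *v v = l *\<^sub>R v"
      by (simp add: weingarten_def matrix_vector_mul_assoc inv matrix_vector_mult_scaleR)
  qed
  also have "\<dots> \<longleftrightarrow> eigenpair l v"
    unfolding eigenpair_def
    by (simp add: vec_eq_iff forall_2 matrix_vector_mult_def sum_2 first_form second_form yy_commute
        sf_inner_commute[of \<kappa> "y 2" "y 1"])
  finally show ?thesis .
qed

text \<open>\<open>principal_curvatures\<close> collects eigenvalues over all charts at x, so they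
  must be shown to agree. The new eigenvector is the image under the differential of the transition
  map. That differential is injective because the immersion is, hence every test vector in the new
  chart has a preimage.\<close>

lemma eigenpair_chart_change:
  assumes d: "d \<in> A" "x \<in> fst d" and v: "v \<noteq> 0" "eigenpair l v"
  shows "\<exists>w. w \<noteq> 0 \<and> surface_point.eigenpair \<kappa> X \<nu> d x l w"
proof -
  interpret d: surface_point \<kappa> M A X \<nu> d x
    by unfold_locales (use \<kappa> M immersion normal d in auto)
  define \<tau> where "\<tau> = snd d \<circ> inv_into (fst c) (snd c)"
  let ?O = "snd c ` (fst c \<inter> fst d)"
  have OO: "open ?O" "u \<in> ?O" using open_chart_image[OF M c(1) d(1)] c d by auto
  have "smooth_on ?O \<tau>"
    unfolding \<tau>_def by (rule closed_surface_transition[OF M c(1) d(1)])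
  then obtain V where V: "open V" "u \<in> V" "V \<subseteq> ?O" "smooth_in V \<tau>" using OO smooth_on_openD by metis
  let ?D\<tau> = "\<lambda>p. frechet_derivative \<tau> (at p)"
  have \<tau>': "(\<tau> has_derivative ?D\<tau> p) (at p)" if "p \<in> V" for p
    using smooth_in_has_derivative[OF V(1,4) that] .
  have \<tau>u: "\<tau> u = d.u" using chart_inv_into[OF M c] by (simp add: \<tau>_def)
  have \<tau>S: "\<tau> p \<in> d.S" and eq: "d.Y (\<tau> p) = Y p" if p: "p \<in> ?O" for p
  proof -
    obtain z where "z \<in> fst c" "z \<in> fst d" "p = snd c z" using p by blast
    then show "\<tau> p \<in> d.S" "d.Y (\<tau> p) = Y p"
      using chart_inv_into[OF M c(1)] chart_inv_into[OF M d(1)] by (simp_all add: local_param_def \<tau>_def)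
  qed
  have chain: "frechet_derivative Y (at p) w = frechet_derivative d.Y (at (\<tau> p)) (?D\<tau> p w)" if p: "p \<in> V" for p w
  proof -
    have pO: "p \<in> ?O" using p V(3) by blast
    have "(d.Y has_derivative frechet_derivative d.Y (at (\<tau> p))) (at (\<tau> p))"
      using d.Y_differentiable[OF \<tau>S[OF pO]] frechet_derivative_works by blast
    from has_derivative_compose[OF \<tau>'[OF p] this]
    have "(Y has_derivative (\<lambda>w. frechet_derivative d.Y (at (\<tau> p)) (?D\<tau> p w))) (at p)"
      by (rule has_derivative_transform_within_open[OF _ OO(1) pO]) (rule eq)
    from frechet_derivative_at[OF this, symmetric] show ?thesis by simp
  qed
  let ?v = "?D\<tau> u v"
  have second: "second_derivative v w = d.second_derivative ?v (?D\<tau> u w)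
      + frechet_derivative d.Y (at d.u) (frechet_derivative (\<lambda>p. ?D\<tau> p v) (at u) w)" for w
  proof -
    let ?a = "\<lambda>p. ?D\<tau> p v"
    have 1: "frechet_derivative (\<lambda>p. frechet_derivative Y (at p) v) (at u) =
      frechet_derivative (\<lambda>p. ?a p $ 1 *\<^sub>R partial 1 d.Y (\<tau> p) + ?a p $ 2 *\<^sub>R partial 2 d.Y (\<tau> p)) (at u)"
    proof (rule frechet_derivative_cong_open[OF V(1,2)])
      fix p assume p: "p \<in> V"
      then have "\<tau> p \<in> d.S" using \<tau>S V(3) by blast
      then show "frechet_derivative Y (at p) v = ?a p $ 1 *\<^sub>R partial 1 d.Y (\<tau> p) + ?a p $ 2 *\<^sub>R partial 2 d.Y (\<tau> p)"
        unfolding chain[OF p] partial_def by (rule frechet_2[OF d.Y_differentiable])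
    qed
    have a': "(?a has_derivative frechet_derivative ?a (at u)) (at u)"
      by (rule smooth_in_has_derivative[OF V(1) smooth_in_frechet[OF V(4)] V(2)])
    have p': "((\<lambda>p. partial k d.Y (\<tau> p)) has_derivative (\<lambda>w. frechet_derivative (partial k d.Y) (at d.u) (?D\<tau> u w))) (at u)" for k
      by (rule has_derivative_compose[OF \<tau>'[OF V(2)]])
        (use d.partial_differentiable[of k] in \<open>simp add: \<tau>u frechet_derivative_works\<close>)
    have a'k: "((\<lambda>p. ?a p $ k) has_derivative (\<lambda>w. frechet_derivative ?a (at u) w $ k)) (at u)" for k
      using bounded_linear.has_derivative[OF bounded_linear_vec_nth a'] .
    have "((\<lambda>p. ?a p $ 1 *\<^sub>R partial 1 d.Y (\<tau> p) + ?a p $ 2 *\<^sub>R partial 2 d.Y (\<tau> p)) has_derivative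
      (\<lambda>w. (?a u $ 1 *\<^sub>R frechet_derivative (partial 1 d.Y) (at d.u) (?D\<tau> u w) + frechet_derivative ?a (at u) w $ 1 *\<^sub>R partial 1 d.Y (\<tau> u))
         + (?a u $ 2 *\<^sub>R frechet_derivative (partial 2 d.Y) (at d.u) (?D\<tau> u w) + frechet_derivative ?a (at u) w $ 2 *\<^sub>R partial 2 d.Y (\<tau> u)))) (at u)"
      by (intro has_derivative_add has_derivative_scaleR a'k p')
    from frechet_derivative_at[OF this, symmetric] show ?thesis
      unfolding second_derivative_def 1 d.second_derivative_expand d.DY_expand by (simp add: \<tau>u)
  qed
  have lin: "linear (?D\<tau> u)" using \<tau>'[OF V(2)] has_derivative_linear by blast
  have DY0: "frechet_derivative Y (at u) 0 = 0"
    using DY_expand[of 0] by simp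
  have inj: "inj (?D\<tau> u)"
  proof (rule injI)
    fix a b assume "?D\<tau> u a = ?D\<tau> u b"
    then have "frechet_derivative Y (at u) a = frechet_derivative Y (at u) b"
      using chain[OF V(2)] by simp
    then show "a = b" using inj_DY by (simp add: inj_eq)
  qed
  have "?v \<noteq> 0" using inj lin v(1) by (metis injD linear_0)
  moreover have "d.eigenpair l ?v"
    unfolding d.eigenpair_iff
  proof
    fix w
    obtain w' where w': "w = ?D\<tau> u w'" using linear_injective_imp_surjective[OF lin inj] by (auto simp: surj_def)
    have "- sf_inner \<kappa> (d.second_derivative ?v w) (\<nu> x) = - sf_inner \<kappa> (second_derivative v w') (\<nu> x)"
      unfolding second w' by (simp add: sf_inner_simps d.inner_DY_\<nu>)
    also have "\<dots> = l * sf_inner \<kappa> (frechet_derivative Y (at u) v) (frechet_derivative Y (at u) w')"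
      using v(2) unfolding eigenpair_iff by blast
    finally show "- sf_inner \<kappa> (d.second_derivative ?v w) (\<nu> x)
        = l * sf_inner \<kappa> (frechet_derivative d.Y (at d.u) ?v) (frechet_derivative d.Y (at d.u) w)"
      unfolding chain[OF V(2)] w' \<tau>u .
  qed
  ultimately show ?thesis by blast
qed

lemma eigenpair_root:
  "(\<exists>v. v \<noteq> 0 \<and> eigenpair l v) \<longleftrightarrow>
     l = pencil_root (-1) cE cF cG cL cM cN \<or> l = pencil_root 1 cE cF cG cL cM cN"
proof -
  have "(\<exists>v. v \<noteq> 0 \<and> eigenpair l v) \<longleftrightarrow> (\<exists>a b. (a, b) \<noteq> (0, 0) \<and>
    cL * a + cM * b = l * (cE * a + cF * b) \<and> cM * a + cN * b = l * (cF * a + cG * b))"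
  proof
    assume "\<exists>v. v \<noteq> 0 \<and> eigenpair l v"
    then obtain v where v: "v \<noteq> 0" "eigenpair l v" by blast
    have "(v $ 1, v $ 2) \<noteq> (0, 0)" using v(1) by (auto simp: vec_eq_iff forall_2)
    then show "\<exists>a b. (a, b) \<noteq> (0, 0) \<and>
        cL * a + cM * b = l * (cE * a + cF * b) \<and> cM * a + cN * b = l * (cF * a + cG * b)"
      using v(2) unfolding eigenpair_def by blast
  next
    assume "\<exists>a b. (a, b) \<noteq> (0, 0) \<and>
        cL * a + cM * b = l * (cE * a + cF * b) \<and> cM * a + cN * b = l * (cF * a + cG * b)"
    then obtain a b where ab: "(a, b) \<noteq> (0, 0)"
        "cL * a + cM * b = l * (cE * a + cF * b)" "cM * a + cN * b = l * (cF * a + cG * b)" by blast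
    have "vector [a, b] \<noteq> (0 :: real^2)" using ab(1) by (metis vector_2 zero_index)
    moreover have "eigenpair l (vector [a, b])"
      unfolding eigenpair_def using ab(2,3) by (simp add: vector_2)
    ultimately show "\<exists>v. v \<noteq> 0 \<and> eigenpair l v" by blast
  qed
  then show ?thesis unfolding pencil_eigenvalue_iff[OF cE_pos gram_pos] .
qed

lemma principal_curvatures_eq:
  "principal_curvatures \<kappa> A X \<nu> x =
    {pencil_root (-1) cE cF cG cL cM cN, pencil_root 1 cE cF cG cL cM cN}"
proof -
  have "l \<in> principal_curvatures \<kappa> A X \<nu> x \<longleftrightarrow> (\<exists>v. v \<noteq> 0 \<and> eigenpair l v)" for l
  proof
    assume "l \<in> principal_curvatures \<kappa> A X \<nu> x"
    then obtain d v where d: "d \<in> A" "x \<in> fst d" "v \<noteq> 0" "weingarten \<kappa> X \<nu> d x *v v = l *\<^sub>R v"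
      unfolding principal_curvatures_def by blast
    interpret d: surface_point \<kappa> M A X \<nu> d x
      by unfold_locales (use \<kappa> M immersion normal d in auto)
    show "\<exists>v. v \<noteq> 0 \<and> eigenpair l v"
      using d.eigenpair_chart_change[OF c d(3)] d(4) by (simp add: d.weingarten_eigen_iff)
  next
    assume "\<exists>v. v \<noteq> 0 \<and> eigenpair l v"
    then show "l \<in> principal_curvatures \<kappa> A X \<nu> x"
      unfolding principal_curvatures_def weingarten_eigen_iff[symmetric] using c by blast
  qed
  then show ?thesis using eigenpair_root by blast
qed

lemma lambda_eq:
  "lambda1 \<kappa> A X \<nu> x = pencil_root (-1) cE cF cG cL cM cN"
  "lambda2 \<kappa> A X \<nu> x = pencil_root 1 cE cF cG cL cM cN"
  using principal_curvatures_eq pencil_root_less(1)[OF cE_pos gram_pos, of cL cM cN]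
  by (simp_all add: lambda1_def lambda2_def)

section \<open>The differential of the unit normal\<close>

lemma inner_Dn_\<nu>:
  assumes diff: "n differentiable (at u)"
  shows "sf_inner \<kappa> (frechet_derivative n (at u) v) (\<nu> x) = 0"
proof -
  have "frechet_derivative (\<lambda>v. sf_inner \<kappa> (n v) (n v)) (at u) = frechet_derivative (\<lambda>v. 1) (at u)"
    by (rule frechet_derivative_cong_open[OF open_S u]) (rule normal_at(2))
  then have "frechet_derivative (\<lambda>v. sf_inner \<kappa> (n v) (n v)) (at u) v = 0" by simp
  then show ?thesis
    unfolding frechet_bilinear[OF bounded_bilinear_sf_inner diff diff]
    by (simp add: param_at sf_inner_commute)
qed

lemma radial_Dn:
  assumes diff: "n differentiable (at u)"
  shows "sf_radial \<kappa> (X x) (frechet_derivative n (at u) v) = 0"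
proof -
  have "frechet_derivative (\<lambda>v. sf_radial \<kappa> (Y v) (n v)) (at u) = frechet_derivative (\<lambda>v. 0) (at u)"
    by (rule frechet_derivative_cong_open[OF open_S u]) (rule normal_at(1))
  then have "frechet_derivative (\<lambda>v. sf_radial \<kappa> (Y v) (n v)) (at u) v = 0" by simp
  then have "sf_radial \<kappa> (X x) (frechet_derivative n (at u) v) + sf_radial \<kappa> (frechet_derivative Y (at u) v) (\<nu> x) = 0"
    unfolding frechet_bilinear[OF bounded_bilinear_sf_radial Y_differentiable[OF u] diff] by (simp add: param_at)
  then show ?thesis
    using sf_radial_tangent[OF \<kappa> point_space_form radial_DY] by (simp add: inner_DY_\<nu>)
qed

lemma inner_Dn_partial:
  assumes diff: "n differentiable (at u)"
  shows "sf_inner \<kappa> (frechet_derivative n (at u) (axis i 1)) (y j) = - sf_inner \<kappa> (yy i j) (\<nu> x)"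
proof -
  have "frechet_derivative (\<lambda>v. sf_inner \<kappa> (partial j Y v) (n v)) (at u) = frechet_derivative (\<lambda>v. 0) (at u)"
    by (rule frechet_derivative_cong_open[OF open_S u]) (rule normal_at(3))
  then have "frechet_derivative (\<lambda>v. sf_inner \<kappa> (partial j Y v) (n v)) (at u) (axis i 1) = 0" by simp
  then have "sf_inner \<kappa> (y j) (frechet_derivative n (at u) (axis i 1)) + sf_inner \<kappa> (yy i j) (\<nu> x) = 0"
    unfolding frechet_bilinear[OF bounded_bilinear_sf_inner partial_differentiable diff]
    by (simp add: param_at partial_def)
  then show ?thesis by (simp add: sf_inner_commute[of \<kappa> "y j"])
qed

text \<open>Rodrigues' formula. Both sides are tangent to the space form, orthogonal to the normal,
  and have equal inner products with \<open>y 1\<close> and \<open>y 2\<close>.\<close>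

lemma eigenpair_Dn:
  assumes diff: "n differentiable (at u)" and v: "eigenpair l v"
  shows "frechet_derivative n (at u) v = l *\<^sub>R frechet_derivative Y (at u) v"
proof -
  let ?r = "frechet_derivative n (at u) v - l *\<^sub>R frechet_derivative Y (at u) v"
  have inner: "sf_inner \<kappa> ?r (y 1) = cL * v $ 1 + cM * v $ 2 - l * (cE * v $ 1 + cF * v $ 2)"
    "sf_inner \<kappa> ?r (y 2) = cM * v $ 1 + cN * v $ 2 - l * (cF * v $ 1 + cG * v $ 2)"
    unfolding frechet_2[OF diff, of v] DY_expand[of v]
    by (simp_all add: sf_inner_simps inner_Dn_partial[OF diff] yy_commute sf_inner_commute[of \<kappa> "y 2" "y 1"] algebra_simps)
  have "?r = 0"
  proof (rule sf_orthogonal_complement_trivial[OF \<kappa> point_space_form radial_y radial_y normal_at_point(1) _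
          independent normal_at_point(2) normal_at_point(3) normal_at_point(3)])
    show "sf_inner \<kappa> ?r (y 1) = 0" "sf_inner \<kappa> ?r (y 2) = 0"
      using v unfolding inner eigenpair_def by simp_all
  qed (simp_all add: sf_radial_simps sf_inner_simps radial_Dn[OF diff] radial_DY inner_Dn_\<nu>[OF diff] inner_DY_\<nu>)
  then show ?thesis by simp
qed

end

subsection \<open>The flow in a space-time patch\<close>

lemma open_positive:
  fixes f :: "'a::topological_space \<Rightarrow> real"
  assumes "open V" "continuous_on V f"
  shows "open {z \<in> V. f z > 0}"
proof -
  have "open (f -` {0<..} \<inter> V)"
    using assms(2) unfolding continuous_on_open_vimage[OF assms(1)] by simp
  moreover have "f -` {0<..} \<inter> V = {z \<in> V. f z > 0}" by auto
  ultimately show ?thesis by simp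
qed

locale surface_flow =
  fixes \<kappa> :: real and F :: "real^2 \<Rightarrow> real" and \<alpha> :: real and M :: "'m::t2_space set" and A :: "'m chart set"
    and T :: ereal and X \<nu> :: "real \<Rightarrow> 'm \<Rightarrow> ambient"
  assumes \<kappa>: "\<kappa> \<in> {0, 1, -1}" and M: "closed_surface M A" and F: "curvature_function F"
    and \<alpha>: "admissible_exponent \<kappa> \<alpha>" and flow: "expanding_flow \<kappa> F \<alpha> M A T X \<nu>"
begin

abbreviation "I \<equiv> time_interval T"

definition "speed t x = F (vector [lambda1 \<kappa> A (X t) (\<nu> t) x, lambda2 \<kappa> A (X t) (\<nu> t) x]) powr (- \<alpha>)"

lemma open_before: "open {t. ereal t < T}"
  by (cases T) (auto simp: lessThan_def[symmetric])

lemma mem_I: "t \<in> I \<longleftrightarrow> 0 \<le> t \<and> ereal t < T"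
  by (simp add: time_interval_def)

lemma zero_in_I: "0 \<in> I"
  using flow by (simp add: mem_I expanding_flow_def zero_ereal_def[symmetric])

lemma I_downward: "t \<in> I \<Longrightarrow> 0 \<le> s \<Longrightarrow> s \<le> t \<Longrightarrow> s \<in> I"
  unfolding mem_I by (meson ereal_less_eq(3) le_less_trans)

text \<open>Points to the right of t always belong to \<open>I\<close>, so derivatives within
  \<open>I\<close> are unique also at time 0.\<close>

lemma at_within_I:
  assumes "t \<in> I"
  shows "at t within I \<noteq> bot"
proof -
  obtain e where e: "e > 0" "ball t e \<subseteq> {t. ereal t < T}"
    using open_before assms by (metis (no_types, lifting) mem_Collect_eq mem_I open_contains_ball)
  have "{t<..<t+e} \<subseteq> I" using e assms by (auto simp: mem_I dist_real_def subset_iff)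
  moreover have "t islimpt {t<..<t+e}" using e by (simp add: islimpt_greaterThanLessThan1)
  ultimately show ?thesis using islimpt_subset trivial_limit_within by blast
qed

lemma flow_at:
  assumes "t \<in> I"
  shows "smooth_immersion \<kappa> M A (X t)" "unit_normal \<kappa> M A (X t) (\<nu> t)"
    "strictly_convex \<kappa> M A (X t) (\<nu> t)"
    "x \<in> M \<Longrightarrow> ((\<lambda>s. X s x) has_vector_derivative speed t x *\<^sub>R \<nu> t x) (at t within I)"
  using flow assms unfolding expanding_flow_def outer_unit_normal_def speed_def by auto

lemma surface_point_at:
  assumes "t \<in> I" "c \<in> A" "x \<in> fst c"
  shows "surface_point \<kappa> M A (X t) (\<nu> t) c x"
  using \<kappa> M flow_at[OF assms(1)] assms by unfold_locales auto

lemma lambda_props: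
  assumes "t \<in> I" "x \<in> M"
  shows "0 < lambda1 \<kappa> A (X t) (\<nu> t) x" "lambda1 \<kappa> A (X t) (\<nu> t) x \<le> lambda2 \<kappa> A (X t) (\<nu> t) x"
    "principal_curvatures \<kappa> A (X t) (\<nu> t) x = {lambda1 \<kappa> A (X t) (\<nu> t) x, lambda2 \<kappa> A (X t) (\<nu> t) x}"
proof -
  obtain c where c: "c \<in> A" "x \<in> fst c" using closed_surface_covered[OF M assms(2)] .
  interpret surface_point \<kappa> M A "X t" "\<nu> t" c x by (rule surface_point_at[OF assms(1) c])
  show pc: "principal_curvatures \<kappa> A (X t) (\<nu> t) x = {lambda1 \<kappa> A (X t) (\<nu> t) x, lambda2 \<kappa> A (X t) (\<nu> t) x}"
    unfolding lambda_eq by (rule principal_curvatures_eq)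
  show "0 < lambda1 \<kappa> A (X t) (\<nu> t) x"
    using flow_at(3)[OF assms(1)] assms(2) pc unfolding strictly_convex_def by blast
  show "lambda1 \<kappa> A (X t) (\<nu> t) x \<le> lambda2 \<kappa> A (X t) (\<nu> t) x"
    unfolding lambda_eq by (rule pencil_root_less(1)[OF cE_pos gram_pos])
qed

lemma speed_pos:
  assumes "t \<in> I" "x \<in> M"
  shows "speed t x > 0"
proof -
  have "vector [lambda1 \<kappa> A (X t) (\<nu> t) x, lambda2 \<kappa> A (X t) (\<nu> t) x] \<in> Gamma_plus"
    using lambda_props[OF assms] by (simp add: Gamma_plus_def vector_2)
  then show ?thesis using F by (auto simp: speed_def curvature_function_def)
qed

end

lemma slice_derivative:
  fixes f :: "real \<times> (real^2) \<Rightarrow> 'b::euclidean_space"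
  assumes "open W" "smooth_in W f" "(s, u) \<in> W" "\<And>u'. (s, u') \<in> W \<Longrightarrow> h u' = f (s, u')"
  shows "(h has_derivative (\<lambda>v. frechet_derivative f (at (s, u)) (0, v))) (at u)"
proof -
  have "((\<lambda>u'. f (s, u')) has_derivative (\<lambda>v. frechet_derivative f (at (s, u)) (0, v))) (at u)"
    by (rule has_derivative_compose[where f="\<lambda>u'. (s, u')" and g=f, OF _ smooth_in_has_derivative[OF assms(1-3)]])
      (intro has_derivative_Pair has_derivative_const has_derivative_ident)
  moreover have "open ((\<lambda>u'. (s, u')) -` W)"
    by (intro open_vimage assms(1) continuous_intros)
  ultimately show ?thesis
    using assms(3,4) by (auto intro: has_derivative_transform_within_open)
qed

text \<open>A smooth extension \<open>g\<close> of the flow in one chart, possibly to negative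
  times. It represents the flow only for s \<ge> 0, which is why facts about the surfaces carry that
  premise.\<close>

locale flow_patch = surface_flow +
  fixes c and W :: "(real \<times> (real^2)) set" and g :: "real \<times> (real^2) \<Rightarrow> ambient"
  assumes c: "c \<in> A" and W: "open W" "W \<subseteq> {t. ereal t < T} \<times> snd c ` fst c"
    and g: "smooth_in W g" "\<And>s u. (s, u) \<in> W \<Longrightarrow> 0 \<le> s \<Longrightarrow> g (s, u) = local_param (X s) c u"
begin

definition "gt = dd (\<lambda>_. (1, 0)) g"
definition "gx i = dd (\<lambda>_. (0, axis i 1)) g"
definition "gxx i j = dd (\<lambda>_. (0, axis i 1)) (gx j)"

lemma smooth_g: "smooth_in W gt" "smooth_in W (gx i)" "smooth_in W (gxx i j)"
  unfolding gt_def gxx_def gx_def by (intro smooth_intros W g)+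

abbreviation "pt u \<equiv> inv_into (fst c) (snd c) u"

lemma patch_point:
  assumes "(s, u) \<in> W" "0 \<le> s"
  shows "s \<in> I" "pt u \<in> fst c" "snd c (pt u) = u" "pt u \<in> M"
proof -
  have "ereal s < T" "u \<in> snd c ` fst c" using assms(1) W(2) by auto
  then show "s \<in> I" "pt u \<in> fst c" "snd c (pt u) = u"
    using assms(2) by (auto simp: mem_I inv_into_into f_inv_into_f)
  then show "pt u \<in> M" using closed_surface_chart(1)[OF M c] by blast
qed

lemma param_derivative:
  assumes "(s, u) \<in> W" "0 \<le> s"
  shows "frechet_derivative (local_param (X s) c) (at u) v = frechet_derivative g (at (s, u)) (0, v)"
  using frechet_derivative_at[OF slice_derivative[OF W(1) g(1) assms(1)], of "local_param (X s) c", symmetric]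
    g(2) assms(2) by auto

lemma partial_param:
  assumes "(s, u) \<in> W" "0 \<le> s"
  shows "partial i (local_param (X s) c) u = gx i (s, u)"
  using param_derivative[OF assms] by (simp add: partial_def gx_def dd_def)

lemma partial_partial_param:
  assumes "(s, u) \<in> W" "0 \<le> s"
  shows "partial i (partial j (local_param (X s) c)) u = gxx i j (s, u)"
  using frechet_derivative_at[OF slice_derivative[OF W(1) smooth_g(2) assms(1)], of "partial j (local_param (X s) c)", symmetric]
    partial_param[OF _ assms(2)] by (auto simp: partial_def[of _ "partial j _"] gxx_def dd_def)

text \<open>At time 0 the flow equation is one-sided, whereas \<open>gt\<close> comes from the full
  derivative of the extension. Uniqueness of the derivative within \<open>I\<close> identifies the
  two.\<close>

lemma time_derivative:
  assumes "(s, u) \<in> W" "0 \<le> s"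
  shows "gt (s, u) = speed s (pt u) *\<^sub>R \<nu> s (pt u)"
proof -
  note p = patch_point[OF assms]
  have "((\<lambda>\<sigma>. g (\<sigma>, u)) has_derivative (\<lambda>h. frechet_derivative g (at (s, u)) (h, 0))) (at s within I)"
    by (rule has_derivative_compose[where f="\<lambda>\<sigma>. (\<sigma>, u)" and g=g, OF _ smooth_in_has_derivative[OF W(1) g(1) assms(1)]])
      (intro has_derivative_Pair has_derivative_const has_derivative_ident)
  moreover have "(\<lambda>h. frechet_derivative g (at (s, u)) (h, 0)) = (\<lambda>h. h *\<^sub>R gt (s, u))"
  proof
    fix h :: real
    have "linear (frechet_derivative g (at (s, u)))"
      using smooth_in_has_derivative[OF W(1) g(1) assms(1)] has_derivative_linear by blast
    from linear_scale[OF this, of h "(1, 0)"]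
    show "frechet_derivative g (at (s, u)) (h, 0) = h *\<^sub>R gt (s, u)"
      by (simp add: gt_def dd_def)
  qed
  ultimately have "((\<lambda>\<sigma>. g (\<sigma>, u)) has_vector_derivative gt (s, u)) (at s within I)"
    by (simp add: has_vector_derivative_def)
  moreover have "((\<lambda>\<sigma>. g (\<sigma>, u)) has_vector_derivative speed s (pt u) *\<^sub>R \<nu> s (pt u)) (at s within I)"
  proof -
    have "open ((\<lambda>\<sigma>. (\<sigma>, u)) -` W)"
      by (intro open_vimage W continuous_intros)
    then obtain e where e: "e > 0" "ball s e \<subseteq> (\<lambda>\<sigma>. (\<sigma>, u)) -` W"
      using assms(1) by (meson open_contains_ball vimageI)
    show ?thesis
    proof (rule has_vector_derivative_transform_within[OF flow_at(4)[OF p(1,4)] e(1) p(1)])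
      fix \<sigma> assume "\<sigma> \<in> I" "dist \<sigma> s < e"
      then have "(\<sigma>, u) \<in> W" "0 \<le> \<sigma>" using e(2) by (auto simp: mem_I dist_commute subset_iff)
      then show "X \<sigma> (pt u) = g (\<sigma>, u)" using g(2) by (simp add: local_param_def)
    qed
  qed
  ultimately show ?thesis using vector_derivative_unique_within[OF at_within_I[OF p(1)]] by blast
qed

text \<open>Outside the flow equation nothing is assumed about the regularity of the normal. Since the velocity
  is \<open>\<phi> \<nu>\<close> with \<open>\<phi> > 0\<close>, the normal is the normalised velocity \<open>n\<close> and therefore smooth in space
  and time.\<close>

definition "\<phi> z = sqrt (sf_inner \<kappa> (gt z) (gt z))"
definition "n z = (1 / \<phi> z) *\<^sub>R gt z"
definition "cE z = sf_inner \<kappa> (gx 1 z) (gx 1 z)"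
definition "cF z = sf_inner \<kappa> (gx 1 z) (gx 2 z)"
definition "cG z = sf_inner \<kappa> (gx 2 z) (gx 2 z)"
definition "cL z = - sf_inner \<kappa> (gxx 1 1 z) (n z)"
definition "cM z = - sf_inner \<kappa> (gxx 1 2 z) (n z)"
definition "cN z = - sf_inner \<kappa> (gxx 2 2 z) (n z)"
definition "disc z = pencil_disc (cE z) (cF z) (cG z) (cL z) (cM z) (cN z)"
definition "lam \<sigma> z = pencil_root \<sigma> (cE z) (cF z) (cG z) (cL z) (cM z) (cN z)"

lemma \<phi>_n:
  assumes "(s, u) \<in> W" "0 \<le> s"
  shows "sf_inner \<kappa> (gt (s, u)) (gt (s, u)) > 0" "\<phi> (s, u) = speed s (pt u)" "n (s, u) = \<nu> s (pt u)"
proof -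
  note p = patch_point[OF assms]
  have pos: "speed s (pt u) > 0" by (rule speed_pos[OF p(1,4)])
  interpret sp: surface_point \<kappa> M A "X s" "\<nu> s" c "pt u" by (rule surface_point_at[OF p(1) c p(2)])
  have eq: "sf_inner \<kappa> (gt (s, u)) (gt (s, u)) = (speed s (pt u))\<^sup>2"
    unfolding time_derivative[OF assms] using sp.normal_at_point(2) by (simp add: sf_inner_simps power2_eq_square)
  show "sf_inner \<kappa> (gt (s, u)) (gt (s, u)) > 0" unfolding eq using pos by simp
  show \<phi>: "\<phi> (s, u) = speed s (pt u)" unfolding \<phi>_def eq using pos by simp
  show "n (s, u) = \<nu> s (pt u)" unfolding n_def \<phi> time_derivative[OF assms] using pos by simp
qed

lemma coefficients_pos:
  assumes "(s, u) \<in> W" "0 \<le> s"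
  shows "cE (s, u) > 0" "cE (s, u) * cG (s, u) - (cF (s, u))\<^sup>2 > 0"
    "lambda1 \<kappa> A (X s) (\<nu> s) (pt u) = lam (-1) (s, u)" "lambda2 \<kappa> A (X s) (\<nu> s) (pt u) = lam 1 (s, u)"
proof -
  note p = patch_point[OF assms]
  interpret sp: surface_point \<kappa> M A "X s" "\<nu> s" c "pt u" by (rule surface_point_at[OF p(1) c p(2)])
  note eqs = cE_def cF_def cG_def cL_def cM_def cN_def \<phi>_n(3)[OF assms] lam_def
  show "cE (s, u) > 0" "cE (s, u) * cG (s, u) - (cF (s, u))\<^sup>2 > 0"
    using sp.cE_pos sp.gram_pos unfolding p(3) partial_partial_param[OF assms] partial_param[OF assms] eqs .
  show "lambda1 \<kappa> A (X s) (\<nu> s) (pt u) = lam (-1) (s, u)" "lambda2 \<kappa> A (X s) (\<nu> s) (pt u) = lam 1 (s, u)"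
    using sp.lambda_eq unfolding p(3) partial_partial_param[OF assms] partial_param[OF assms] eqs .
qed

lemma smooth_coefficients:
  assumes V: "open V" "V \<subseteq> W" and pos: "\<And>z. z \<in> V \<Longrightarrow> sf_inner \<kappa> (gt z) (gt z) > 0"
  shows "smooth_in V \<phi>" "smooth_in V n" "smooth_in V cE" "smooth_in V cF" "smooth_in V cG"
    "smooth_in V cL" "smooth_in V cM" "smooth_in V cN" "smooth_in V disc"
proof -
  note s [smooth_intros] = V(1) smooth_g[THEN smooth_in_subset[OF _ V(2)]]
  show \<phi>: "smooth_in V \<phi>" unfolding \<phi>_def[abs_def] by (intro smooth_intros pos)
  then show n: "smooth_in V n" unfolding n_def[abs_def]
    by (intro smooth_intros) (use pos in \<open>force simp: \<phi>_def\<close>)+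
  show "smooth_in V cE" "smooth_in V cF" "smooth_in V cG"
    unfolding cE_def[abs_def] cF_def[abs_def] cG_def[abs_def] by (intro smooth_intros)+
  moreover show "smooth_in V cL" "smooth_in V cM" "smooth_in V cN"
    unfolding cL_def[abs_def] cM_def[abs_def] cN_def[abs_def] by (intro smooth_intros n)+
  ultimately show "smooth_in V disc"
    unfolding disc_def[abs_def] pencil_disc_def power2_eq_square by (intro smooth_intros)
qed

text \<open>Only continuity is claimed because the square root of the discriminant may fail to be
  smooth at umbilic points. Negative times are cut off since the extension need not be an immersion
  there.\<close>

lemma continuous_lam: "continuous_on (W \<inter> {0..} \<times> UNIV) (lam \<sigma>)"
proof -
  let ?V = "{z \<in> W. sf_inner \<kappa> (gt z) (gt z) > 0}"
  have V: "open ?V" "?V \<subseteq> W"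
    using open_positive[OF W(1) smooth_in_continuous_on[OF smooth_in_sf_inner[OF W(1) smooth_g(1) smooth_g(1)]]]
    by auto
  have sub: "W \<inter> {0..} \<times> UNIV \<subseteq> ?V" using \<phi>_n(1) by auto
  have "smooth_in ?V cE" "smooth_in ?V cF" "smooth_in ?V cG"
    "smooth_in ?V cL" "smooth_in ?V cM" "smooth_in ?V cN" "smooth_in ?V disc"
    by (rule smooth_coefficients[OF V], simp)+
  note co = this[THEN smooth_in_continuous_on, THEN continuous_on_subset[OF _ sub]]
  have nz: "cE z * cG z - (cF z)\<^sup>2 \<noteq> 0" if "z \<in> W \<inter> {0..} \<times> UNIV" for z
    using that coefficients_pos(2) by force
  show ?thesis
    unfolding lam_def[abs_def] pencil_root_def disc_def[symmetric]
    by (intro continuous_intros co) (use nz in auto)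
qed

end

lemma (in surface_flow) flow_patch_exists:
  assumes "t \<in> I" "c \<in> A" "x \<in> fst c"
  obtains W g where "flow_patch \<kappa> F \<alpha> M A T X \<nu> c W g" "(t, snd c x) \<in> W"
proof -
  let ?f = "\<lambda>(t, u). local_param (X t) c u" and ?D = "I \<times> snd c ` fst c"
  have "smooth_on ?D ?f" using flow assms(2) unfolding expanding_flow_def by auto
  moreover have "(t, snd c x) \<in> ?D" using assms by auto
  ultimately obtain U g where U: "open U" "(t, snd c x) \<in> U" "\<forall>k. Ck_on k g U" "\<forall>y\<in>?D \<inter> U. g y = ?f y"
    unfolding smooth_on_def by meson
  let ?W = "U \<inter> {t. ereal t < T} \<times> snd c ` fst c"
  have "open ?W" using U(1) open_before closed_surface_chart(3)[OF M assms(2)] by (intro open_Int open_Times)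
  moreover have "smooth_in ?W g" using U(3) smooth_in_subset[of U g ?W] by (auto simp: smooth_in_def)
  moreover have "g (s, u) = local_param (X s) c u" if "(s, u) \<in> ?W" "0 \<le> s" for s u
    using U(4) that by (auto simp: mem_I)
  ultimately have "flow_patch \<kappa> F \<alpha> M A T X \<nu> c ?W g"
    using assms(2) by unfold_locales auto
  moreover have "(t, snd c x) \<in> ?W" using U(2) assms by (auto simp: mem_I)
  ultimately show thesis by (rule that)
qed

subsection \<open>Principal frames of the flow\<close>

text \<open>If the second derivative were positive, the first derivative would be positive just
  beyond z and f would increase there by the mean value theorem. The maximum is assumed along one
  line only, since the curvature ratio is compared in spatial directions and separately in
  time.\<close>

lemma second_derivative_test_max:
  fixes f :: "'a::euclidean_space \<Rightarrow> real"
  assumes U: "open U" "z \<in> U" and f: "smooth_in U f"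
    and max: "\<And>s. z + s *\<^sub>R v \<in> U \<Longrightarrow> f (z + s *\<^sub>R v) \<le> f z"
  shows "frechet_derivative f (at z) v = 0"
    "frechet_derivative (\<lambda>y. frechet_derivative f (at y) v) (at z) v \<le> 0"
proof -
  define q where "q s = f (z + s *\<^sub>R v)" for s
  define q' where "q' s = frechet_derivative f (at (z + s *\<^sub>R v)) v" for s
  let ?c = "frechet_derivative (\<lambda>y. frechet_derivative f (at y) v) (at z) v"
  have diff: "g differentiable_on U" if "smooth_in U g" for g :: "'a \<Rightarrow> real"
    using smooth_in_differentiable[OF U(1) that] by (simp add: differentiable_at_imp_differentiable_on)
  have dq: "(q has_real_derivative q' s) (at s)" if "z + s *\<^sub>R v \<in> U" for s
    unfolding q_def[abs_def] q'_def by (rule has_real_derivative_along_line[OF U(1) diff[OF f] that])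
  have "z + 0 *\<^sub>R v \<in> U" using U by simp
  from has_real_derivative_along_line[OF U(1) diff[OF smooth_in_frechet[OF f]] this]
  have dq': "(q' has_real_derivative ?c) (at 0)"
    unfolding q'_def[abs_def] by simp
  have "open ((\<lambda>s. z + s *\<^sub>R v) -` U)" by (intro open_vimage U continuous_intros)
  moreover have "0 \<in> (\<lambda>s. z + s *\<^sub>R v) -` U" using U(2) by simp
  ultimately obtain e where e: "e > 0" "ball 0 e \<subseteq> (\<lambda>s. z + s *\<^sub>R v) -` U"
    by (rule openE)
  have near: "z + s *\<^sub>R v \<in> U" if "\<bar>s\<bar> < e" for s
    using e that by (auto simp: subset_iff dist_real_def)
  have le: "q s \<le> q 0" if "\<bar>s\<bar> < e" for s
    using max[OF near[OF that]] by (simp add: q_def)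
  have zero: "q' 0 = 0"
    by (rule DERIV_local_max[OF dq e(1)]) (use U le in auto)
  then show "frechet_derivative f (at z) v = 0" by (simp add: q'_def)
  show "?c \<le> 0"
  proof (rule ccontr)
    assume "\<not> ?c \<le> 0"
    then obtain d where d: "d > 0" "\<And>h. h > 0 \<Longrightarrow> h < d \<Longrightarrow> q' 0 < q' (0 + h)"
      using DERIV_pos_inc_right[OF dq'] by auto
    define h where "h = min d e / 2"
    have h: "0 < h" "h < d" "h < e" using d e by (auto simp: h_def)
    obtain y where y: "0 < y" "y < h" "q h - q 0 = (h - 0) * q' y"
      using MVT2[of 0 h q q'] h dq near by auto
    have "q' y > 0" using d(2)[of y] y h zero by simp
    then have "h * q' y > 0" using h by simp
    then show False using y(3) h le[of h] by simp
  qed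
qed

text \<open>By Cayley-Hamilton \<open>(h - l g) adj(g) (h - \<rho> g) = 0\<close> for the two roots \<open>l\<close> and \<open>\<rho>\<close>, which gives
  eigenvectors depending smoothly on the coefficients.\<close>

lemma pencil_adjugate_eigenvector:
  fixes E F G L M N l \<rho> w1 w2 :: real
  assumes sum: "(E * G - F\<^sup>2) * (l + \<rho>) = E * N + G * L - 2 * F * M"
    and prod: "(E * G - F\<^sup>2) * (l * \<rho>) = L * N - M\<^sup>2"
    and k: "k1 = (L - \<rho> * E) * w1 + (M - \<rho> * F) * w2" "k2 = (M - \<rho> * F) * w1 + (N - \<rho> * G) * w2"
    and v: "v1 = G * k1 - F * k2" "v2 = E * k2 - F * k1"
  shows "L * v1 + M * v2 = l * (E * v1 + F * v2)" "M * v1 + N * v2 = l * (F * v1 + G * v2)"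
proof -
  have "L * v1 + M * v2 - l * (E * v1 + F * v2) =
      (E * N + G * L - 2 * F * M - (E * G - F\<^sup>2) * (l + \<rho>)) * (L * w1 + M * w2)
      - (L * N - M\<^sup>2 - (E * G - F\<^sup>2) * (l * \<rho>)) * (E * w1 + F * w2)"
    unfolding v k power2_eq_square by algebra
  then show "L * v1 + M * v2 = l * (E * v1 + F * v2)" unfolding sum prod by simp
  have "M * v1 + N * v2 - l * (F * v1 + G * v2) =
      (E * N + G * L - 2 * F * M - (E * G - F\<^sup>2) * (l + \<rho>)) * (M * w1 + N * w2)
      - (L * N - M\<^sup>2 - (E * G - F\<^sup>2) * (l * \<rho>)) * (F * w1 + G * w2)"
    unfolding v k power2_eq_square by algebra
  then show "M * v1 + N * v2 = l * (F * v1 + G * v2)" unfolding sum prod by simp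
qed

lemma pencil_form_pos:
  fixes E F G x y :: real
  assumes "E > 0" "E * G - F\<^sup>2 > 0" "(x, y) \<noteq> (0, 0)"
  shows "E * x\<^sup>2 + 2 * F * x * y + G * y\<^sup>2 > 0"
proof -
  have "E * (E * x\<^sup>2 + 2 * F * x * y + G * y\<^sup>2) = (E * x + F * y)\<^sup>2 + (E * G - F\<^sup>2) * y\<^sup>2"
    by (simp add: power2_eq_square algebra_simps)
  also have "\<dots> > 0"
  proof (cases "y = 0")
    case True
    then show ?thesis using assms by simp
  next
    case False
    then show ?thesis using assms(2) by (simp add: add_nonneg_pos)
  qed
  finally show ?thesis using assms(1) by (simp add: zero_less_mult_iff)
qed

section \<open>Consequences of homogeneity and monotonicity of the curvature function\<close>

lemma curvature_function_near:
  assumes "curvature_function F" "p \<in> Gamma_plus"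
  obtains V where "open V" "p \<in> V" "V \<subseteq> Gamma_plus" "smooth_in V F"
proof -
  have "Gamma_plus = {l. 0 < l $ 1} \<inter> {l. 0 < l $ 2}" by (auto simp: Gamma_plus_def)
  also have "open \<dots>" by (intro open_Int open_Collect_less continuous_intros)
  finally have "open Gamma_plus" .
  then show thesis
    using smooth_on_openD[of Gamma_plus F p] assms that unfolding curvature_function_def by metis
qed

lemma curvature_function_derivative:
  assumes "curvature_function F" "p \<in> Gamma_plus"
  shows "(F has_derivative frechet_derivative F (at p)) (at p)"
  using curvature_function_near[OF assms] smooth_in_has_derivative by metis

text \<open>Euler's identity, from differentiating F(k p) = k F(p) at k = 1.\<close>

lemma curvature_function_euler:
  assumes F: "curvature_function F" and p: "p \<in> Gamma_plus"
  shows "frechet_derivative F (at p) p = F p"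
proof -
  have "((\<lambda>k::real. k *\<^sub>R p) has_derivative (\<lambda>k. k *\<^sub>R p)) (at 1)"
    by (intro bounded_linear_imp_has_derivative bounded_linear_scaleR_left)
  from has_derivative_compose[OF this, of F] curvature_function_derivative[OF F p]
  have "((\<lambda>k. F (k *\<^sub>R p)) has_derivative (\<lambda>k. frechet_derivative F (at p) (k *\<^sub>R p))) (at 1)" by simp
  then have "((\<lambda>k. k * F p) has_derivative (\<lambda>k. frechet_derivative F (at p) (k *\<^sub>R p))) (at 1)"
    by (rule has_derivative_transform_within_open[of _ _ _ _ "{0<..}"])
      (use F p in \<open>auto simp: curvature_function_def\<close>)
  moreover have "((\<lambda>k. k * F p) has_derivative (\<lambda>k. k * F p)) (at 1)"
    by (intro bounded_linear_imp_has_derivative bounded_linear_mult_left)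
  ultimately have "(\<lambda>k. frechet_derivative F (at p) (k *\<^sub>R p)) = (\<lambda>k. k * F p)"
    by (rule has_derivative_unique)
  from fun_cong[OF this, of 1] show ?thesis by simp
qed

text \<open>The derivative of \<open>ln (F(1, r))\<close>. Homogeneity makes \<open>F (l, r l) = l F (1, r)\<close>, so the speed depends on
  \<open>l1\<close> and \<open>r = l2 / l1\<close> through this function of one variable only.\<close>

definition log_slope :: "(real^2 \<Rightarrow> real) \<Rightarrow> real \<Rightarrow> real" where
  "log_slope F r = frechet_derivative F (at (vector [1, r])) (axis 2 1) / F (vector [1, r])"

lemma vector_1_axis: "vector [1, r] = axis 1 1 + r *\<^sub>R (axis 2 1 :: real^2)"
  by (simp add: vec_eq_iff forall_2 axis_def)

text \<open>Euler's identity at (1, r) splits F into its first partial derivative plus r times the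
  second. Both partial derivatives are positive, so the second part is at most F.\<close>

lemma log_slope_bounds:
  assumes F: "curvature_function F" and r: "r > 0"
  shows "0 \<le> log_slope F r" "r * log_slope F r \<le> 1"
proof -
  let ?p = "vector [1, r] :: real^2"
  have p: "?p \<in> Gamma_plus" using r by (simp add: Gamma_plus_def)
  have pos: "F ?p > 0" "frechet_derivative F (at ?p) (axis i 1) > 0" for i
    using F p by (auto simp: curvature_function_def)
  then show "0 \<le> log_slope F r" by (simp add: log_slope_def less_imp_le)
  have lin: "linear (frechet_derivative F (at ?p))"
    using curvature_function_derivative[OF F p] has_derivative_linear by blast
  have "F ?p = frechet_derivative F (at ?p) (axis 1 1 + r *\<^sub>R axis 2 1)"
    using curvature_function_euler[OF F p] by (simp add: vector_1_axis)
  also have "\<dots> = frechet_derivative F (at ?p) (axis 1 1) + r * frechet_derivative F (at ?p) (axis 2 1)"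
    by (simp add: linear_add[OF lin] linear_scale[OF lin])
  finally show "r * log_slope F r \<le> 1" using pos(1) pos(2)[of 1] by (simp add: log_slope_def)
qed

lemma log_slope_differentiable:
  assumes F: "curvature_function F" and r: "r z > 0" "r differentiable (at z)"
  shows "(\<lambda>y. log_slope F (r y)) differentiable (at z)"
proof -
  let ?p = "\<lambda>y. axis 1 1 + r y *\<^sub>R (axis 2 1 :: real^2)"
  have p: "?p z \<in> Gamma_plus" using r(1) by (simp add: Gamma_plus_def vector_1_axis[symmetric])
  obtain V where V: "open V" "?p z \<in> V" "V \<subseteq> Gamma_plus" "smooth_in V F"
    using curvature_function_near[OF F p] .
  have p': "?p differentiable (at z)" using r(2) by simp
  have "(\<lambda>y. frechet_derivative F (at (?p y)) (axis 2 1)) differentiable (at z)"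
    by (rule differentiable_compose[where g="?p", OF smooth_in_differentiable[OF V(1) smooth_in_frechet[OF V(4)] V(2)] p'])
  moreover have "(\<lambda>y. F (?p y)) differentiable (at z)"
    by (rule differentiable_compose[where g="?p", OF smooth_in_differentiable[OF V(1,4,2)] p'])
  moreover have "F (?p z) \<noteq> 0" using F p by (auto simp: curvature_function_def)
  ultimately show ?thesis unfolding log_slope_def vector_1_axis by (rule differentiable_divide)
qed

text \<open>By homogeneity \<phi> is the power -\<alpha> of l F(1, r). The formula is its
  logarithmic derivative, multiplied by l \<phi> to clear denominators.\<close>

lemma speed_derivative:
  fixes l r \<phi> :: "'a::euclidean_space \<Rightarrow> real"
  assumes F: "curvature_function F" and U: "open U" "z \<in> U"
    and smooth: "smooth_in U l" "smooth_in U r" and pos: "\<And>y. y \<in> U \<Longrightarrow> l y > 0" "\<And>y. y \<in> U \<Longrightarrow> r y > 0"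
    and \<phi>: "\<And>y. y \<in> U \<Longrightarrow> \<phi> y = F (vector [l y, r y * l y]) powr (- \<alpha>)"
  shows "l z * dd E \<phi> z = - \<alpha> * (\<phi> z * dd E l z) - \<alpha> * (\<phi> z * l z * (log_slope F (r z) * dd E r z))"
proof -
  let ?p = "\<lambda>y. axis 1 1 + r y *\<^sub>R (axis 2 1 :: real^2)"
  have p: "?p y \<in> Gamma_plus" if "y \<in> U" for y
    using pos(2)[OF that] by (simp add: Gamma_plus_def vector_1_axis[symmetric])
  have Fp: "F (?p y) > 0" if "y \<in> U" for y using F p[OF that] by (auto simp: curvature_function_def)
  have \<phi>': "\<phi> y = (l y * F (?p y)) powr (- \<alpha>)" if "y \<in> U" for y
  proof -
    have "vector [l y, r y * l y] = l y *\<^sub>R ?p y"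
      by (simp add: vec_eq_iff forall_2 axis_def)
    then show ?thesis using \<phi>[OF that] F p[OF that] pos(1)[OF that] by (simp add: curvature_function_def)
  qed
  let ?l' = "frechet_derivative l (at z)" and ?r' = "frechet_derivative r (at z)"
    and ?F' = "frechet_derivative F (at (?p z))"
  have lin: "linear ?F'" using curvature_function_derivative[OF F p[OF U(2)]] has_derivative_linear by blast
  have "(?p has_derivative (\<lambda>h. 0 + ?r' h *\<^sub>R axis 2 1)) (at z)"
    by (intro has_derivative_add has_derivative_const has_derivative_scaleR_left smooth_in_has_derivative[OF U(1) smooth(2) U(2)])
  from has_derivative_compose[OF this curvature_function_derivative[OF F p[OF U(2)]]]
  have "((\<lambda>y. F (?p y)) has_derivative (\<lambda>h. ?r' h * ?F' (axis 2 1))) (at z)"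
    by (simp add: linear_scale[OF lin])
  from has_derivative_mult[OF smooth_in_has_derivative[OF U(1) smooth(1) U(2)] this]
  have d: "((\<lambda>y. l y * F (?p y)) has_derivative (\<lambda>h. l z * (?r' h * ?F' (axis 2 1)) + ?l' h * F (?p z))) (at z)" .
  have lF: "l z * F (?p z) > 0" using pos(1) Fp U(2) by simp
  have "((\<lambda>y. (l y * F (?p y)) powr (- \<alpha>)) has_derivative
      (\<lambda>h. (l z * (?r' h * ?F' (axis 2 1)) + ?l' h * F (?p z)) * (- \<alpha> * (l z * F (?p z)) powr (- \<alpha> - 1)))) (at z)"
    by (rule DERIV_compose_FDERIV[OF has_real_derivative_powr[OF lF] d])
  from dd_eqI[OF this, of E]
  have "dd E \<phi> z = (l z * (dd E r z * ?F' (axis 2 1)) + dd E l z * F (?p z)) * (- \<alpha> * (l z * F (?p z)) powr (- \<alpha> - 1))"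
    using dd_cong_open[OF U, of \<phi> "\<lambda>y. (l y * F (?p y)) powr (- \<alpha>)" E] \<phi>' by (simp add: dd_def)
  also have "(l z * F (?p z)) powr (- \<alpha> - 1) = \<phi> z / (l z * F (?p z))"
    using lF unfolding \<phi>'[OF U(2)] by (simp add: powr_diff)
  finally show ?thesis
    using pos(1)[OF U(2)] Fp[OF U(2)] unfolding log_slope_def vector_1_axis by (simp add: field_simps)
qed

section \<open>Smooth principal frames away from umbilic points\<close>

context flow_patch
begin

text \<open>Positive time is included so that the set is open and \<open>g\<close> agrees with the
  flow on all of it; identities that hold for the surfaces may then be differentiated in time as
  well.\<close>

definition "nonumbilic = {z \<in> W \<inter> {0<..} \<times> UNIV. disc z > 0}"

lemma open_positive_time: "open (W \<inter> {0<..} \<times> UNIV)"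
  by (intro open_Int W open_Times open_greaterThan open_UNIV)

lemma smooth_positive_time:
  "smooth_in (W \<inter> {0<..} \<times> UNIV) \<phi>" "smooth_in (W \<inter> {0<..} \<times> UNIV) n"
  "smooth_in (W \<inter> {0<..} \<times> UNIV) cE" "smooth_in (W \<inter> {0<..} \<times> UNIV) cF" "smooth_in (W \<inter> {0<..} \<times> UNIV) cG"
  "smooth_in (W \<inter> {0<..} \<times> UNIV) cL" "smooth_in (W \<inter> {0<..} \<times> UNIV) cM" "smooth_in (W \<inter> {0<..} \<times> UNIV) cN"
  "smooth_in (W \<inter> {0<..} \<times> UNIV) disc"
  by (rule smooth_coefficients[OF open_positive_time]; use \<phi>_n(1) in force)+

lemma open_nonumbilic: "open nonumbilic"
  unfolding nonumbilic_def
  by (rule open_positive[OF open_positive_time smooth_in_continuous_on[OF smooth_positive_time(9)]])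

lemma nonumbilic_sub: "nonumbilic \<subseteq> W \<inter> {0<..} \<times> UNIV"
  by (auto simp: nonumbilic_def)

lemmas smooth_nonumbilic = smooth_positive_time[THEN smooth_in_subset[OF _ nonumbilic_sub]]

lemma nonumbilic_pos:
  assumes "z \<in> nonumbilic"
  shows "cE z > 0" "cE z * cG z - (cF z)\<^sup>2 > 0" "\<phi> z > 0" "lam (-1) z > 0" "lam (-1) z < lam 1 z"
proof -
  obtain s u where z: "z = (s, u)" by (cases z)
  then have W: "(s, u) \<in> W" "0 \<le> s" and d: "disc (s, u) > 0"
    using assms by (auto simp: nonumbilic_def)
  show pos: "cE z > 0" "cE z * cG z - (cF z)\<^sup>2 > 0" using coefficients_pos(1,2)[OF W] by (simp_all add: z)
  show "\<phi> z > 0" using \<phi>_n(1)[OF W] by (simp add: z \<phi>_def)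
  show "lam (-1) z > 0"
    using coefficients_pos(3)[OF W] lambda_props(1)[OF patch_point(1,4)[OF W]] by (simp add: z)
  show "lam (-1) z < lam 1 z"
    using pencil_root_less(2)[OF pos, of "cL z" "cM z" "cN z"] d by (simp add: z lam_def disc_def)
qed

lemma smooth_lam: "smooth_in nonumbilic (lam \<sigma>)"
  unfolding lam_def[abs_def] pencil_root_def disc_def[symmetric] power2_eq_square
  by (intro smooth_intros open_nonumbilic smooth_nonumbilic)
    (use nonumbilic_pos(2) in \<open>force simp: nonumbilic_def power2_eq_square\<close>)+

lemma principal_field_exists:
  fixes \<sigma> \<sigma>' :: real
  assumes z0: "z0 \<in> nonumbilic" and \<sigma>: "(\<sigma>, \<sigma>') \<in> {(1, -1), (-1, 1)}"
  obtains U x y where "open U" "z0 \<in> U" "U \<subseteq> nonumbilic" "smooth_in U x" "smooth_in U y"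
    "\<And>z. z \<in> U \<Longrightarrow> cE z * (x z)\<^sup>2 + 2 * cF z * x z * y z + cG z * (y z)\<^sup>2 = 1"
    "\<And>z. z \<in> U \<Longrightarrow> cL z * x z + cM z * y z = lam \<sigma> z * (cE z * x z + cF z * y z)"
    "\<And>z. z \<in> U \<Longrightarrow> cM z * x z + cN z * y z = lam \<sigma> z * (cF z * x z + cG z * y z)"
proof -
  define k1 where "k1 w z = (cL z - lam \<sigma>' z * cE z) * fst w + (cM z - lam \<sigma>' z * cF z) * snd w" for w :: "real \<times> real" and z
  define k2 where "k2 w z = (cM z - lam \<sigma>' z * cF z) * fst w + (cN z - lam \<sigma>' z * cG z) * snd w" for w :: "real \<times> real" and z
  \<comment> \<open>The pair \<open>k1\<close>, \<open>k2\<close> is (h - \<rho> g) w for the other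
    root \<rho>. If it vanished for every w, h would be a multiple of g and the discriminant would
    be zero.\<close>
  have "\<exists>w. (k1 w z0, k2 w z0) \<noteq> (0, 0)"
  proof (rule ccontr)
    assume "\<not> (\<exists>w. (k1 w z0, k2 w z0) \<noteq> (0, 0))"
    then have "k1 (1, 0) z0 = 0" "k1 (0, 1) z0 = 0" "k2 (0, 1) z0 = 0" by blast+
    then have h: "cL z0 = lam \<sigma>' z0 * cE z0" "cM z0 = lam \<sigma>' z0 * cF z0" "cN z0 = lam \<sigma>' z0 * cG z0"
      by (simp_all add: k1_def k2_def)
    have "disc z0 = 0" unfolding disc_def pencil_disc_def h power2_eq_square by algebra
    then show False using z0 by (simp add: nonumbilic_def)
  qed
  then obtain w where w: "(k1 w z0, k2 w z0) \<noteq> (0, 0)" by blast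
  define vx where "vx z = cG z * k1 w z - cF z * k2 w z" for z
  define vy where "vy z = cE z * k2 w z - cF z * k1 w z" for z
  define q where "q z = cE z * (vx z)\<^sup>2 + 2 * cF z * vx z * vy z + cG z * (vy z)\<^sup>2" for z
  \<comment> \<open>The vector \<open>w\<close> is kept constant, so the eigenvector built from it
    may degenerate away from \<open>z0\<close>; \<open>U\<close> is the open set where its squared
    length \<open>q\<close> stays positive.\<close>
  define U where "U = {z \<in> nonumbilic. q z > 0}"
  note s [smooth_intros] = open_nonumbilic smooth_nonumbilic smooth_lam
  have sv: "smooth_in nonumbilic vx" "smooth_in nonumbilic vy"
    unfolding vx_def[abs_def] vy_def[abs_def] k1_def k2_def by (intro smooth_intros)+
  have sq: "smooth_in nonumbilic q"
    unfolding q_def[abs_def] power2_eq_square by (intro smooth_intros sv)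
  have U: "open U" "U \<subseteq> nonumbilic"
    unfolding U_def using open_positive[OF open_nonumbilic smooth_in_continuous_on[OF sq]] by auto
  have "(vx z0, vy z0) \<noteq> (0, 0)"
  proof
    assume v: "(vx z0, vy z0) = (0, 0)"
    have "cE z0 * vx z0 + cF z0 * vy z0 = (cE z0 * cG z0 - (cF z0)\<^sup>2) * k1 w z0"
      "cF z0 * vx z0 + cG z0 * vy z0 = (cE z0 * cG z0 - (cF z0)\<^sup>2) * k2 w z0"
      by (simp_all add: vx_def vy_def power2_eq_square algebra_simps)
    then show False using v w nonumbilic_pos(2)[OF z0] by simp
  qed
  then have "q z0 > 0" unfolding q_def by (rule pencil_form_pos[OF nonumbilic_pos(1,2)[OF z0]])
  then have z0U: "z0 \<in> U" using z0 by (simp add: U_def)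
  define x where "x z = vx z / sqrt (q z)" for z
  define y where "y z = vy z / sqrt (q z)" for z
  have sU: "smooth_in U vx" "smooth_in U vy" "smooth_in U q"
    using sv sq smooth_in_subset U(2) by blast+
  have pos: "q z > 0" "sqrt (q z) \<noteq> 0" if "z \<in> U" for z using that by (auto simp: U_def)
  have sxy: "smooth_in U x" "smooth_in U y"
    unfolding x_def[abs_def] y_def[abs_def] using pos by (intro smooth_intros U sU; blast)+
  have unit: "cE z * (x z)\<^sup>2 + 2 * cF z * x z * y z + cG z * (y z)\<^sup>2 = 1" if z: "z \<in> U" for z
  proof -
    define S where "S = sqrt (q z)"
    have S: "S * S = q z" using pos(1)[OF z] by (simp add: S_def)
    have "cE z * (x z)\<^sup>2 + 2 * cF z * x z * y z + cG z * (y z)\<^sup>2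
        = (cE z * (vx z)\<^sup>2 + 2 * cF z * vx z * vy z + cG z * (vy z)\<^sup>2) / (S * S)"
      by (simp add: x_def y_def S_def[symmetric] power2_eq_square add_divide_distrib)
    also have "\<dots> = 1" unfolding S q_def[symmetric] using pos(1)[OF z] by simp
    finally show ?thesis .
  qed
  have eig: "cL z * x z + cM z * y z = lam \<sigma> z * (cE z * x z + cF z * y z)"
    "cM z * x z + cN z * y z = lam \<sigma> z * (cF z * x z + cG z * y z)" if z: "z \<in> U" for z
  proof -
    have "z \<in> nonumbilic" using z U(2) by blast
    note sp = pencil_roots_sum_prod[OF nonumbilic_pos(1,2)[OF this], of "cL z" "cM z" "cN z", folded lam_def]
    have "(cE z * cG z - (cF z)\<^sup>2) * (lam \<sigma> z + lam \<sigma>' z) = cE z * cN z + cG z * cL z - 2 * cF z * cM z"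
      "(cE z * cG z - (cF z)\<^sup>2) * (lam \<sigma> z * lam \<sigma>' z) = cL z * cN z - (cM z)\<^sup>2"
      using sp \<sigma> by (auto simp: algebra_simps)
    note e = pencil_adjugate_eigenvector[OF this k1_def k2_def vx_def vy_def]
    have "(cL z * vx z + cM z * vy z) / sqrt (q z) = (lam \<sigma> z * (cE z * vx z + cF z * vy z)) / sqrt (q z)"
      "(cM z * vx z + cN z * vy z) / sqrt (q z) = (lam \<sigma> z * (cF z * vx z + cG z * vy z)) / sqrt (q z)"
      unfolding e by simp_all
    then show "cL z * x z + cM z * y z = lam \<sigma> z * (cE z * x z + cF z * y z)"
      "cM z * x z + cN z * y z = lam \<sigma> z * (cF z * x z + cG z * y z)"
      by (simp_all add: x_def y_def add_divide_distrib distrib_left)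
  qed
  show thesis by (rule that[OF U(1) z0U U(2) sxy unit eig])
qed

abbreviation "field x y \<equiv> (\<lambda>z. x z *\<^sub>R (0, axis 1 1) + y z *\<^sub>R (0, axis 2 1) :: real \<times> (real^2))"

lemma smooth_field: "open U \<Longrightarrow> smooth_in U x \<Longrightarrow> smooth_in U y \<Longrightarrow> smooth_in U (field x y)"
  by (intro smooth_intros)

lemma dd_field:
  assumes "open U" "smooth_in U x" "smooth_in U y" "z \<in> U"
  shows "dd E (field x y) z = dd E x z *\<^sub>R (0, axis 1 1) + dd E y z *\<^sub>R (0, axis 2 1)"
proof -
  have "smooth_in U (\<lambda>z. x z *\<^sub>R (0, axis 1 1) :: real \<times> (real^2))" "smooth_in U (\<lambda>z. y z *\<^sub>R (0, axis 2 1) :: real \<times> (real^2))"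
    by (intro smooth_intros assms)+
  from dd_add[OF assms(1) this assms(4)] show ?thesis
    unfolding dd_scaleR[OF assms(1,2) smooth_in_const[OF assms(1)] assms(4)]
      dd_scaleR[OF assms(1,3) smooth_in_const[OF assms(1)] assms(4)] dd_const by simp
qed

lemma dd_field_eq:
  assumes "U \<subseteq> W" "open U" "smooth_in U f" "z \<in> U"
  shows "dd (field x y) f z = x z *\<^sub>R dd (\<lambda>_. (0, axis 1 1)) f z + y z *\<^sub>R dd (\<lambda>_. (0, axis 2 1)) f z"
proof -
  have "linear (frechet_derivative f (at z))"
    using smooth_in_has_derivative[OF assms(2-4)] has_derivative_linear by blast
  then show ?thesis by (simp only: dd_def linear_add linear_scale)
qed

lemma principal_direction:
  assumes z: "z \<in> nonumbilic"
    and eig: "cL z * x z + cM z * y z = lam \<sigma> z * (cE z * x z + cF z * y z)"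
      "cM z * x z + cN z * y z = lam \<sigma> z * (cF z * x z + cG z * y z)"
  shows "dd (field x y) n z = lam \<sigma> z *\<^sub>R dd (field x y) g z"
proof -
  obtain s u where su: "z = (s, u)" by (cases z)
  then have W': "(s, u) \<in> W" "0 \<le> s" "0 < s" "z \<in> W \<inter> {0<..} \<times> UNIV"
    using z by (auto simp: nonumbilic_def)
  note p = patch_point[OF W'(1,2)]
  interpret sp: surface_point \<kappa> M A "X s" "\<nu> s" c "pt u" by (rule surface_point_at[OF p(1) c p(2)])
  let ?v = "x z *\<^sub>R axis 1 1 + y z *\<^sub>R axis 2 1 :: real^2"
  have v: "?v $ 1 = x z" "?v $ 2 = y z" by (simp_all add: axis_def)
  have "local_param (\<nu> s) c u' = n (s, u')" if "(s, u') \<in> W \<inter> {0<..} \<times> UNIV" for u'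
    using \<phi>_n(3)[of s u'] that by (simp add: local_param_def)
  from slice_derivative[OF open_positive_time smooth_positive_time(2), of s u "local_param (\<nu> s) c", OF _ this]
  have d: "(local_param (\<nu> s) c has_derivative (\<lambda>v. frechet_derivative n (at (s, u)) (0, v))) (at u)"
    using W' by simp
  then have diff: "local_param (\<nu> s) c differentiable (at (snd c (pt u)))"
    unfolding p(3) differentiable_def by blast
  have "sp.eigenpair (lam \<sigma> z) ?v"
    unfolding sp.eigenpair_def v p(3) partial_partial_param[OF W'(1,2)] partial_param[OF W'(1,2)]
    using eig unfolding su cE_def cF_def cG_def cL_def cM_def cN_def \<phi>_n(3)[OF W'(1,2)] by blast
  from sp.eigenpair_Dn[OF diff this]
  have "frechet_derivative n (at (s, u)) (0, ?v) = lam \<sigma> z *\<^sub>R frechet_derivative g (at (s, u)) (0, ?v)"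
    unfolding p(3) frechet_derivative_at[OF d, symmetric] param_derivative[OF W'(1,2)] .
  then show ?thesis by (simp add: dd_def su)
qed

lemma point_geometry:
  assumes "(s, u) \<in> W" "0 \<le> s"
  shows "g (s, u) \<in> space_form \<kappa>" "sf_radial \<kappa> (g (s, u)) (n (s, u)) = 0" "sf_inner \<kappa> (n (s, u)) (n (s, u)) = 1"
    "sf_inner \<kappa> (gx i (s, u)) (n (s, u)) = 0" "gt (s, u) = \<phi> (s, u) *\<^sub>R n (s, u)"
proof -
  note p = patch_point[OF assms]
  interpret sp: surface_point \<kappa> M A "X s" "\<nu> s" c "pt u" by (rule surface_point_at[OF p(1) c p(2)])
  have g': "g (s, u) = X s (pt u)" using g(2)[OF assms] by (simp add: local_param_def)
  show "g (s, u) \<in> space_form \<kappa>" "sf_radial \<kappa> (g (s, u)) (n (s, u)) = 0" "sf_inner \<kappa> (n (s, u)) (n (s, u)) = 1"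
    "sf_inner \<kappa> (gx i (s, u)) (n (s, u)) = 0"
    using sp.point_space_form sp.normal_at_point
    unfolding g' \<phi>_n(3)[OF assms] partial_param[OF assms, symmetric] p(3) by blast+
  show "gt (s, u) = \<phi> (s, u) *\<^sub>R n (s, u)"
    unfolding time_derivative[OF assms] \<phi>_n(2,3)[OF assms] ..
qed

text \<open>Both frame fields are spatial, hence so are all brackets, and two independent spatial
  fields span them. The facts about first components are exported for the second derivative test,
  which is applied in spatial directions.\<close>

lemma moving_frame_exists:
  assumes z0: "z0 \<in> nonumbilic"
  obtains U E1 E2 where "open U" "z0 \<in> U" "U \<subseteq> nonumbilic"
    "moving_frame \<kappa> U g n (\<lambda>_. (1, 0)) E1 E2 \<phi> (lam (-1)) (lam 1)"
    "\<And>z. fst (E1 z) = 0" "\<And>z. fst (E2 z) = 0"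
    "\<And>E z. z \<in> U \<Longrightarrow> fst (dd E E1 z) = 0" "\<And>E z. z \<in> U \<Longrightarrow> fst (dd E E2 z) = 0"
proof -
  obtain U1 x1 y1 where U1: "open U1" "z0 \<in> U1" "U1 \<subseteq> nonumbilic" "smooth_in U1 x1" "smooth_in U1 y1"
    and u1: "\<And>z. z \<in> U1 \<Longrightarrow> cE z * (x1 z)\<^sup>2 + 2 * cF z * x1 z * y1 z + cG z * (y1 z)\<^sup>2 = 1"
    and eig1: "\<And>z. z \<in> U1 \<Longrightarrow> cL z * x1 z + cM z * y1 z = lam (-1) z * (cE z * x1 z + cF z * y1 z)"
      "\<And>z. z \<in> U1 \<Longrightarrow> cM z * x1 z + cN z * y1 z = lam (-1) z * (cF z * x1 z + cG z * y1 z)"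
    using principal_field_exists[OF z0, of "-1" 1] by auto
  obtain U2 x2 y2 where U2: "open U2" "z0 \<in> U2" "U2 \<subseteq> nonumbilic" "smooth_in U2 x2" "smooth_in U2 y2"
    and u2: "\<And>z. z \<in> U2 \<Longrightarrow> cE z * (x2 z)\<^sup>2 + 2 * cF z * x2 z * y2 z + cG z * (y2 z)\<^sup>2 = 1"
    and eig2: "\<And>z. z \<in> U2 \<Longrightarrow> cL z * x2 z + cM z * y2 z = lam 1 z * (cE z * x2 z + cF z * y2 z)"
      "\<And>z. z \<in> U2 \<Longrightarrow> cM z * x2 z + cN z * y2 z = lam 1 z * (cF z * x2 z + cG z * y2 z)"
    using principal_field_exists[OF z0, of 1 "-1"] by auto
  define U where "U = U1 \<inter> U2"
  have U: "open U" "z0 \<in> U" "U \<subseteq> nonumbilic" "U \<subseteq> W" and U12: "U \<subseteq> U1" "U \<subseteq> U2"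
    using U1 U2 nonumbilic_sub by (auto simp: U_def)
  have sx: "smooth_in U x1" "smooth_in U y1" "smooth_in U x2" "smooth_in U y2"
    using U1(4,5) U2(4,5) U12 smooth_in_subset by blast+
  let ?E1 = "field x1 y1" and ?E2 = "field x2 y2"
  \<comment> \<open>Self-adjointness: evaluating h on the two fields in both ways gives both roots
    times the same inner product, and the roots differ.\<close>
  have orth: "cE z * (x1 z * x2 z) + cF z * (x1 z * y2 z + y1 z * x2 z) + cG z * (y1 z * y2 z) = 0" if z: "z \<in> U" for z
  proof -
    have m: "z \<in> U1" "z \<in> U2" using z U12 by auto
    let ?q = "cE z * (x1 z * x2 z) + cF z * (x1 z * y2 z + y1 z * x2 z) + cG z * (y1 z * y2 z)"
    have "lam (-1) z * ?q = x2 z * (lam (-1) z * (cE z * x1 z + cF z * y1 z)) + y2 z * (lam (-1) z * (cF z * x1 z + cG z * y1 z))"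
      by (simp add: algebra_simps)
    also have "\<dots> = x2 z * (cL z * x1 z + cM z * y1 z) + y2 z * (cM z * x1 z + cN z * y1 z)"
      by (simp only: eig1[OF m(1)])
    also have "\<dots> = x1 z * (cL z * x2 z + cM z * y2 z) + y1 z * (cM z * x2 z + cN z * y2 z)"
      by (simp add: algebra_simps)
    also have "\<dots> = x1 z * (lam 1 z * (cE z * x2 z + cF z * y2 z)) + y1 z * (lam 1 z * (cF z * x2 z + cG z * y2 z))"
      by (simp only: eig2[OF m(2)])
    also have "\<dots> = lam 1 z * ?q" by (simp add: algebra_simps)
    finally show ?thesis using nonumbilic_pos(5) z U(3) by fastforce
  qed
  have span: "a *\<^sub>R (0, axis 1 1) + b *\<^sub>R (0, axis 2 1) \<in> span {?E1 z, ?E2 z}" if z: "z \<in> U" for a b z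
  proof -
    have m: "z \<in> U1" "z \<in> U2" using z U12 by auto
    \<comment> \<open>The determinant of the frame in coordinates. Its square times det g is the
      Gram determinant of an orthonormal pair, hence 1, and Cramer's rule applies.\<close>
    let ?D = "x1 z * y2 z - x2 z * y1 z"
    have "(cE z * cG z - (cF z)\<^sup>2) * ?D\<^sup>2 =
      (cE z * (x1 z)\<^sup>2 + 2 * cF z * x1 z * y1 z + cG z * (y1 z)\<^sup>2) * (cE z * (x2 z)\<^sup>2 + 2 * cF z * x2 z * y2 z + cG z * (y2 z)\<^sup>2)
      - (cE z * (x1 z * x2 z) + cF z * (x1 z * y2 z + y1 z * x2 z) + cG z * (y1 z * y2 z))\<^sup>2"
      unfolding power2_eq_square by algebra
    also have "\<dots> = 1" unfolding orth[OF z] u1[OF m(1)] u2[OF m(2)] by simp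
    finally have D: "?D \<noteq> 0" by auto
    have "a *\<^sub>R (0, axis 1 1) + b *\<^sub>R (0, axis 2 1) =
       ((a * y2 z - b * x2 z) / ?D) *\<^sub>R ?E1 z + ((b * x1 z - a * y1 z) / ?D) *\<^sub>R ?E2 z"
    proof -
      have "((a * y2 z - b * x2 z) / ?D) * x1 z + ((b * x1 z - a * y1 z) / ?D) * x2 z = a * ?D / ?D"
        "((a * y2 z - b * x2 z) / ?D) * y1 z + ((b * x1 z - a * y1 z) / ?D) * y2 z = b * ?D / ?D"
        unfolding times_divide_eq_left add_divide_distrib[symmetric] by (simp_all add: algebra_simps)
      then have "a = ((a * y2 z - b * x2 z) / ?D) * x1 z + ((b * x1 z - a * y1 z) / ?D) * x2 z"
        "b = ((a * y2 z - b * x2 z) / ?D) * y1 z + ((b * x1 z - a * y1 z) / ?D) * y2 z" using D by simp_all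
      then show ?thesis
        by (simp add: vec_eq_iff forall_2 axis_def)
    qed
    moreover have "\<dots> \<in> span {?E1 z, ?E2 z}"
      by (intro span_add span_scale span_base) (rule insertI1, rule insertI2, rule insertI1)
    ultimately show ?thesis by (rule ssubst)
  qed
  have lin_E: "dd ?E1 g z = x1 z *\<^sub>R gx 1 z + y1 z *\<^sub>R gx 2 z" "dd ?E2 g z = x2 z *\<^sub>R gx 1 z + y2 z *\<^sub>R gx 2 z"
    if "z \<in> U" for z
    using dd_field_eq[OF U(4,1) smooth_in_subset[OF g(1) U(4)] that] by (simp_all add: gx_def)
  note coeff = cE_def[symmetric] cF_def[symmetric] cG_def[symmetric]
  have pt: "\<exists>s u. z = (s, u) \<and> (s, u) \<in> W \<and> 0 \<le> s" if "z \<in> U" for z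
    using that U(3) nonumbilic_sub by (cases z) force
  have inner: "sf_inner \<kappa> (a *\<^sub>R gx 1 z + b *\<^sub>R gx 2 z) (a' *\<^sub>R gx 1 z + b' *\<^sub>R gx 2 z) =
      cE z * (a * a') + cF z * (a * b' + b * a') + cG z * (b * b')" for a b a' b' z
    by (simp add: sf_inner_simps sf_inner_commute[of \<kappa> "gx 2 z" "gx 1 z"] coeff algebra_simps)
  have normal: "sf_inner \<kappa> (a *\<^sub>R gx 1 z + b *\<^sub>R gx 2 z) (n z) = 0" if "z \<in> U" for a b z
    using pt[OF that] point_geometry(4) by (auto simp: sf_inner_simps)
  have mf: "moving_frame \<kappa> U g n (\<lambda>_. (1, 0)) ?E1 ?E2 \<phi> (lam (-1)) (lam 1)"
  proof
    show "smooth_in U g" "smooth_in U n" "smooth_in U \<phi>" "smooth_in U (lam (-1))" "smooth_in U (lam 1)"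
      using smooth_in_subset[OF g(1) U(4)] smooth_in_subset[OF smooth_nonumbilic(2) U(3)]
        smooth_in_subset[OF smooth_nonumbilic(1) U(3)] smooth_in_subset[OF smooth_lam U(3)] by blast+
    show "smooth_in U (\<lambda>_. (1, 0))" by (intro smooth_intros U)
    show "smooth_in U ?E1" "smooth_in U ?E2" using smooth_field U(1) sx by blast+
    fix z assume z: "z \<in> U"
    show "g z \<in> space_form \<kappa>" "sf_radial \<kappa> (g z) (n z) = 0" "sf_inner \<kappa> (n z) (n z) = 1"
      "dd (\<lambda>_. (1, 0)) g z = \<phi> z *\<^sub>R n z"
      using pt[OF z] point_geometry by (auto simp: gt_def[symmetric])
    show "sf_inner \<kappa> (dd ?E1 g z) (dd ?E1 g z) = 1" "sf_inner \<kappa> (dd ?E2 g z) (dd ?E2 g z) = 1"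
      using u1[of z] u2[of z] z U12 unfolding lin_E[OF z] inner by (auto simp: power2_eq_square algebra_simps)
    show "sf_inner \<kappa> (dd ?E1 g z) (dd ?E2 g z) = 0" unfolding lin_E[OF z] inner by (rule orth[OF z])
    show "sf_inner \<kappa> (dd ?E1 g z) (n z) = 0" "sf_inner \<kappa> (dd ?E2 g z) (n z) = 0"
      unfolding lin_E[OF z] by (rule normal[OF z])+
    have "z \<in> nonumbilic" "z \<in> U1" "z \<in> U2" using z U(3) U12 by blast+
    then show "dd ?E1 n z = lam (-1) z *\<^sub>R dd ?E1 g z" "dd ?E2 n z = lam 1 z *\<^sub>R dd ?E2 g z"
      using principal_direction eig1 eig2 by blast+
    have s: "v - w \<in> span {?E1 z, ?E2 z}" if "v \<in> span {?E1 z, ?E2 z}" "w \<in> span {?E1 z, ?E2 z}" for v w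
      using that by (rule span_diff)
    show "dd ?E1 ?E2 z - dd ?E2 ?E1 z \<in> span {?E1 z, ?E2 z}"
      "dd (\<lambda>_. (1, 0)) ?E1 z - dd ?E1 (\<lambda>_. (1, 0)) z \<in> span {?E1 z, ?E2 z}"
      "dd (\<lambda>_. (1, 0)) ?E2 z - dd ?E2 (\<lambda>_. (1, 0)) z \<in> span {?E1 z, ?E2 z}"
      unfolding dd_field[OF U(1) sx(1,2) z] dd_field[OF U(1) sx(3,4) z] dd_const
      by (rule s; (rule span[OF z] | rule span_zero))+
  qed (use \<kappa> U in auto)
  have fst: "fst (dd E ?E1 z) = 0" "fst (dd E ?E2 z) = 0" if "z \<in> U" for E z
    unfolding dd_field[OF U(1) sx(1,2) that] dd_field[OF U(1) sx(3,4) that] by simp_all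
  show thesis by (rule that[OF U(1-3) mf _ _ fst]) simp_all
qed

text \<open>The spatial maximum makes the time derivative of the ratio negative, so the ratio was
  larger shortly before \<open>t0\<close>. Only earlier times are compared because \<open>t0\<close>
  may be the right end of the interval over which the maximum is taken.\<close>

lemma ratio_no_interior_max:
  assumes z0: "(t0, u0) \<in> W" "t0 > 0" and gap: "lam (-1) (t0, u0) < lam 1 (t0, u0)"
    and space_max: "\<And>u. (t0, u) \<in> W \<Longrightarrow> lam 1 (t0, u) / lam (-1) (t0, u) \<le> lam 1 (t0, u0) / lam (-1) (t0, u0)"
    and time_max: "\<And>s. (s, u0) \<in> W \<Longrightarrow> 0 \<le> s \<Longrightarrow> s \<le> t0 \<Longrightarrow>
      lam 1 (s, u0) / lam (-1) (s, u0) \<le> lam 1 (t0, u0) / lam (-1) (t0, u0)"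
  shows False
proof -
  let ?z = "(t0, u0)"
  have "disc ?z > 0"
    using gap pencil_root_less(2)[OF coefficients_pos(1,2)] z0 by (simp add: lam_def disc_def)
  then have zn: "?z \<in> nonumbilic" using z0 by (simp add: nonumbilic_def)
  obtain U E1 E2 where U: "open U" "?z \<in> U" "U \<subseteq> nonumbilic"
    and mf: "moving_frame \<kappa> U g n (\<lambda>_. (1, 0)) E1 E2 \<phi> (lam (-1)) (lam 1)"
    and fstE: "\<And>z. fst (E1 z) = 0" "\<And>z. fst (E2 z) = 0"
      "\<And>E z. z \<in> U \<Longrightarrow> fst (dd E E1 z) = 0" "\<And>E z. z \<in> U \<Longrightarrow> fst (dd E E2 z) = 0"
    using moving_frame_exists[OF zn] by metis
  interpret mf: moving_frame \<kappa> U g n "\<lambda>_. (1, 0)" E1 E2 \<phi> "lam (-1)" "lam 1" by (rule mf)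
  define r where "r z = lam 1 z / lam (-1) z" for z
  have pos: "lam (-1) z > 0" "r z > 1" "\<phi> z > 0" if "z \<in> U" for z
    using nonumbilic_pos(3-5)[of z] that U(3) by (auto simp: r_def)
  have r: "smooth_in U r" unfolding r_def[abs_def]
    by (intro smooth_intros U mf.smooth) (use pos(1) in force)
  have spatial: "frechet_derivative r (at ?z) (0, v) = 0"
    "frechet_derivative (\<lambda>y. frechet_derivative r (at y) (0, v)) (at ?z) (0, v) \<le> 0" for v
  proof -
    have "r (?z + s *\<^sub>R (0, v)) \<le> r ?z" if "?z + s *\<^sub>R (0, v) \<in> U" for s
      using space_max[of "u0 + s *\<^sub>R v"] that U(3) nonumbilic_sub by (auto simp: r_def)
    from second_derivative_test_max[OF U(1,2) r this]
    show "frechet_derivative r (at ?z) (0, v) = 0"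
      "frechet_derivative (\<lambda>y. frechet_derivative r (at y) (0, v)) (at ?z) (0, v) \<le> 0" by blast+
  qed
  have crit: "dd E r ?z = 0" if "\<And>z. fst (E z) = 0" for E
  proof -
    have "E ?z = (0, snd (E ?z))" using that by (simp add: prod_eq_iff)
    then show ?thesis unfolding dd_def by (metis spatial(1))
  qed
  \<comment> \<open>Along a field that varies with the point, the extra term is the derivative of r
    in direction \<open>dd E E\<close>; that direction is spatial, so the term vanishes and the
    Hessian remains.\<close>
  have crit2: "dd E (dd E r) ?z \<le> 0"
    if "smooth_in U E" "fst (E ?z) = 0" "fst (dd E E ?z) = 0" for E
  proof -
    have "E ?z = (0, snd (E ?z))" "dd E E ?z = (0, snd (dd E E ?z))" using that(2,3) by (simp_all add: prod_eq_iff)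
    then show ?thesis
      unfolding dd_dd_expand[OF U(1) r that(1) U(2)] by (metis add.right_neutral spatial)
  qed
  have \<alpha>01: "0 < \<alpha>" "\<alpha> \<le> 1" "(1 - \<alpha>) * \<kappa> \<le> 0"
    using \<kappa> \<alpha> by (auto simp: admissible_exponent_def)
  have l2: "lam 1 z = r z * lam (-1) z" if "z \<in> U" for z
    using pos(1)[OF that] by (simp add: r_def)
  have \<phi>F: "\<phi> z = F (vector [lam (-1) z, r z * lam (-1) z]) powr (- \<alpha>)" if z: "z \<in> U" for z
  proof -
    obtain s u where su: "z = (s, u)" by (cases z)
    then have "(s, u) \<in> W" "0 \<le> s" using z U(3) nonumbilic_sub by force+
    from \<phi>_n(2)[OF this] coefficients_pos(3,4)[OF this] show ?thesis
      using l2[OF z] by (simp add: su speed_def)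
  qed
  have "dd (\<lambda>_. (1, 0)) r ?z < 0"
  proof (rule mf.ratio_decreasing_at_critical_point[where G="\<lambda>z. log_slope F (r z)" and \<alpha>=\<alpha> and r=r])
    show "(\<lambda>z. log_slope F (r z)) differentiable (at ?z)"
      using pos(2)[OF U(2)] by (intro log_slope_differentiable[OF F] smooth_in_differentiable[OF U(1) r U(2)]) simp
    show "0 \<le> log_slope F (r ?z)" "r ?z * log_slope F (r ?z) \<le> 1"
      using log_slope_bounds[OF F, of "r ?z"] pos(2)[OF U(2)] by simp_all
    show "lam (-1) y * dd E \<phi> y = - \<alpha> * (\<phi> y * dd E (lam (-1)) y)
        - \<alpha> * (\<phi> y * lam (-1) y * (log_slope F (r y) * dd E r y))" if y: "y \<in> U" for y E
    proof (rule speed_derivative[OF F U(1) y mf.smooth(7) r pos(1) _ \<phi>F])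
      show "0 < r z" if "z \<in> U" for z using pos(2)[OF that] by simp
    qed
  qed (use U \<alpha>01 pos r l2 crit fstE crit2 mf.smooth in auto)
  moreover have "((\<lambda>s. r (?z + s *\<^sub>R (1, 0))) has_real_derivative dd (\<lambda>_. (1, 0)) r ?z) (at 0)"
  proof -
    have "r differentiable_on U"
      using smooth_in_differentiable[OF U(1) r] by (simp add: differentiable_at_imp_differentiable_on)
    from has_real_derivative_along_line[OF U(1) this, of ?z 0 "(1, 0)"] U(2) show ?thesis
      by (simp add: dd_def zero_prod_def[symmetric])
  qed
  ultimately obtain d where d: "d > 0" "\<And>h. h > 0 \<Longrightarrow> h < d \<Longrightarrow> r (?z + 0 *\<^sub>R (1, 0)) < r (?z + (0 - h) *\<^sub>R (1, 0))"
    using DERIV_neg_dec_left[of "\<lambda>s. r (?z + s *\<^sub>R (1, 0))"] by blast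
  have "open ((\<lambda>s. (s, u0)) -` W)" by (intro open_vimage W continuous_intros)
  moreover have "t0 \<in> (\<lambda>s. (s, u0)) -` W" using z0 by simp
  ultimately obtain e where e: "e > 0" "ball t0 e \<subseteq> (\<lambda>s. (s, u0)) -` W" by (rule openE)
  \<comment> \<open>Below \<open>d\<close> for the strict decrease, below \<open>e\<close> to stay
    in the patch, below \<open>t0\<close> to keep the time positive.\<close>
  define h where "h = min d (min e t0) / 2"
  have h: "0 < h" "h < d" "h < e" "h < t0" using d e z0 by (auto simp: h_def)
  have "(t0 - h, u0) \<in> W" using e h by (auto simp: subset_iff dist_real_def)
  from time_max[OF this] h have "r (t0 - h, u0) \<le> r (t0, u0)" by (simp add: r_def)
  then show False using d(2)[OF h(1,2)] by simp
qed

end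

subsection \<open>The maximum principle\<close>

context surface_flow
begin

definition "ratio t x = lambda2 \<kappa> A (X t) (\<nu> t) x / lambda1 \<kappa> A (X t) (\<nu> t) x"

lemma ratio_ge_1: "t \<in> I \<Longrightarrow> x \<in> M \<Longrightarrow> ratio t x \<ge> 1"
  using lambda_props(1,2)[of t x] by (simp add: ratio_def)

text \<open>Continuity is a local matter: \<open>?B\<close> is relatively open in
  \<open>I \<times> M\<close>, also at time 0, and on it the ratio is a quotient of continuous patch
  functions composed with the chart.\<close>

lemma continuous_ratio: "continuous_on (I \<times> M) (\<lambda>(t, x). ratio t x)"
  unfolding continuous_on_eq_continuous_within
proof
  fix z assume z: "z \<in> I \<times> M"
  obtain t x where tx: "z = (t, x)" "t \<in> I" "x \<in> M" using z by blast
  obtain c where c: "c \<in> A" "x \<in> fst c" using closed_surface_covered[OF M tx(3)] .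
  obtain W g where Wg: "flow_patch \<kappa> F \<alpha> M A T X \<nu> c W g" "(t, snd c x) \<in> W"
    using flow_patch_exists[OF tx(2) c] .
  interpret fp: flow_patch \<kappa> F \<alpha> M A T X \<nu> c W g by (rule Wg(1))
  define \<psi> where "\<psi> = (\<lambda>(s::real, y). (s, snd c y))"
  let ?C = "I \<times> fst c"
  let ?B = "?C \<inter> \<psi> -` W"
  have "continuous_on (fst c) (snd c)" using closed_surface_chart(4)[OF M c(1)] by (simp add: homeomorphism_def)
  then have "continuous_on ?C (\<lambda>z. snd c (snd z))"
    by (rule continuous_on_compose2[OF _ continuous_on_snd[OF continuous_on_id]]) auto
  then have \<psi>: "continuous_on ?C \<psi>"
    unfolding \<psi>_def split_beta by (rule continuous_on_Pair[OF continuous_on_fst[OF continuous_on_id]])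
  have "openin (top_of_set (I \<times> M)) ?C"
    using closed_surface_chart(2)[OF M c(1)] by (intro openin_Times) auto
  moreover have "openin (top_of_set ?C) ?B" by (rule continuous_openin_preimage_gen[OF \<psi> fp.W(1)])
  ultimately have "openin (top_of_set (I \<times> M)) ?B" by (rule openin_trans[rotated])
  then obtain V where V: "open V" "?B = (I \<times> M) \<inter> V" by (auto simp: openin_open)
  have zB: "z \<in> ?B" using tx c Wg(2) by (auto simp: \<psi>_def)
  have in_W: "\<psi> z \<in> W \<inter> {0..} \<times> UNIV" if "z \<in> ?B" for z
    using that by (auto simp: \<psi>_def mem_I)
  have eq: "fp.lam 1 (\<psi> z) / fp.lam (-1) (\<psi> z) = (case z of (t, x) \<Rightarrow> ratio t x)"
    and ne: "fp.lam (-1) (\<psi> z) \<noteq> 0" if z: "z \<in> ?B" for z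
  proof -
    obtain s y where sy: "z = (s, y)" "s \<in> I" "y \<in> fst c" using z by blast
    then have W: "(s, snd c y) \<in> W" "0 \<le> s" using in_W[OF z] by (auto simp: \<psi>_def)
    have "y \<in> M" using sy(3) closed_surface_chart(1)[OF M c(1)] by blast
    then show "fp.lam 1 (\<psi> z) / fp.lam (-1) (\<psi> z) = (case z of (t, x) \<Rightarrow> ratio t x)"
      "fp.lam (-1) (\<psi> z) \<noteq> 0"
      using fp.coefficients_pos(3,4)[OF W] chart_inv_into[OF M c(1) sy(3)] lambda_props(1)[OF sy(2) \<open>y \<in> M\<close>]
      by (auto simp: sy(1) \<psi>_def ratio_def)
  qed
  have "continuous_on ?B (\<lambda>z. fp.lam 1 (\<psi> z) / fp.lam (-1) (\<psi> z))"
    by (intro continuous_on_divide continuous_on_compose2[OF fp.continuous_lam continuous_on_subset[OF \<psi>]])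
      (use in_W ne in blast)+
  then have "continuous_on ?B (\<lambda>(t, x). ratio t x)"
    by (rule continuous_on_eq) (rule eq)
  then have "continuous (at z within ?B) (\<lambda>(t, x). ratio t x)"
    using zB unfolding continuous_on_eq_continuous_within by (rule bspec)
  moreover have "at z within ?B = at z within (I \<times> M)"
    by (rule at_within_nhd[of z V]) (use V zB in auto)
  ultimately show "continuous (at z within I \<times> M) (\<lambda>(t, x). ratio t x)" by simp
qed

lemma ratio_attains_max:
  assumes "t \<in> I"
  obtains s y where "0 \<le> s" "s \<le> t" "y \<in> M" "\<And>s' y'. 0 \<le> s' \<Longrightarrow> s' \<le> t \<Longrightarrow> y' \<in> M \<Longrightarrow> ratio s' y' \<le> ratio s y"
proof -
  have sub: "{0..t} \<times> M \<subseteq> I \<times> M" using I_downward[OF assms] by auto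
  have M': "compact M" "M \<noteq> {}" using M by (simp_all add: closed_surface_def)
  have "0 \<le> t" using assms by (simp add: mem_I)
  then have "{0..t} \<times> M \<noteq> {}" using M' by auto
  from continuous_attains_sup[OF compact_Times[OF compact_Icc M'(1)] this continuous_on_subset[OF continuous_ratio sub]]
  show thesis using that by fastforce
qed

lemma ratio_bound:
  assumes "t \<in> I" "x \<in> M"
  shows "\<exists>y\<in>M. ratio t x \<le> ratio 0 y"
proof -
  obtain s y where sy: "0 \<le> s" "s \<le> t" "y \<in> M"
    and max: "\<And>s' y'. 0 \<le> s' \<Longrightarrow> s' \<le> t \<Longrightarrow> y' \<in> M \<Longrightarrow> ratio s' y' \<le> ratio s y"
    using ratio_attains_max[OF assms(1)] by blast
  have s: "s \<in> I" using I_downward[OF assms(1) sy(1,2)] .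
  have "ratio t x \<le> ratio s y" using max assms by (simp add: mem_I)
  \<comment> \<open>It suffices to compare with the same point y at time 0.\<close>
  also have "ratio s y \<le> ratio 0 y"
  proof (rule ccontr)
    assume less: "\<not> ratio s y \<le> ratio 0 y"
    then have s0: "s > 0" using sy(1) by (cases "s = 0") auto
    have gt: "ratio s y > 1" using less ratio_ge_1[OF zero_in_I sy(3)] by simp
    obtain c where c: "c \<in> A" "y \<in> fst c" using closed_surface_covered[OF M sy(3)] .
    obtain W g where Wg: "flow_patch \<kappa> F \<alpha> M A T X \<nu> c W g" "(s, snd c y) \<in> W"
      using flow_patch_exists[OF s c] .
    interpret fp: flow_patch \<kappa> F \<alpha> M A T X \<nu> c W g by (rule Wg(1))
    have y: "inv_into (fst c) (snd c) (snd c y) = y" by (rule chart_inv_into[OF M c])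
    have lam: "fp.lam 1 (s', u) / fp.lam (-1) (s', u) = ratio s' (inv_into (fst c) (snd c) u)"
      if "(s', u) \<in> W" "0 \<le> s'" for s' u
      using fp.coefficients_pos(3,4)[OF that] by (simp add: ratio_def)
    have "fp.lam (-1) (s, snd c y) < fp.lam 1 (s, snd c y)"
      using gt fp.coefficients_pos(3,4)[OF Wg(2) sy(1)] lambda_props(1)[OF s sy(3)] by (simp add: y ratio_def)
    then show False
    proof (rule fp.ratio_no_interior_max[OF Wg(2) s0])
      show "fp.lam 1 (s, u) / fp.lam (-1) (s, u) \<le> fp.lam 1 (s, snd c y) / fp.lam (-1) (s, snd c y)"
        if "(s, u) \<in> W" for u
        using max[OF sy(1,2) fp.patch_point(4)[OF that sy(1)]] lam that Wg(2) sy(1) y by simp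
      show "fp.lam 1 (s', snd c y) / fp.lam (-1) (s', snd c y) \<le> fp.lam 1 (s, snd c y) / fp.lam (-1) (s, snd c y)"
        if "(s', snd c y) \<in> W" "0 \<le> s'" "s' \<le> s" for s'
        using max[OF that(2) _ sy(3)] lam that Wg(2) sy(1,2) y by simp
    qed
  qed
  finally show ?thesis using sy(3) by blast
qed

text \<open>The attained maximum over the degenerate time interval from 0 to 0.\<close>

lemma ratio_initially_bounded: "\<exists>C. \<forall>x\<in>M. ratio 0 x \<le> C"
  using ratio_attains_max[OF zero_in_I] by (metis order_refl order_antisym)

lemma pinching_ratio_bound:
  assumes "t \<in> I"
  shows "pinching_ratio \<kappa> M A (X t) (\<nu> t) \<le> pinching_ratio \<kappa> M A (X 0) (\<nu> 0)"
  unfolding pinching_ratio_def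
proof (rule SUP_least)
  fix x assume "x \<in> M"
  then obtain y where "y \<in> M" "ratio t x \<le> ratio 0 y" using ratio_bound[OF assms] by blast
  then show "ereal (lambda2 \<kappa> A (X t) (\<nu> t) x / lambda1 \<kappa> A (X t) (\<nu> t) x)
      \<le> (SUP x\<in>M. ereal (lambda2 \<kappa> A (X 0) (\<nu> 0) x / lambda1 \<kappa> A (X 0) (\<nu> 0) x))"
    by (intro SUP_upper2[of y]) (simp_all add: ratio_def)
qed

end

section \<open>Dependence of the constant on the initial surface alone\<close>

lemma unit_normal_unique_up_to_sign:
  assumes "surface_point \<kappa> M A X \<nu> c x" "unit_normal \<kappa> M A X \<nu>'"
  shows "\<nu>' x = \<nu> x \<or> \<nu>' x = - \<nu> x"
proof -
  interpret p: surface_point \<kappa> M A X \<nu> c x by (rule assms(1))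
  interpret q: surface_point \<kappa> M A X \<nu>' c x
    using p.\<kappa> p.M p.c p.immersion assms(2) by unfold_locales auto
  let ?k = "sf_inner \<kappa> (\<nu>' x) (\<nu> x)"
  \<comment> \<open>What remains of \<nu>' after removing its component along \<nu> is orthogonal to
    the tangent plane of the surface and to \<nu>, hence zero.\<close>
  have "\<nu>' x - ?k *\<^sub>R \<nu> x = 0"
    by (rule sf_orthogonal_complement_trivial[OF p.\<kappa> p.point_space_form p.radial_y p.radial_y p.normal_at_point(1) _
          p.independent p.normal_at_point(2) p.normal_at_point(3) p.normal_at_point(3)])
      (simp_all add: sf_radial_simps sf_inner_simps p.normal_at_point q.normal_at_point
        sf_inner_commute[of \<kappa> "\<nu>' x" "p.y _"] sf_inner_commute[of \<kappa> "\<nu> x" "p.y _"])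
  then have eq: "\<nu>' x = ?k *\<^sub>R \<nu> x" by simp
  have "sf_inner \<kappa> (?k *\<^sub>R \<nu> x) (?k *\<^sub>R \<nu> x) = 1" using q.normal_at_point(2) eq by simp
  then have "?k * ?k = 1" by (simp add: sf_inner_simps p.normal_at_point)
  then have "?k = 1 \<or> ?k = -1" by (simp add: square_eq_1_iff)
  then show ?thesis using eq by (metis scaleR_minus1_left scaleR_one)
qed

text \<open>Two flows with the same initial surface may come with different normals at time 0, but reversing the
  normal would make the principal curvatures negative. Hence \<open>\<beta>\<close> depends on the initial surface only.\<close>

lemma initial_ratio_unique:
  assumes "surface_flow \<kappa> F \<alpha> M A T X \<nu>" "surface_flow \<kappa> F' \<alpha>' M A T' X' \<nu>'"
    and X0: "\<And>x. x \<in> M \<Longrightarrow> X' 0 x = X 0 x" and x: "x \<in> M"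
  shows "surface_flow.ratio \<kappa> A X' \<nu>' 0 x = surface_flow.ratio \<kappa> A X \<nu> 0 x"
proof -
  interpret f: surface_flow \<kappa> F \<alpha> M A T X \<nu> by (rule assms(1))
  interpret f': surface_flow \<kappa> F' \<alpha>' M A T' X' \<nu>' by (rule assms(2))
  obtain c where c: "c \<in> A" "x \<in> fst c" using closed_surface_covered[OF f.M x] .
  note p0 = f.surface_point_at[OF f.zero_in_I c]
  interpret p: surface_point \<kappa> M A "X 0" "\<nu> 0" c x by (rule p0)
  interpret q: surface_point \<kappa> M A "X' 0" "\<nu>' 0" c x by (rule f'.surface_point_at[OF f'.zero_in_I c])
  have Y: "local_param (X' 0) d v = local_param (X 0) d v" if d: "d \<in> A" and v: "v \<in> snd d ` fst d" for d v
  proof -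
    have "inv_into (fst d) (snd d) v \<in> M" using inv_into_into[OF v] closed_surface_chart(1)[OF f.M d] by blast
    then show ?thesis using X0 by (simp add: local_param_def)
  qed
  have partial_eq: "partial i (local_param (X' 0) d) v = partial i (local_param (X 0) d) v"
    if "d \<in> A" "v \<in> snd d ` fst d" for d v i
    unfolding partial_def
    using frechet_derivative_cong_open[OF closed_surface_chart(3)[OF f.M that(1)] that(2) Y[OF that(1)]] by simp
  have y: "q.y i = p.y i" and yy: "q.yy i j = p.yy i j" for i j
  proof -
    show "q.y i = p.y i" by (rule partial_eq[OF c(1) p.u])
    have "frechet_derivative (partial j q.Y) (at p.u) = frechet_derivative (partial j p.Y) (at p.u)"
      by (rule frechet_derivative_cong_open[OF p.open_S p.u partial_eq[OF c(1)]])
    then show "q.yy i j = p.yy i j" by (simp add: partial_def[of _ "partial j _"])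
  qed
  have "unit_normal \<kappa> M A (X 0) (\<nu>' 0)"
    using f'.flow_at(2)[OF f'.zero_in_I] X0 partial_eq closed_surface_chart(1)[OF f.M]
    unfolding unit_normal_def by (metis imageI)
  from unit_normal_unique_up_to_sign[OF p0 this] show ?thesis
  proof
    assume "\<nu>' 0 x = \<nu> 0 x"
    then show ?thesis
      unfolding f.ratio_def f'.ratio_def p.lambda_eq q.lambda_eq y yy by simp
  next
    assume neg: "\<nu>' 0 x = - \<nu> 0 x"
    let ?l = "lambda1 \<kappa> A (X' 0) (\<nu>' 0) x"
    have l: "?l > 0" by (rule f'.lambda_props(1)[OF f'.zero_in_I x])
    \<comment> \<open>The second fundamental form changes sign with the normal, so an eigenvector
      for \<open>?l\<close> becomes one for \<open>- ?l\<close>, against strict convexity.\<close>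
    have "\<exists>v. v \<noteq> 0 \<and> q.eigenpair ?l v" unfolding q.eigenpair_root by (simp add: q.lambda_eq)
    then have "\<exists>v. v \<noteq> 0 \<and> p.eigenpair (- ?l) v"
      unfolding p.eigenpair_def q.eigenpair_def y yy neg by (auto simp: sf_inner_simps algebra_simps)
    then have "- ?l \<in> principal_curvatures \<kappa> A (X 0) (\<nu> 0) x"
      unfolding p.eigenpair_root p.principal_curvatures_eq by blast
    then have "- ?l > 0" using f.flow_at(3)[OF f.zero_in_I] x unfolding strictly_convex_def by blast
    then show ?thesis using l by simp
  qed
qed

theorem proposition3p2:
  fixes \<kappa> :: real and M :: "'m::t2_space set" and A :: "'m chart set" and X\<^sub>0 :: "'m \<Rightarrow> ambient"
  assumes "\<kappa> \<in> {0, 1, -1}" and "closed_surface M A"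
  shows "\<exists>\<beta>>1. \<forall>F \<alpha> T X \<nu>.
    curvature_function F \<and> admissible_exponent \<kappa> \<alpha> \<and> expanding_flow \<kappa> F \<alpha> M A T X \<nu> \<and>
    (\<forall>x\<in>M. X 0 x = X\<^sub>0 x) \<longrightarrow>
    (\<forall>t\<in>time_interval T.
       pinching_ratio \<kappa> M A (X t) (\<nu> t) \<le> pinching_ratio \<kappa> M A (X 0) (\<nu> 0) \<and>
       (\<forall>x\<in>M. lambda2 \<kappa> A (X t) (\<nu> t) x \<le> \<beta> * lambda1 \<kappa> A (X t) (\<nu> t) x))"
proof -
  let ?flow = "\<lambda>F \<alpha> T X \<nu>. curvature_function F \<and> admissible_exponent \<kappa> \<alpha> \<and>
    expanding_flow \<kappa> F \<alpha> M A T X \<nu> \<and> (\<forall>x\<in>M. X 0 x = X\<^sub>0 x)"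
  have flowI: "surface_flow \<kappa> F \<alpha> M A T X \<nu>" if "?flow F \<alpha> T X \<nu>" for F \<alpha> T X \<nu>
    using assms that by unfold_locales auto
  show ?thesis
  \<comment> \<open>The constant must be fixed before the flow is given. If no flow starts from the
    surface, any number above 1 will do; otherwise one such flow provides the initial ratio that all
    of them share.\<close>
  proof (cases "\<exists>F \<alpha> T X \<nu>. ?flow F \<alpha> T X \<nu>")
    case False
    then show ?thesis by (intro exI[of _ 2] conjI) (simp, blast)
  next
    case True
    then obtain F\<^sub>0 \<alpha>\<^sub>0 T\<^sub>0 X\<^sub>1 \<nu>\<^sub>0 where f0: "?flow F\<^sub>0 \<alpha>\<^sub>0 T\<^sub>0 X\<^sub>1 \<nu>\<^sub>0" by blast
    interpret f0: surface_flow \<kappa> F\<^sub>0 \<alpha>\<^sub>0 M A T\<^sub>0 X\<^sub>1 \<nu>\<^sub>0 by (rule flowI[OF f0])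
    obtain C where C: "\<And>x. x \<in> M \<Longrightarrow> f0.ratio 0 x \<le> C" using f0.ratio_initially_bounded by blast
    show ?thesis
    \<comment> \<open>The constant exceeds 1 strictly even if the initial surface is totally
      umbilic, where the ratio is 1.\<close>
    proof (intro exI[of _ "max 1 C + 1"] conjI allI impI ballI)
      show "1 < max 1 C + 1" by simp
      fix F \<alpha> T X \<nu> t assume f: "?flow F \<alpha> T X \<nu>" and t: "t \<in> time_interval T"
      interpret f: surface_flow \<kappa> F \<alpha> M A T X \<nu> by (rule flowI[OF f])
      show "pinching_ratio \<kappa> M A (X t) (\<nu> t) \<le> pinching_ratio \<kappa> M A (X 0) (\<nu> 0)"
        by (rule f.pinching_ratio_bound[OF t])
      fix x assume x: "x \<in> M"
      obtain y where y: "y \<in> M" "f.ratio t x \<le> f.ratio 0 y" using f.ratio_bound[OF t x] by blast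
      have "f.ratio 0 y = f0.ratio 0 y"
        by (rule initial_ratio_unique[OF flowI[OF f0] flowI[OF f] _ y(1)]) (use f f0 in auto)
      then have "f.ratio t x \<le> max 1 C + 1" using y(2) C[OF y(1)] by simp
      then show "lambda2 \<kappa> A (X t) (\<nu> t) x \<le> (max 1 C + 1) * lambda1 \<kappa> A (X t) (\<nu> t) x"
        using f.lambda_props(1)[OF t x] by (simp add: f.ratio_def pos_divide_le_eq)
    qed
  qed
qed

end
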